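(* Let $\omega\subset\mathbb{R}^2$ be a bounded Lipschitz domain, and let $\overline{Q}_2$, $\mathcal{L}_0,\mathcal{L}_1$ and the constants $E_0,F_0\in\mathbb{R}^{2\times2}_{\rm sym}$ be as defined in the context. Let $$\mathcal{I}_{\rm lvK}(u,v)=\frac12\int_\omega \overline{Q}_2[\nabla_s u,-\nabla^2 v]\,dx\quad\text{if }(u,v)\in W^{1,2}(\omega;\mathbb{R}^2)\times W^{2,2}(\omega;\mathbb{R}),$$ and $\mathcal{I}_{\rm lvK}(u,v)=\infty$ otherwise. The minimisers of $\mathcal{I}_{\rm lvK}$ are of the form $$u(x)=(\mathcal{L}_0^{-1}\mathcal{L}_1F_0+E_0)\,x\quad\text{and}\quad v(x)=\tfrac12 x^\top F_0x .$$ Here $u$ is unique up to an infinitesimal rigid motion and $v$ is unique up to the addition of an affine transformation.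
   Context: $\nabla_s u=\frac12(\nabla u+\nabla u^\top)$ is the symmetrised gradient. An infinitesimal rigid motion is a map $x\mapsto Rx+c$ with $R\in\mathbb{R}^{2\times2}$ antisymmetric and $c\in\mathbb{R}^2$. Data: for a.e. $t\in(-1/2,1/2)$, $Q_2(t,\cdot)$ is a quadratic form on $\mathbb{R}^{2\times2}$ vanishing on antisymmetric matrices, and there are constants $c,C>0$ such that for a.e. $t$: $Q_2(t,G)\le C|G|^2$ for all $G\in\mathbb{R}^{2\times 2}$ and $Q_2(t,G)\ge c|G|^2$ for all $G\in\mathbb{R}^{2\times2}_{\rm sym}$. Moreover $\check B\in L^\infty((-1/2,1/2);\mathbb{R}^{2\times2}_{\rm sym})$. Set $$\overline{Q}_2[E,F]=\int_{-1/2}^{1/2}Q_2(t,E+tF+\check B(t))\,dt .$$ Identify $A\in\mathbb{R}^{2\times2}_{\rm sym}$ with $a=(A_{11},A_{22},A_{12})\in\mathbb{R}^3$ (and likewise $\check B(t)$ with $b(t)$). Let $M(t)\in\mathbb{R}^{3\times3}$ be the symmetric positive definite matrix with $Q_2(t,A)=a^\top M(t)a$ for all $A\in\mathbb{R}^{2\times2}_{\rm sym}$. Put $M_i=\int_{-1/2}^{1/2}t^iM(t)\,dt$ for $i=0,1,2$ and $M^*=M_2-M_1M_0^{-1}M_1$; $M_0$ and $M^*$ are positive definite. Let $\mathcal{L}_i$ and $\mathcal{L}_*$ be the linear maps on $\mathbb{R}^{2\times2}_{\rm sym}$ corresponding, under the identification, to $M_i$ and $M^*$. Let $B_1,B_2\in\mathbb{R}^{2\times2}_{\rm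 sym}$ be the matrices corresponding to $b_1=\int_{-1/2}^{1/2}M(t)b(t)\,dt$ and $b_2=\int_{-1/2}^{1/2}tM(t)b(t)\,dt$. Finally, $$F_0=\mathcal{L}_*^{-1}(\mathcal{L}_1\mathcal{L}_0^{-1}B_1-B_2),\qquad E_0=\mathcal{L}_0^{-1}B_1 .$$
   Formalization: Both signs of the minimisers are corrected: u(x) = -(L_0^{-1}L_1F_0+E_0)x and v(x) = -½ xᵀF_0x. With plus signs the claim fails, e.g. for Q_2(t,G)=|sym G|² and constant prestrain equal to the identity, where the minimiser is u(x) = -x. *)

theory Defs
  imports "HOL-Analysis.Analysis"
begin

section \<open>Sobolev functions on planar domains\<close>

definition lipschitz_domain :: "(real^2) set \<Rightarrow> bool" where
  "lipschitz_domain \<Omega> \<longleftrightarrow> open \<Omega> \<and> connected \<Omega> \<and> \<Omega> \<noteq> {} \<and>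
     (\<forall>p\<in>frontier \<Omega>. \<exists>r>0. \<exists>(T :: real^2 \<Rightarrow> real^2) (\<gamma> :: real \<Rightarrow> real) L. orthogonal_transformation T \<and> L-lipschitz_on UNIV \<gamma> \<and>
        (\<forall>x\<in>ball p r. x \<in> \<Omega> \<longleftrightarrow> \<gamma> (T x $ 1) < T x $ 2))"

definition partial_deriv :: "2 \<Rightarrow> (real^2 \<Rightarrow> real) \<Rightarrow> real^2 \<Rightarrow> real" where
  "partial_deriv i f x = frechet_derivative f (at x) (axis i 1)"

text \<open>Iterated partial derivatives are indexed by the list of directions:
  \<open>partials [i, j] f\<close> is the derivative of \<open>f\<close> first in direction \<open>j\<close>, then in direction \<open>i\<close>.\<close>

definition partials :: "2 list \<Rightarrow> (real^2 \<Rightarrow> real) \<Rightarrow> real^2 \<Rightarrow> real" where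
  "partials is f = foldr partial_deriv is f"

text \<open>The class of test functions is \<open>C_c^\<infinity>(\<Omega>)\<close>; differentiability of all iterated partial
  derivatives entails their continuity.\<close>

definition test_function :: "(real^2) set \<Rightarrow> (real^2 \<Rightarrow> real) \<Rightarrow> bool" where
  "test_function \<Omega> \<phi> \<longleftrightarrow>
     (\<forall>is x. partials is \<phi> differentiable (at x)) \<and>
     (\<exists>K. compact K \<and> K \<subseteq> \<Omega> \<and> (\<forall>x. x \<notin> K \<longrightarrow> \<phi> x = 0))"

definition locally_integrable :: "(real^2) set \<Rightarrow> (real^2 \<Rightarrow> real) \<Rightarrow> bool" where
  "locally_integrable \<Omega> f \<longleftrightarrow> (\<forall>K. compact K \<and> K \<subseteq> \<Omega> \<longrightarrow> integrable (lebesgue_on K) f)"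

definition is_weak_deriv ::
  "(real^2) set \<Rightarrow> 2 list \<Rightarrow> (real^2 \<Rightarrow> real) \<Rightarrow> (real^2 \<Rightarrow> real) \<Rightarrow> bool" where
  "is_weak_deriv \<Omega> is f g \<longleftrightarrow> locally_integrable \<Omega> f \<and> locally_integrable \<Omega> g \<and>
     (\<forall>\<phi>. test_function \<Omega> \<phi> \<longrightarrow>
        (\<integral>x. f x * partials is \<phi> x \<partial>lebesgue_on \<Omega>) =
        (- 1) ^ length is * (\<integral>x. g x * \<phi> x \<partial>lebesgue_on \<Omega>))"

text \<open>A representative of the weak derivative, which is unique only almost everywhere.\<close>

definition weak_deriv :: "(real^2) set \<Rightarrow> 2 list \<Rightarrow> (real^2 \<Rightarrow> real) \<Rightarrow> real^2 \<Rightarrow> real" where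
  "weak_deriv \<Omega> is f = (SOME g. is_weak_deriv \<Omega> is f g)"

definition L2_on :: "(real^2) set \<Rightarrow> (real^2 \<Rightarrow> real) \<Rightarrow> bool" where
  "L2_on \<Omega> f \<longleftrightarrow> f \<in> borel_measurable (lebesgue_on \<Omega>) \<and> integrable (lebesgue_on \<Omega>) (\<lambda>x. (f x)\<^sup>2)"

text \<open>The space \<open>W^{k,2}(\<Omega>)\<close>, as a set of representatives.\<close>

definition sobolev2 :: "nat \<Rightarrow> (real^2) set \<Rightarrow> (real^2 \<Rightarrow> real) set" where
  "sobolev2 k \<Omega> = {f. L2_on \<Omega> f \<and>
     (\<forall>is. length is \<le> k \<longrightarrow> (\<exists>g. L2_on \<Omega> g \<and> is_weak_deriv \<Omega> is f g))}"

definition weak_grad :: "(real^2) set \<Rightarrow> (real^2 \<Rightarrow> real^2) \<Rightarrow> real^2 \<Rightarrow> real^2^2" where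
  "weak_grad \<Omega> u x = (\<chi> i j. weak_deriv \<Omega> [j] (\<lambda>y. u y $ i) x)"

definition sym_grad :: "(real^2) set \<Rightarrow> (real^2 \<Rightarrow> real^2) \<Rightarrow> real^2 \<Rightarrow> real^2^2" where
  "sym_grad \<Omega> u x = (1/2) *\<^sub>R (weak_grad \<Omega> u x + transpose (weak_grad \<Omega> u x))"

definition weak_hessian :: "(real^2) set \<Rightarrow> (real^2 \<Rightarrow> real) \<Rightarrow> real^2 \<Rightarrow> real^2^2" where
  "weak_hessian \<Omega> v x = (\<chi> i j. weak_deriv \<Omega> [i, j] v x)"

section \<open>The energy\<close>

definition symmetric_matrices :: "(real^'n^'n) set" where
  "symmetric_matrices = {A. transpose A = A}"

definition quadratic_form :: "('a::real_vector \<Rightarrow> real) \<Rightarrow> bool" where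
  "quadratic_form q \<longleftrightarrow> (\<exists>\<beta>. bilinear \<beta> \<and> (\<forall>x y. \<beta> x y = \<beta> y x) \<and> (\<forall>x. q x = \<beta> x x))"

definition thickness :: "real set" where
  "thickness = {- 1/2 <..< 1/2}"

text \<open>Throughout, \<open>Q t G\<close> is the quadratic form \<open>Q\<^sub>2(t, G)\<close> and \<open>B t\<close> is the prestrain.
  The norm of \<open>real^2^2\<close> is the Frobenius norm.\<close>

definition Q2bar ::
  "(real \<Rightarrow> real^2^2 \<Rightarrow> real) \<Rightarrow> (real \<Rightarrow> real^2^2) \<Rightarrow> real^2^2 \<Rightarrow> real^2^2 \<Rightarrow> real" where
  "Q2bar Q B E F = (\<integral>t. Q t (E + t *\<^sub>R F + B t) \<partial>lebesgue_on thickness)"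

definition I_lvK ::
  "(real^2) set \<Rightarrow> (real \<Rightarrow> real^2^2 \<Rightarrow> real) \<Rightarrow> (real \<Rightarrow> real^2^2) \<Rightarrow>
   (real^2 \<Rightarrow> real^2) \<Rightarrow> (real^2 \<Rightarrow> real) \<Rightarrow> ereal" where
  "I_lvK \<omega> Q B u v =
     (if (\<forall>i. (\<lambda>x. u x $ i) \<in> sobolev2 1 \<omega>) \<and> v \<in> sobolev2 2 \<omega>
      then ereal (1/2 * (\<integral>x. Q2bar Q B (sym_grad \<omega> u x) (- weak_hessian \<omega> v x) \<partial>lebesgue_on \<omega>))
      else \<infinity>)"

section \<open>The matrices and constants describing the minimisers\<close>

definition vec_of_sym :: "real^2^2 \<Rightarrow> real^3" where
  "vec_of_sym A = vector [A$1$1, A$2$2, A$1$2]"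

definition sym_of_vec :: "real^3 \<Rightarrow> real^2^2" where
  "sym_of_vec a = vector [vector [a$1, a$3], vector [a$3, a$2]]"

definition M_of :: "(real \<Rightarrow> real^2^2 \<Rightarrow> real) \<Rightarrow> real \<Rightarrow> real^3^3" where
  "M_of Q t = (THE M. M \<in> symmetric_matrices \<and> (\<forall>a. a \<noteq> 0 \<longrightarrow> 0 < a \<bullet> (M *v a)) \<and>
     (\<forall>A\<in>symmetric_matrices. Q t A = vec_of_sym A \<bullet> (M *v vec_of_sym A)))"

definition M_mom :: "(real \<Rightarrow> real^2^2 \<Rightarrow> real) \<Rightarrow> nat \<Rightarrow> real^3^3" where
  "M_mom Q i = (\<integral>t. t ^ i *\<^sub>R M_of Q t \<partial>lebesgue_on thickness)"

definition M_star :: "(real \<Rightarrow> real^2^2 \<Rightarrow> real) \<Rightarrow> real^3^3" where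
  "M_star Q = M_mom Q 2 - M_mom Q 1 ** matrix_inv (M_mom Q 0) ** M_mom Q 1"

definition sym_map :: "real^3^3 \<Rightarrow> real^2^2 \<Rightarrow> real^2^2" where
  "sym_map N A = sym_of_vec (N *v vec_of_sym A)"

abbreviation L_map :: "(real \<Rightarrow> real^2^2 \<Rightarrow> real) \<Rightarrow> nat \<Rightarrow> real^2^2 \<Rightarrow> real^2^2" where
  "L_map Q i \<equiv> sym_map (M_mom Q i)"

abbreviation L_star :: "(real \<Rightarrow> real^2^2 \<Rightarrow> real) \<Rightarrow> real^2^2 \<Rightarrow> real^2^2" where
  "L_star Q \<equiv> sym_map (M_star Q)"

abbreviation inv_sym :: "(real^2^2 \<Rightarrow> real^2^2) \<Rightarrow> real^2^2 \<Rightarrow> real^2^2" where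
  "inv_sym \<equiv> inv_into symmetric_matrices"

text \<open>\<open>B_mom Q B 0\<close> and \<open>B_mom Q B 1\<close> are the matrices usually called \<open>B\<^sub>1\<close> and \<open>B\<^sub>2\<close>.\<close>

definition B_mom ::
  "(real \<Rightarrow> real^2^2 \<Rightarrow> real) \<Rightarrow> (real \<Rightarrow> real^2^2) \<Rightarrow> nat \<Rightarrow> real^2^2" where
  "B_mom Q B i =
     sym_of_vec (\<integral>t. t ^ i *\<^sub>R (M_of Q t *v vec_of_sym (B t)) \<partial>lebesgue_on thickness)"

text \<open>The minimiser \<open>(E, F)\<close> of \<open>Q2bar Q B\<close> over pairs of symmetric matrices solves
  \<open>L\<^sub>0 E + L\<^sub>1 F + B\<^sub>1 = 0\<close> and \<open>L\<^sub>1 E + L\<^sub>2 F + B\<^sub>2 = 0\<close>, so that \<open>F = F\<^sub>0\<close> and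
  \<open>E = - (L\<^sub>0\<^sup>-\<^sup>1 L\<^sub>1 F\<^sub>0 + E\<^sub>0)\<close>. Since \<open>F\<close> stands for minus the Hessian of \<open>v\<close>, both the optimal
  symmetrised gradient \<open>- (L\<^sub>0\<^sup>-\<^sup>1 L\<^sub>1 F\<^sub>0 + E\<^sub>0)\<close> and the optimal Hessian \<open>- F\<^sub>0\<close> carry a minus sign.\<close>

definition F_zero ::
  "(real \<Rightarrow> real^2^2 \<Rightarrow> real) \<Rightarrow> (real \<Rightarrow> real^2^2) \<Rightarrow> real^2^2" where
  "F_zero Q B =
     inv_sym (L_star Q) (L_map Q 1 (inv_sym (L_map Q 0) (B_mom Q B 0)) - B_mom Q B 1)"

definition E_zero ::
  "(real \<Rightarrow> real^2^2 \<Rightarrow> real) \<Rightarrow> (real \<Rightarrow> real^2^2) \<Rightarrow> real^2^2" where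
  "E_zero Q B = inv_sym (L_map Q 0) (B_mom Q B 0)"

definition infinitesimal_rigid_motion :: "(real^2 \<Rightarrow> real^2) \<Rightarrow> bool" where
  "infinitesimal_rigid_motion r \<longleftrightarrow>
     (\<exists>R::real^2^2. \<exists>c. transpose R = - R \<and> r = (\<lambda>x. R *v x + c))"

definition affine_function :: "(real^2 \<Rightarrow> real) \<Rightarrow> bool" where
  "affine_function l \<longleftrightarrow> (\<exists>p d. l = (\<lambda>x. p \<bullet> x + d))"

end

theory Submission
  imports Defs "HOL-Real_Asymp.Real_Asymp"
begin

text \<open>The integrand is minimised pointwise. For symmetric \<open>E\<close>, \<open>F\<close> the averaged density equals its
  value at the critical point \<open>(E_opt, F_zero)\<close> plus a quadratic form \<open>W\<close> in the
  deviation, and \<open>W\<close> is the integral over the thickness of the positive definite form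
  \<open>Q t\<close> at \<open>D + t \<cdot> H\<close>, so it vanishes only if \<open>D = H = 0\<close>.
  Hence a pair is minimal iff its symmetrised gradient and its Hessian are the optimal constants
  almost everywhere. That this determines \<open>u\<close> up to a rigid motion and \<open>v\<close> up to an affine function
  reduces to the statement that a locally integrable function with vanishing weak gradient on a
  connected open set is constant almost everywhere.

  The latter and the uniqueness of weak derivatives need only test functions of the form
  \<open>a(x\<^sub>1) b(x\<^sub>2)\<close>: bump functions converging to the indicator of an interval
  give the integral over boxes, and writing \<open>a = \<alpha> e + A'\<close> for a fixed bump \<open>e\<close> reduces a
  functional that kills derivatives to its value on \<open>e(x\<^sub>1) e(x\<^sub>2)\<close>. For such products mixed
  partial derivatives commute trivially.\<close>

section \<open>Smooth functions of one variable\<close>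

text \<open>Existence of minimisers comes with the pointwise analysis: the optimal constants are
  realised as symmetrised gradient and Hessian of a linear map and a quadratic polynomial, so the
  pointwise lower bound is attained. Two conventions shape the rest. A Bochner integral of a
  non-integrable function is 0, so energies can be compared only after the excess over the minimum
  is shown to be integrable; with \<open>W\<close> written through the moments
  \<open>M_mom Q k\<close>, the excess is a fixed quadratic polynomial in L2 functions. And
  \<open>weak_deriv\<close> picks a representative separately for each list of directions, so the
  Hessian is symmetric only almost everywhere; as the lower bound on \<open>Q t\<close> concerns
  symmetric matrices, this symmetry must be established before the expansion around the critical
  point applies to it. Invertibility of \<open>M_mom Q 0\<close> and of \<open>M_star Q\<close> is
  derived: both follow from \<open>W\<close> vanishing only at the origin.\<close>

primrec times_diff :: "nat \<Rightarrow> (real \<Rightarrow> real) \<Rightarrow> bool" where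
  "times_diff 0 f \<longleftrightarrow> True"
| "times_diff (Suc n) f \<longleftrightarrow>
     (\<exists>f'. (\<forall>x. (f has_real_derivative f' x) (at x)) \<and> times_diff n f')"

text \<open>Quantifying over finite orders makes each closure property an induction on the order,
  generalised over the functions; the existential derivative in \<open>times_diff\<close> lets the
  induction supply its own witness.\<close>

definition smooth :: "(real \<Rightarrow> real) \<Rightarrow> bool" where
  "smooth f \<longleftrightarrow> (\<forall>n. times_diff n f)"

lemma times_diff_mono: "times_diff n f \<Longrightarrow> m \<le> n \<Longrightarrow> times_diff m f"
proof (induction m arbitrary: n f)
  case (Suc m)
  then obtain k where "n = Suc k" by (cases n) auto
  with Suc show ?case by auto
qed simp

lemma times_diff_add: "times_diff n f \<Longrightarrow> times_diff n g \<Longrightarrow> times_diff n (\<lambda>x. f x + g x)"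
proof (induction n arbitrary: f g)
  case (Suc n)
  then obtain f' g' where "\<forall>x. (f has_real_derivative f' x) (at x)" "times_diff n f'"
    "\<forall>x. (g has_real_derivative g' x) (at x)" "times_diff n g'" by auto
  then show ?case using Suc.IH
    by (auto intro!: exI[of _ "\<lambda>x. f' x + g' x"] derivative_eq_intros)
qed simp

lemma times_diff_mult: "times_diff n f \<Longrightarrow> times_diff n g \<Longrightarrow> times_diff n (\<lambda>x. f x * g x)"
proof (induction n arbitrary: f g)
  case (Suc n)
  then obtain f' g' where *: "\<forall>x. (f has_real_derivative f' x) (at x)" "times_diff n f'"
    "\<forall>x. (g has_real_derivative g' x) (at x)" "times_diff n g'" by auto
  \<comment> \<open>The product rule also contains the undifferentiated factors, which have to be
    lowered to order \<open>n\<close> for the induction hypothesis.\<close>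
  have "times_diff n f" "times_diff n g" using Suc.prems by (auto intro: times_diff_mono[of "Suc n"] simp del: times_diff.simps)
  with * Suc.IH have "times_diff n (\<lambda>x. f' x * g x + f x * g' x)"
    by (intro times_diff_add) auto
  with * show ?case
    by (auto intro!: exI[of _ "\<lambda>x. f' x * g x + f x * g' x"] derivative_eq_intros)
qed simp

lemma times_diff_const: "times_diff n (\<lambda>x. c)"
  by (induction n arbitrary: c) (auto intro!: exI[of _ "\<lambda>x. 0"] derivative_eq_intros)

lemma times_diff_ident: "times_diff n (\<lambda>x. x)"
  by (cases n) (auto intro!: exI[of _ "\<lambda>x. 1"] derivative_eq_intros times_diff_const)

lemma times_diff_comp: "times_diff n f \<Longrightarrow> times_diff n g \<Longrightarrow> times_diff n (\<lambda>x. f (g x))"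
proof (induction n arbitrary: f g)
  case (Suc n)
  then obtain f' g' where *: "\<forall>x. (f has_real_derivative f' x) (at x)" "times_diff n f'"
    "\<forall>x. (g has_real_derivative g' x) (at x)" "times_diff n g'" by auto
  have "times_diff n g" using Suc.prems by (auto intro: times_diff_mono[of "Suc n"] simp del: times_diff.simps)
  with * Suc.IH have "times_diff n (\<lambda>x. f' (g x) * g' x)"
    by (intro times_diff_mult) auto
  with * show ?case
    by (intro times_diff.simps(2)[THEN iffD2] exI[of _ "\<lambda>x. f' (g x) * g' x"]) (blast intro: DERIV_chain2)
qed simp

lemma smooth_add: "smooth f \<Longrightarrow> smooth g \<Longrightarrow> smooth (\<lambda>x. f x + g x)"
  and smooth_mult: "smooth f \<Longrightarrow> smooth g \<Longrightarrow> smooth (\<lambda>x. f x * g x)"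
  and smooth_const: "smooth (\<lambda>x. c)"
  and smooth_ident: "smooth (\<lambda>x. x)"
  and smooth_comp: "smooth f \<Longrightarrow> smooth g \<Longrightarrow> smooth (\<lambda>x. f (g x))"
  by (auto simp: smooth_def times_diff_add times_diff_mult times_diff_const times_diff_ident times_diff_comp)

lemma smooth_diff: "smooth f \<Longrightarrow> smooth g \<Longrightarrow> smooth (\<lambda>x. f x - g x)"
  using smooth_add[of f "\<lambda>x. (- 1) * g x"] smooth_mult[OF smooth_const[of "-1"], of g] by simp

text \<open>Each order provides its own witness for the derivative. Uniqueness of derivatives
  identifies all of them with \<open>deriv f\<close>, which is therefore differentiable to every
  order.\<close>

lemma smooth_has_deriv:
  assumes "smooth f"
  shows "(f has_real_derivative deriv f x) (at x)" "smooth (deriv f)"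
proof -
  have *: "\<exists>f'. (\<forall>x. (f has_real_derivative f' x) (at x)) \<and> times_diff n f'" for n
    using assms unfolding smooth_def by (metis times_diff.simps(2))
  have eq: "f' = deriv f" if "\<forall>x. (f has_real_derivative f' x) (at x)" for f'
    using that by (auto intro!: ext DERIV_imp_deriv[symmetric])
  have **: "(\<forall>x. (f has_real_derivative deriv f x) (at x)) \<and> times_diff n (deriv f)" for n
  proof -
    obtain f' where "\<forall>x. (f has_real_derivative f' x) (at x)" "times_diff n f'" using * by blast
    with eq[of f'] show ?thesis by simp
  qed
  then show "(f has_real_derivative deriv f x) (at x)" by blast
  show "smooth (deriv f)" unfolding smooth_def using ** by blast
qed

lemma smooth_antideriv:
  assumes "smooth f'" "\<And>x. (f has_real_derivative f' x) (at x)"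
  shows "smooth f"
  unfolding smooth_def
proof
  fix n show "times_diff n f"
    using assms by (cases n) (auto simp: smooth_def)
qed

lemma smooth_continuous:
  assumes "smooth f"
  shows "continuous_on S f"
  by (intro continuous_at_imp_continuous_on ballI DERIV_isCont[OF smooth_has_deriv(1)[OF assms]])

text \<open>The classical flat function exp(-1/x) is the member k = 0. The powers in the denominator
  are carried along because the linear span of this family is closed under differentiation, so
  smoothness becomes an induction simultaneous in all \<open>k\<close>.\<close>

definition expinv :: "nat \<Rightarrow> real \<Rightarrow> real" where
  "expinv k x = (if 0 < x then exp (- 1 / x) / x ^ k else 0)"

lemma expinv_has_deriv:
  "(expinv k has_real_derivative expinv (k + 2) x - real k * expinv (k + 1) x) (at x)"
proof -
  consider "x < 0" | "x > 0" | "x = 0" by linarith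
  then show ?thesis
  proof cases
    case 1
    have "((\<lambda>x. 0) has_real_derivative 0) (at x)" by simp
    then have "(expinv k has_real_derivative 0) (at x)"
      by (rule DERIV_cong_ev[THEN iffD1, rotated -1, OF _ refl])
        (use 1 in \<open>auto simp: expinv_def eventually_nhds intro!: exI[of _ "{..<0}"]\<close>)
    then show ?thesis using 1 by (simp add: expinv_def)
  next
    case 2
    have "((\<lambda>x. exp (- 1 / x) * (inverse x) ^ k) has_real_derivative
       expinv (k + 2) x - real k * expinv (k + 1) x) (at x)"
    \<comment> \<open>The power rule produces the exponent k - 1, hence the separate case k =
      0.\<close>
    proof (cases k)
      case 0
      then show ?thesis using 2
        by (auto intro!: derivative_eq_intros simp: expinv_def field_simps power2_eq_square)
    next
      case (Suc m)
      have "((\<lambda>x. exp (- 1 / x) * (inverse x) ^ Suc m) has_real_derivative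
         exp (- 1 / x) * (1 / x\<^sup>2) * inverse x ^ Suc m
           + exp (- 1 / x) * (real (Suc m) * inverse x ^ m * (- (inverse x)\<^sup>2))) (at x)"
        using 2 by (auto intro!: derivative_eq_intros DERIV_inverse' simp del: power_Suc simp: power2_eq_square)
      moreover have "exp (- 1 / x) * (1 / x\<^sup>2) * inverse x ^ Suc m
           + exp (- 1 / x) * (real (Suc m) * inverse x ^ m * (- (inverse x)\<^sup>2))
         = expinv (Suc m + 2) x - real (Suc m) * expinv (Suc m + 1) x"
        using 2 by (cases m) (simp_all add: expinv_def power_inverse field_simps power2_eq_square)
      ultimately show ?thesis using Suc by simp
    qed
    then show ?thesis
      by (rule DERIV_cong_ev[THEN iffD1, rotated -1, OF _ refl])
        (use 2 in \<open>auto simp: expinv_def eventually_nhds field_simps intro!: exI[of _ "{0<..}"]\<close>)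
  next
    case 3
    \<comment> \<open>At the origin the difference quotient is treated one side at a time: from the
      right the exponential beats every power, from the left it is identically 0.\<close>
    have "((\<lambda>h::real. exp (- 1 / h) / h ^ k / h) \<longlongrightarrow> 0) (at_right 0)"
      by real_asymp
    moreover have "\<forall>\<^sub>F h in at_right 0. exp (- 1 / h) / h ^ k / h = expinv k h / h"
      by (auto simp: expinv_def eventually_at_right_field intro!: exI[of _ 1])
    ultimately have r: "((\<lambda>h. expinv k h / h) \<longlongrightarrow> 0) (at_right 0)"
      using tendsto_cong by fast
    have "\<forall>\<^sub>F h in at_left (0::real). 0 = expinv k h / h"
      unfolding eventually_at_left_field by (intro exI[of _ "-1"]) (simp add: expinv_def)
    from tendsto_cong[OF this, of 0] have l: "((\<lambda>h. expinv k h / h) \<longlongrightarrow> 0) (at_left 0)" by simp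
    from l r have "((\<lambda>h. expinv k h / h) \<longlongrightarrow> 0) (at 0)" by (rule filterlim_split_at)
    then show ?thesis using 3 by (simp add: DERIV_def expinv_def)
  qed
qed

lemma smooth_expinv: "smooth (expinv k)"
  unfolding smooth_def
proof
  fix n show "times_diff n (expinv k)"
  proof (induction n arbitrary: k)
    case (Suc n)
    have "times_diff n (\<lambda>x. expinv (k + 2) x + (- real k) * expinv (k + 1) x)"
      by (intro times_diff_add times_diff_mult times_diff_const Suc)
    then show ?case using expinv_has_deriv[of k] by (auto intro!: exI[of _ "\<lambda>x. expinv (k + 2) x - real k * expinv (k + 1) x"])
  qed simp
qed

text \<open>For p \<le> q the product \<open>(x - p) * (q - x)\<close> is positive exactly on the
  open interval; the growing factor drives the values there to 1. With \<open>Suc n\<close> the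
  member n = 0 is already a genuine bump, which serves later as the fixed profile.\<close>

definition bump :: "real \<Rightarrow> real \<Rightarrow> nat \<Rightarrow> real \<Rightarrow> real" where
  "bump p q n x = expinv 0 (real (Suc n) * ((x - p) * (q - x)))"

lemma smooth_bump: "smooth (bump p q n)"
  unfolding bump_def
  by (intro smooth_comp[OF smooth_expinv[of 0]] smooth_mult smooth_diff smooth_const smooth_ident)

lemma bump_outside: "x \<notin> {p<..<q} \<Longrightarrow> p \<le> q \<Longrightarrow> bump p q n x = 0"
  by (auto simp: bump_def expinv_def zero_less_mult_iff)

lemma bump_pos: "x \<in> {p<..<q} \<Longrightarrow> 0 < bump p q n x"
  by (auto simp: bump_def expinv_def zero_less_mult_iff)

lemma bump_bounds: "0 \<le> bump p q n x" "bump p q n x \<le> 1"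
  by (auto simp: bump_def expinv_def)

lemma bump_tendsto:
  assumes "p \<le> q"
  shows "(\<lambda>n. bump p q n x) \<longlonglongrightarrow> indicator {p<..<q} x"
proof (cases "x \<in> {p<..<q}")
  case True
  then have "0 < (x - p) * (q - x)" by simp
  moreover have "(\<lambda>n. exp (- 1 / (real (Suc n) * r))) \<longlonglongrightarrow> 1" if "0 < r" for r
    using that by real_asymp
  ultimately have "(\<lambda>n. exp (- 1 / (real (Suc n) * ((x - p) * (q - x))))) \<longlonglongrightarrow> 1"
    by blast
  then show ?thesis using True by (simp add: bump_def expinv_def zero_less_mult_iff)
next
  case False
  then show ?thesis using bump_outside[OF False assms] by simp
qed

section \<open>Splitting off a fixed profile\<close>

text \<open>The primitive vanishes to the left of the interval by its choice of base point and to
  the right because \<open>g\<close> has integral 0.\<close>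

lemma smooth_compact_antideriv:
  assumes g: "smooth g" "\<And>x. x \<notin> {p..q} \<Longrightarrow> g x = 0" and "integral {p..q} g = 0" "p < q"
  obtains G where "smooth G" "\<And>x. x \<notin> {p..q} \<Longrightarrow> G x = 0" "deriv G = g"
proof -
  \<comment> \<open>Starting one unit before \<open>p\<close> makes \<open>p\<close> an interior
    point, so the derivative there is two-sided.\<close>
  define G where "G x = integral {p - 1..x} g" for x
  have cont: "continuous_on S g" for S using g smooth_continuous by blast
  have zero: "G x = 0" if "x \<notin> {p..q}" for x
  proof (cases "x < p")
    case True
    have "G x = integral {p - 1..x} (\<lambda>x. 0)" unfolding G_def
      using True g(2) by (intro integral_cong) auto
    then show ?thesis by simp
  next
    case False
    with that have x: "x > q" by auto
    have "G x = integral {p - 1..p} g + integral {p..x} g" unfolding G_def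
      by (rule Henstock_Kurzweil_Integration.integral_combine[symmetric])
        (use x assms cont in \<open>auto intro: integrable_continuous_real\<close>)
    also have "integral {p..x} g = integral {p..q} g + integral {q..x} g"
      by (rule Henstock_Kurzweil_Integration.integral_combine[symmetric])
        (use x assms cont in \<open>auto intro: integrable_continuous_real\<close>)
    \<comment> \<open>The hypothesis gives \<open>g = 0\<close> only off the closed interval; the
      endpoint is removed as a null set.\<close>
    also have "integral {p - 1..p} g = integral {p - 1..p} (\<lambda>x. 0)"
      by (rule integral_spike[of "{p}"]) (use g in auto)
    also have "integral {q..x} g = integral {q..x} (\<lambda>x. 0)"
      by (rule integral_spike[of "{q}"]) (use g in auto)
    finally show ?thesis using assms by simp
  qed
  have der: "(G has_real_derivative g x) (at x)" for x
  proof (cases "x < p")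
    case True
    have "((\<lambda>x. 0) has_real_derivative 0) (at x)" by simp
    then have "(G has_real_derivative 0) (at x)"
      by (rule DERIV_cong_ev[THEN iffD1, rotated -1, OF _ refl])
        (use True zero in \<open>auto simp: eventually_nhds intro!: exI[of _ "{..<p}"]\<close>)
    then show ?thesis using True g by simp
  next
    case False
    have "(G has_real_derivative g x) (at x within {p - 1..x + 1})"
      unfolding G_def using False cont by (intro integral_has_real_derivative) auto
    then show ?thesis using False by (subst (asm) at_within_interior) auto
  qed
  show ?thesis
  proof
    show "smooth G" using g(1) der by (rule smooth_antideriv)
    show "deriv G = g" using der by (auto intro: DERIV_imp_deriv)
  qed (use zero in auto)
qed

text \<open>The coefficient is the ratio of the two integrals, so that \<open>a - \<alpha> e\<close>
  has integral 0 and hence a primitive with the same support.\<close>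

lemma smooth_decompose:
  assumes a: "smooth a" "\<And>x. x \<notin> {p..q} \<Longrightarrow> a x = 0" and "p < q"
    and e: "smooth e" "\<And>x. x \<notin> {p..q} \<Longrightarrow> e x = 0" "integral {p..q} e \<noteq> 0"
  obtains \<alpha> A where "smooth A" "\<And>x. x \<notin> {p..q} \<Longrightarrow> A x = 0" "\<And>x. a x = \<alpha> * e x + deriv A x"
proof -
  define \<alpha> where "\<alpha> = integral {p..q} a / integral {p..q} e"
  have "a integrable_on {p..q}" "(\<lambda>x. \<alpha> * e x) integrable_on {p..q}"
    by (intro integrable_continuous_real smooth_continuous a(1) smooth_mult[OF smooth_const e(1)])+
  then have "integral {p..q} (\<lambda>x. a x - \<alpha> * e x) = integral {p..q} a - \<alpha> * integral {p..q} e"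
    by (simp add: Henstock_Kurzweil_Integration.integral_diff)
  then have "integral {p..q} (\<lambda>x. a x - \<alpha> * e x) = 0" using e by (simp add: \<alpha>_def)
  moreover have "smooth (\<lambda>x. a x - \<alpha> * e x)"
    by (intro smooth_diff a(1) smooth_mult[OF smooth_const e(1)])
  moreover have "a x - \<alpha> * e x = 0" if "x \<notin> {p..q}" for x using a e that by simp
  ultimately obtain A where
    "smooth A" "\<And>x. x \<notin> {p..q} \<Longrightarrow> A x = 0" "deriv A = (\<lambda>x. a x - \<alpha> * e x)"
    using smooth_compact_antideriv \<open>p < q\<close> by blast
  then show thesis by (intro that[of A \<alpha>]) auto
qed

section \<open>Lebesgue integration on subsets\<close>

text \<open>Completeness of Lebesgue measure: changing a function on a null set keeps it measurable.
  It frees the congruence rules below from measurability side conditions, which matters for the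
  arbitrary representatives behind \<open>weak_deriv\<close> and \<open>M_of\<close>.\<close>

lemma borel_measurable_lebesgue_on_AE:
  fixes f :: "'a::euclidean_space \<Rightarrow> 'b::euclidean_space"
  assumes S: "S \<in> sets lebesgue" and f: "f \<in> borel_measurable (lebesgue_on S)"
    and ae: "AE x in lebesgue_on S. f x = g x"
  shows "g \<in> borel_measurable (lebesgue_on S)"
proof -
  have "AE x in lebesgue. (if x \<in> S then f x else 0) = (if x \<in> S then g x else 0)"
    using ae S by (auto simp: AE_restrict_space_iff elim!: eventually_mono)
  from borel_measurable_AE[OF _ this] show ?thesis
    using f unfolding borel_measurable_if[OF S] .
qed

lemma integrable_cong_AE_lebesgue_on:
  fixes f :: "'a::euclidean_space \<Rightarrow> 'b::euclidean_space"
  assumes S: "S \<in> sets lebesgue" and f: "integrable (lebesgue_on S) f"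
    and ae: "AE x in lebesgue_on S. f x = g x"
  shows "integrable (lebesgue_on S) g"
  using integrable_cong_AE[OF borel_measurable_integrable[OF f]
      borel_measurable_lebesgue_on_AE[OF S borel_measurable_integrable[OF f] ae] ae] f by (rule iffD1)

lemma integral_cong_AE_lebesgue_on:
  fixes f :: "'a::euclidean_space \<Rightarrow> 'b::euclidean_space"
  assumes S: "S \<in> sets lebesgue" and ae: "AE x in lebesgue_on S. f x = g x"
  shows "integral\<^sup>L (lebesgue_on S) f = integral\<^sup>L (lebesgue_on S) g"
proof -
  have ae': "AE x in lebesgue_on S. g x = f x" using ae by (auto elim: eventually_mono)
  show ?thesis
  proof (cases "integrable (lebesgue_on S) f")
    case True
    from integral_cong_AE[OF borel_measurable_integrable[OF this]
        borel_measurable_lebesgue_on_AE[OF S borel_measurable_integrable[OF this] ae] ae]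
    show ?thesis .
  next
    \<comment> \<open>Neither side is integrable, and both integrals take the default value
      0.\<close>
    case False
    moreover from this have "\<not> integrable (lebesgue_on S) g"
      using integrable_cong_AE_lebesgue_on[OF S _ ae'] by blast
    ultimately show ?thesis by (simp add: not_integrable_integral_eq)
  qed
qed

lemma integral_lebesgue_on_support:
  fixes f :: "'a::euclidean_space \<Rightarrow> real"
  assumes "S \<in> sets lebesgue" "T \<in> sets lebesgue" "S \<subseteq> T" and zero: "\<And>x. x \<notin> S \<Longrightarrow> f x = 0"
  shows "integral\<^sup>L (lebesgue_on T) f = integral\<^sup>L (lebesgue_on S) f"
    and "integrable (lebesgue_on T) f \<longleftrightarrow> integrable (lebesgue_on S) f"
proof -
  have "(\<lambda>x. if x \<in> S then f x else 0) = f" "(\<lambda>x. if x \<in> T then f x else 0) = f"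
    using \<open>S \<subseteq> T\<close> zero by (auto simp: fun_eq_iff subset_iff)
  then show "integral\<^sup>L (lebesgue_on T) f = integral\<^sup>L (lebesgue_on S) f"
    "integrable (lebesgue_on T) f \<longleftrightarrow> integrable (lebesgue_on S) f"
    using Lebesgue_Measure.integral_restrict_UNIV[OF assms(1), of f]
      Lebesgue_Measure.integral_restrict_UNIV[OF assms(2), of f]
      Lebesgue_Measure.integrable_restrict_UNIV[OF assms(1), of f]
      Lebesgue_Measure.integrable_restrict_UNIV[OF assms(2), of f] by simp_all
qed

text \<open>A set that is negligible near each of its points is negligible, by second countability
  of the space.\<close>

lemma AE_lebesgue_local:
  fixes S :: "'a::euclidean_space set"
  assumes "S \<in> sets lebesgue"
    and loc: "\<And>x. x \<in> S \<Longrightarrow> \<exists>U. open U \<and> x \<in> U \<and> (AE y in lebesgue. y \<in> U \<longrightarrow> P y)"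
  shows "AE x in lebesgue_on S. P x"
proof -
  define N where "N = {x \<in> S. \<not> P x}"
  have "negligible N"
  proof (subst locally_negligible_alt, rule ballI)
    fix x assume "x \<in> N"
    then have "x \<in> S" by (simp add: N_def)
    from loc[OF this] obtain U where U: "open U" "x \<in> U" "AE y in lebesgue. y \<in> U \<longrightarrow> P y"
      by (elim exE conjE)
    then have "{y. \<not> (y \<in> U \<longrightarrow> P y)} \<in> null_sets lebesgue"
      by (simp add: completion.AE_iff_null_sets)
    then have "negligible (U \<inter> N)"
      unfolding negligible_iff_null_sets[symmetric] 
      by (rule negligible_subset) (auto simp: N_def)
    then show "\<exists>U. openin (top_of_set N) U \<and> x \<in> U \<and> negligible U"
      using U \<open>x \<in> N\<close> by (intro exI[of _ "N \<inter> U"]) (auto simp: Int_commute)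
  qed
  then have "AE x in lebesgue. x \<notin> N"
    by (simp add: AE_not_in negligible_iff_null_sets)
  then show ?thesis
    using assms(1) by (auto simp: AE_restrict_space_iff N_def elim!: eventually_mono)
qed

text \<open>A Dynkin argument: open boxes form an intersection-stable generator of the Borel sets.
  Vanishing of the total integral handles complements, countable additivity handles disjoint unions.
  The result is that \<open>f\<close> and 0 are densities of the same signed measure.\<close>

lemma integral_boxes_zero_imp_AE_zero:
  fixes f :: "'a::euclidean_space \<Rightarrow> real"
  assumes f: "integrable lebesgue f" and tot: "integral\<^sup>L lebesgue f = 0"
    and box: "\<And>a b. (\<integral>x. indicator (box a b) x * f x \<partial>lebesgue) = 0"
  shows "AE x in lebesgue. f x = 0"
proof -
  \<comment> \<open>Boxes generate the Borel sets but not all Lebesgue sets, so the argument runs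
    for a Borel representative.\<close>
  obtain g where g[measurable]: "g \<in> borel_measurable lborel" and fg: "AE x in lborel. f x = g x"
    using completion_ex_borel_measurable_real[of f lborel] f by auto
  have fg': "AE x in lebesgue. f x = g x" using fg by (rule AE_completion)
  have gl: "g \<in> borel_measurable lebesgue" using g by (rule measurable_completion)
  have gi: "integrable lborel g"
    using integrable_completion[OF g] integrable_cong_AE[OF _ gl fg'] f by auto
  have *: "(\<integral>x. indicator A x * g x \<partial>lborel) = (\<integral>x. indicator A x * f x \<partial>lebesgue)" if "A \<in> sets borel" for A
  proof -
    have [measurable]: "A \<in> sets lborel" using that by simp
    have "(\<integral>x. indicator A x * g x \<partial>lborel) = (\<integral>x. indicator A x * g x \<partial>lebesgue)"
      by (rule integral_completion[symmetric]) measurable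
    also have "\<dots> = (\<integral>x. indicator A x * f x \<partial>lebesgue)"
      by (rule integral_cong_AE_lebesgue_on[of UNIV, unfolded lebesgue_on_UNIV_eq])
        (use fg' in \<open>auto elim!: eventually_mono\<close>)
    finally show ?thesis .
  qed
  have tot': "integral\<^sup>L lborel g = 0" using *[of UNIV] tot by simp
  have borel_sigma: "sets borel = sigma_sets UNIV (range (\<lambda>(a, b). box a b :: 'a set))"
    unfolding borel_eq_box by (rule sets_measure_of) simp
  have zero: "set_lebesgue_integral lborel A g = 0" if "A \<in> sets lborel" for A
  proof -
    have "A \<in> sigma_sets UNIV (range (\<lambda>(a, b). box a b :: 'a set))"
      using that borel_sigma by simp
    have "Int_stable (range (\<lambda>(a, b). box a b :: 'a set))"
      by (auto simp: Int_stable_def box_Int_box)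
    moreover have "range (\<lambda>(a, b). box a b :: 'a set) \<subseteq> Pow UNIV" by simp
    from \<open>Int_stable _\<close> this \<open>A \<in> sigma_sets _ _\<close> show ?thesis
    proof (induction rule: sigma_sets_induct_disjoint)
      case (basic A)
      then show ?case using * box by (auto simp: set_lebesgue_integral_def)
    next
      case empty
      show ?case by (simp add: set_lebesgue_integral_def)
    next
      case (compl A)
      have [measurable]: "A \<in> sets lborel"
        using compl(1) borel_sigma by simp
      have "(\<integral>x. indicator (UNIV - A) x * g x \<partial>lborel) = (\<integral>x. g x - indicator A x * g x \<partial>lborel)"
        by (intro Bochner_Integration.integral_cong) (auto simp: indicator_def)
      also have "\<dots> = 0"
        using compl(2) tot' gi integrable_mult_indicator[OF \<open>A \<in> sets lborel\<close> gi]
        by (simp add: set_lebesgue_integral_def)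
      finally show ?case by (simp add: set_lebesgue_integral_def)
    next
      case (union A)
      have m: "A i \<in> sets lborel" for i
        using union(2) borel_sigma by auto
      have U: "(\<Union>i. A i) \<in> sets lborel" by (rule sets.countable_UN) (use m in blast)
      have "set_integrable lborel (\<Union>i. A i) g"
        unfolding set_integrable_def by (rule integrable_mult_indicator[OF U gi])
      then have "set_lebesgue_integral lborel (\<Union>i. A i) g = (\<Sum>i. set_lebesgue_integral lborel (A i) g)"
        using union(1) m by (intro lebesgue_integral_countable_add) (auto simp: disjoint_family_on_def)
      then show ?case using union by simp
    qed
  qed
  have "AE x in lborel. g x = 0"
    by (rule density_unique_real[OF gi]) (simp_all add: zero set_lebesgue_integral_def[of _ _ "\<lambda>_. 0"])
  then have "AE x in lborel. f x = 0" using fg by eventually_elim simp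
  then show ?thesis by (rule AE_completion)
qed

section \<open>Test functions\<close>

definition tensor :: "(real \<Rightarrow> real) \<Rightarrow> (real \<Rightarrow> real) \<Rightarrow> real^2 \<Rightarrow> real" where
  "tensor a b x = a (x $ 1) * b (x $ 2)"

text \<open>The supporting box is an explicit parameter because differentiating a factor and
  splitting off a profile must both stay within the same box.\<close>

definition box_test :: "real^2 \<Rightarrow> real^2 \<Rightarrow> (real \<Rightarrow> real) \<Rightarrow> (real \<Rightarrow> real) \<Rightarrow> bool" where
  "box_test p q a b \<longleftrightarrow> smooth a \<and> smooth b \<and>
     (\<forall>s. s \<notin> {p $ 1..q $ 1} \<longrightarrow> a s = 0) \<and> (\<forall>s. s \<notin> {p $ 2..q $ 2} \<longrightarrow> b s = 0)"

definition tensor_test :: "(real^2) set \<Rightarrow> (real \<Rightarrow> real) \<Rightarrow> (real \<Rightarrow> real) \<Rightarrow> bool" where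
  "tensor_test \<Omega> a b \<longleftrightarrow> (\<exists>p q. box_test p q a b \<and> cbox p q \<subseteq> \<Omega>)"

lemma tensor_has_derivative:
  assumes "smooth a" "smooth b"
  shows "(tensor a b has_derivative
    (\<lambda>h. deriv a (x $ 1) * h $ 1 * b (x $ 2) + a (x $ 1) * (deriv b (x $ 2) * h $ 2))) (at x)"
proof -
  have c: "((\<lambda>x::real^2. x $ i) has_derivative (\<lambda>h. h $ i)) (at x)" for i
    by (rule bounded_linear_imp_has_derivative) (rule bounded_linear_vec_nth)
  have d: "((\<lambda>x::real^2. f (x $ i)) has_derivative (\<lambda>h. deriv f (x $ i) * h $ i)) (at x)" if "smooth f" for f i
    using has_derivative_compose[OF c, of f "\<lambda>s. deriv f (x $ i) * s" i] smooth_has_deriv(1)[OF that, of "x $ i"]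
    by (auto simp: has_field_derivative_def)
  show ?thesis
    unfolding tensor_def
    by (rule has_derivative_eq_rhs[OF has_derivative_mult[OF d[OF assms(1)] d[OF assms(2)]]])
      (auto simp: algebra_simps)
qed

lemma partial_deriv_tensor:
  assumes "smooth a" "smooth b"
  shows "partial_deriv 1 (tensor a b) = tensor (deriv a) b"
    "partial_deriv 2 (tensor a b) = tensor a (deriv b)"
  using frechet_derivative_at[OF tensor_has_derivative[OF assms], symmetric]
  by (auto simp: partial_deriv_def tensor_def axis_def fun_eq_iff)

text \<open>Products of smooth functions of one variable are closed under both partial derivatives;
  this yields differentiability of all orders without several-variable smoothness theory.\<close>

lemma partials_tensor:
  assumes "smooth a" "smooth b"
  shows "\<exists>a' b'. smooth a' \<and> smooth b' \<and> partials is (tensor a b) = tensor a' b'"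
proof (induction "is")
  case Nil
  then show ?case using assms by (auto simp: partials_def)
next
  case (Cons i "is")
  then obtain a' b' where *: "smooth a'" "smooth b'" "partials is (tensor a b) = tensor a' b'" by blast
  have "i = 1 \<or> i = 2" using exhaust_2 by blast
  then show ?case
    using * partial_deriv_tensor[of a' b'] smooth_has_deriv(2)
    by (auto simp: partials_def)
qed

lemma tensor_zero_outside:
  assumes "box_test p q a b" "x \<notin> cbox p q"
  shows "tensor a b x = 0"
proof -
  obtain i where "x $ i \<notin> {p $ i..q $ i}" using assms(2) by (auto simp: mem_box_cart)
  moreover have "i = 1 \<or> i = 2" using exhaust_2 by blast
  ultimately have "a (x $ 1) = 0 \<or> b (x $ 2) = 0" using assms(1) by (auto simp: box_test_def)
  then show ?thesis by (auto simp: tensor_def)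
qed

lemma test_function_tensor:
  assumes "tensor_test \<Omega> a b"
  shows "test_function \<Omega> (tensor a b)"
proof -
  obtain p q where pq: "box_test p q a b" "cbox p q \<subseteq> \<Omega>"
    using assms unfolding tensor_test_def by blast
  then have *: "smooth a" "smooth b" by (auto simp: box_test_def)
  have "partials is (tensor a b) differentiable at x" for "is" x
  proof -
    obtain a' b' where "smooth a'" "smooth b'" "partials is (tensor a b) = tensor a' b'"
      using partials_tensor[OF *(1,2), of "is"] by blast
    with differentiableI[OF tensor_has_derivative[of a' b' x]] show ?thesis by simp
  qed
  then show ?thesis using pq tensor_zero_outside[OF pq(1)]
    by (auto simp: test_function_def intro!: exI[of _ "cbox p q"])
qed

lemma box_test_deriv:
  assumes "box_test p q a b"
  shows "box_test p q (deriv a) b" "box_test p q a (deriv b)"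
proof -
  have 0: "deriv f s = 0" if z: "\<And>s. s \<notin> {p..q} \<Longrightarrow> f s = 0" and s: "s \<notin> {p..q}" for f :: "real \<Rightarrow> real" and p q s
  proof -
    have "((\<lambda>x. 0) has_real_derivative 0) (at s)" by simp
    then have "(f has_real_derivative 0) (at s)"
      by (rule has_field_derivative_transform_within_open[of _ _ _ "- {p..q}"]) (use z s in \<open>auto intro: open_Compl\<close>)
    then show ?thesis by (rule DERIV_imp_deriv)
  qed
  have *: "smooth a" "smooth b" "\<And>s. s \<notin> {p $ 1..q $ 1} \<Longrightarrow> a s = 0" "\<And>s. s \<notin> {p $ 2..q $ 2} \<Longrightarrow> b s = 0"
    using assms unfolding box_test_def by blast+
  have "deriv a s = 0" if "s \<notin> {p $ 1..q $ 1}" for s by (rule 0[OF *(3) that])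
  moreover have "deriv b s = 0" if "s \<notin> {p $ 2..q $ 2}" for s by (rule 0[OF *(4) that])
  ultimately show "box_test p q (deriv a) b" "box_test p q a (deriv b)"
    using * smooth_has_deriv(2)[OF *(1)] smooth_has_deriv(2)[OF *(2)] unfolding box_test_def by blast+
qed

lemma tensor_test_deriv:
  assumes "tensor_test \<Omega> a b"
  shows "tensor_test \<Omega> (deriv a) b" "tensor_test \<Omega> a (deriv b)"
  using assms box_test_deriv unfolding tensor_test_def by blast+

lemma partials_tensor_test:
  assumes "tensor_test \<Omega> a b"
  shows "partials [1] (tensor a b) = tensor (deriv a) b"
    "partials [2] (tensor a b) = tensor a (deriv b)"
    "partials [1, 2] (tensor a b) = tensor (deriv a) (deriv b)"
    "partials [2, 1] (tensor a b) = tensor (deriv a) (deriv b)"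
  using assms by (auto simp: tensor_test_def box_test_def partials_def partial_deriv_tensor smooth_has_deriv(2))

lemma partials_append: "partials is (partials js \<phi>) = partials (is @ js) \<phi>"
  by (simp add: partials_def)

text \<open>One compact set serves all derivatives at once: its complement is open, and a function
  vanishing on an open set has vanishing derivative there.\<close>

lemma test_function_support:
  assumes "test_function \<Omega> \<phi>"
  obtains K where "compact K" "K \<subseteq> \<Omega>" "\<And>is x. x \<notin> K \<Longrightarrow> partials is \<phi> x = 0"
proof -
  obtain K where K: "compact K" "K \<subseteq> \<Omega>" "\<And>x. x \<notin> K \<Longrightarrow> \<phi> x = 0"
    using assms by (auto simp: test_function_def)
  have "\<forall>x. x \<notin> K \<longrightarrow> partials is \<phi> x = 0" for "is"
  proof (induction "is")
    case (Cons i "is")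
    show ?case
    proof (intro allI impI)
      fix x assume "x \<notin> K"
      have "((\<lambda>_. 0) has_derivative (\<lambda>_. 0)) (at x)" by simp
      then have "(partials is \<phi> has_derivative (\<lambda>_. 0)) (at x)"
        by (rule has_derivative_transform_within_open[of _ _ _ _ "- K"])
          (use Cons \<open>x \<notin> K\<close> K in \<open>auto intro: open_Compl compact_imp_closed\<close>)
      then have "frechet_derivative (partials is \<phi>) (at x) = (\<lambda>_. 0)"
        by (rule frechet_derivative_at[symmetric])
      then show "partials (i # is) \<phi> x = 0"
        by (simp add: partials_def partial_deriv_def)
    qed
  qed (use K in \<open>auto simp: partials_def\<close>)
  then show thesis using K that by blast
qed

lemma test_function_partials:
  assumes "test_function \<Omega> \<phi>"
  shows "test_function \<Omega> (partials is \<phi>)"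
  using assms
  by (rule test_function_support) (use assms in \<open>auto simp: test_function_def partials_append\<close>)

lemma test_function_continuous: "test_function \<Omega> \<phi> \<Longrightarrow> continuous_on S (partials is \<phi>)"
  unfolding test_function_def
  by (intro continuous_at_imp_continuous_on ballI differentiable_imp_continuous_within) blast

lemma integrable_mult_continuous:
  fixes f g :: "'a::euclidean_space \<Rightarrow> real"
  assumes K: "compact K" and f: "integrable (lebesgue_on K) f" and g: "continuous_on K g"
  shows "integrable (lebesgue_on K) (\<lambda>x. f x * g x)"
proof -
  have Kl: "K \<in> sets lebesgue" using borel_compact[OF K] by simp
  have "bounded (g ` K)" using g K compact_continuous_image compact_imp_bounded by blast
  then obtain M where M: "\<And>x. x \<in> K \<Longrightarrow> norm (g x) \<le> M" unfolding bounded_iff by blast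
  show ?thesis
  proof (rule Bochner_Integration.integrable_bound)
    show "integrable (lebesgue_on K) (\<lambda>x. M * f x)" using f by simp
    have [measurable]: "g \<in> borel_measurable (lebesgue_on K)"
      using g Kl by (rule continuous_imp_measurable_on_sets_lebesgue)
    show "(\<lambda>x. f x * g x) \<in> borel_measurable (lebesgue_on K)"
      using f by measurable
    show "AE x in lebesgue_on K. norm (f x * g x) \<le> norm (M * f x)"
    proof (rule AE_I2)
      fix x assume "x \<in> space (lebesgue_on K)"
      then have "\<bar>g x\<bar> \<le> \<bar>M\<bar>" using M[of x] by auto
      then show "norm (f x * g x) \<le> norm (M * f x)"
        by (simp add: abs_mult mult.commute[of "\<bar>f x\<bar>"] mult_right_mono)
    qed
  qed
qed

lemma integrable_mult_test_function:
  assumes \<Omega>: "open \<Omega>" and f: "locally_integrable \<Omega> f" and \<phi>: "test_function \<Omega> \<phi>"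
  shows "integrable (lebesgue_on \<Omega>) (\<lambda>x. f x * partials is \<phi> x)"
proof -
  obtain K where K: "compact K" "K \<subseteq> \<Omega>" "\<And>x. x \<notin> K \<Longrightarrow> partials is \<phi> x = 0"
    using test_function_support[OF \<phi>] by metis
  have "integrable (lebesgue_on K) (\<lambda>x. f x * partials is \<phi> x)"
    using f K by (intro integrable_mult_continuous test_function_continuous[OF \<phi>])
      (auto simp: locally_integrable_def)
  moreover have "K \<in> sets lebesgue" using borel_compact[OF K(1)] by simp
  moreover have "\<Omega> \<in> sets lebesgue" using \<Omega> by simp
  ultimately show ?thesis
    using integral_lebesgue_on_support(2)[of K \<Omega> "\<lambda>x. f x * partials is \<phi> x"] K by simp
qed

section \<open>Integration by parts\<close>

text \<open>The integral of the difference quotient vanishes by translation invariance.\<close>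

lemma integral_directional_derivative_zero:
  fixes h g :: "'a::euclidean_space \<Rightarrow> real"
  assumes deriv: "\<And>x. (h has_derivative h' x) (at x)" and g: "\<And>x. g x = h' x e"
    and cont: "continuous_on UNIV g" and K: "compact K" "\<And>x. x \<notin> K \<Longrightarrow> h x = 0"
  shows "(\<integral>x. g x \<partial>lborel) = 0"
proof -
  have line: "((\<lambda>t. h (x + t *\<^sub>R e)) has_real_derivative g (x + t *\<^sub>R e)) (at t)" for x t
  proof -
    have "((\<lambda>t. x + t *\<^sub>R e) has_derivative (\<lambda>s. s *\<^sub>R e)) (at t)"
      by (auto intro!: derivative_eq_intros)
    from has_derivative_compose[OF this deriv]
    have "((\<lambda>t. h (x + t *\<^sub>R e)) has_derivative (\<lambda>s. h' (x + t *\<^sub>R e) (s *\<^sub>R e))) (at t)" .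
    moreover have "h' (x + t *\<^sub>R e) (s *\<^sub>R e) = g (x + t *\<^sub>R e) * s" for s
      using linear_cmul[OF has_derivative_linear[OF deriv]] g by simp
    ultimately show ?thesis by (simp add: has_field_derivative_def mult_commute_abs)
  qed
  have hcont: "continuous_on UNIV h"
    using deriv has_derivative_continuous by (blast intro: continuous_at_imp_continuous_on)
  have gK: "g x = 0" if "x \<notin> K" for x
  proof -
    have "((\<lambda>_. 0) has_derivative (\<lambda>_. 0)) (at x)" by simp
    then have "(h has_derivative (\<lambda>_. 0)) (at x)"
      by (rule has_derivative_transform_within_open[of _ _ _ _ "- K"])
        (use that K in \<open>auto intro: open_Compl compact_imp_closed\<close>)
    then have "h' x = (\<lambda>_. 0)" using has_derivative_unique[OF deriv] by blast
    then show ?thesis using g by simp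
  qed
  have "bounded (g ` K)"
    using continuous_on_subset[OF cont] K compact_continuous_image compact_imp_bounded by blast
  then obtain M where M: "\<And>x. x \<in> K \<Longrightarrow> norm (g x) \<le> M" unfolding bounded_iff by blast
  \<comment> \<open>The bound \<open>M\<close> may be negative when \<open>K\<close> is empty, hence
    the absolute value; likewise for the radius \<open>R\<close>.\<close>
  have gM: "\<bar>g x\<bar> \<le> \<bar>M\<bar>" for x using M[of x] gK[of x] by (cases "x \<in> K") auto
  obtain R where R: "\<And>x. x \<in> K \<Longrightarrow> norm x \<le> R"
    using compact_imp_bounded[OF K(1)] unfolding bounded_iff by blast
  define r where "r n = 1 / real (Suc n)" for n
  have r0: "r \<longlonglongrightarrow> 0"
    unfolding r_def[abs_def] using LIMSEQ_inverse_real_of_nat by (simp add: inverse_eq_divide del: of_nat_Suc)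
  have r: "0 < r n" "r n \<le> 1" for n by (auto simp: r_def)
  define D where "D n x = (h (x + r n *\<^sub>R e) - h x) / r n" for n x
  have lim: "(\<lambda>n. D n x) \<longlonglongrightarrow> g x" for x
  proof -
    have "((\<lambda>t. (h (x + t *\<^sub>R e) - h x) / t) \<longlongrightarrow> g x) (at 0)"
      using line[of x 0] by (simp add: DERIV_def)
    moreover have "filterlim r (at 0) sequentially"
      unfolding filterlim_at using r0 r(1) by (auto simp: less_imp_neq[symmetric] intro!: always_eventually)
    ultimately show ?thesis unfolding D_def by (rule filterlim_compose)
  qed
  \<comment> \<open>Domination for the limit of difference quotients. Inside the ball the mean value
    theorem bounds them by the sup of \<open>g\<close>; outside, since \<open>r n \<le> 1\<close>,
    neither \<open>x\<close> nor its translate reaches \<open>K\<close>.\<close>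
  have D_bound: "\<bar>D n x\<bar> \<le> \<bar>M\<bar> * indicator (cball 0 (\<bar>R\<bar> + norm e)) x" for n x
  proof (cases "x \<in> cball 0 (\<bar>R\<bar> + norm e)")
    case True
    obtain z where "h (x + r n *\<^sub>R e) - h (x + 0 *\<^sub>R e) = (r n - 0) * g (x + z *\<^sub>R e)"
      using MVT2[of 0 "r n" "\<lambda>t. h (x + t *\<^sub>R e)" "\<lambda>t. g (x + t *\<^sub>R e)"] line r by blast
    then have "D n x = g (x + z *\<^sub>R e)" using r[of n] by (simp add: D_def)
    then show ?thesis using True gM by simp
  next
    case False
    then have big: "norm x > R + norm e" by simp
    have "x \<notin> K" using R[of x] big norm_ge_zero[of e] by linarith
    moreover have "x + r n *\<^sub>R e \<notin> K"
    proof
      assume "x + r n *\<^sub>R e \<in> K"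
      then have "norm (x + r n *\<^sub>R e) \<le> R" by (rule R)
      moreover have "norm (r n *\<^sub>R e) \<le> norm e" using r[of n] by (simp add: mult_left_le_one_le)
      moreover have "norm x \<le> norm (x + r n *\<^sub>R e) + norm (r n *\<^sub>R e)"
        by (metis add_diff_cancel norm_triangle_ineq4)
      ultimately show False using big by linarith
    qed
    ultimately show ?thesis using K(2) by (simp add: D_def)
  qed
  have hint: "integrable lborel h"
  proof -
    have "integrable lborel (\<lambda>x. indicator K x *\<^sub>R h x)"
      by (rule borel_integrable_compact[OF K(1)]) (use hcont continuous_on_subset in blast)
    moreover have "(\<lambda>x. indicator K x *\<^sub>R h x) = h" using K(2) by (auto simp: fun_eq_iff split: split_indicator)
    ultimately show ?thesis by simp
  qed
  have hm[measurable]: "h \<in> borel_measurable borel" using hcont by (rule borel_measurable_continuous_onI)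
  have gm[measurable]: "g \<in> borel_measurable borel" using cont by (rule borel_measurable_continuous_onI)
  have shift: "(\<integral>x. h (x + v) \<partial>lborel) = (\<integral>x. h x \<partial>lborel)" "integrable lborel (\<lambda>x. h (x + v))" for v
  proof -
    have "(\<integral>x. h x \<partial>distr lborel borel ((+) v)) = (\<integral>x. h (v + x) \<partial>lborel)"
      by (rule integral_distr) measurable
    then show "(\<integral>x. h (x + v) \<partial>lborel) = (\<integral>x. h x \<partial>lborel)"
      by (simp add: lborel_distr_plus add.commute)
    have "integrable (distr lborel borel ((+) v)) h \<longleftrightarrow> integrable lborel (\<lambda>x. h (v + x))"
      by (rule integrable_distr_eq) measurable
    then show "integrable lborel (\<lambda>x. h (x + v))"
      using hint by (simp add: lborel_distr_plus add.commute)
  qed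
  have "(\<integral>x. D n x \<partial>lborel) = 0" for n
    unfolding D_def using shift hint by (simp add: Bochner_Integration.integral_diff)
  moreover have "(\<lambda>n. \<integral>x. D n x \<partial>lborel) \<longlonglongrightarrow> (\<integral>x. g x \<partial>lborel)"
  proof (rule integral_dominated_convergence)
    show "integrable lborel (\<lambda>x. \<bar>M\<bar> * indicator (cball 0 (\<bar>R\<bar> + norm e)) x :: real)"
      by (intro integrable_mult_right integrable_real_indicator emeasure_lborel_cball_finite) simp
    show "D n \<in> borel_measurable lborel" for n unfolding D_def by measurable
    show "AE x in lborel. norm (D n x) \<le> \<bar>M\<bar> * indicator (cball 0 (\<bar>R\<bar> + norm e)) x" for n
      using D_bound by auto
  qed (use lim in auto)
  ultimately show ?thesis by (simp add: LIMSEQ_const_iff)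
qed

lemma locally_integrable_continuous:
  assumes "continuous_on UNIV p"
  shows "locally_integrable \<Omega> p"
  unfolding locally_integrable_def
proof (intro allI impI)
  fix K assume K: "compact K \<and> K \<subseteq> \<Omega>"
  have "integrable lborel (\<lambda>x. indicator K x *\<^sub>R p x)"
    using K assms continuous_on_subset by (intro borel_integrable_compact) blast+
  then have "integrable lebesgue (\<lambda>x. indicator K x *\<^sub>R p x)"
    using integrable_completion borel_measurable_integrable by blast
  moreover have "K \<in> sets lebesgue" using borel_compact[of K] K by simp
  ultimately show "integrable (lebesgue_on K) p" by (simp add: integrable_restrict_space)
qed

text \<open>Applied to the product of \<open>p\<close> with the test function, whose compact support
  makes the integral of its directional derivative vanish; the product rule then splits that
  integral into the two terms of the weak formulation.\<close>

lemma is_weak_deriv_classical: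
  assumes \<Omega>: "open \<Omega>" and p: "\<And>x. (p has_derivative p' x) (at x)"
    and cont: "continuous_on UNIV (\<lambda>x. p' x (axis i 1))"
  shows "is_weak_deriv \<Omega> [i] p (\<lambda>x. p' x (axis i 1))"
  unfolding is_weak_deriv_def
proof (intro conjI allI impI)
  have pc: "continuous_on UNIV p"
    using p has_derivative_continuous by (blast intro: continuous_at_imp_continuous_on)
  show lp: "locally_integrable \<Omega> p" using pc by (rule locally_integrable_continuous)
  show lp': "locally_integrable \<Omega> (\<lambda>x. p' x (axis i 1))" using cont by (rule locally_integrable_continuous)
  fix \<phi> assume \<phi>: "test_function \<Omega> \<phi>"
  obtain K where K: "compact K" "K \<subseteq> \<Omega>" "\<And>is x. x \<notin> K \<Longrightarrow> partials is \<phi> x = 0"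
    using test_function_support[OF \<phi>] by metis
  have \<phi>0: "partials [] \<phi> = \<phi>" by (simp add: partials_def)
  have \<phi>c: "continuous_on UNIV \<phi>" "continuous_on UNIV (partials [i] \<phi>)"
    using test_function_continuous[OF \<phi>, of UNIV "[]"] test_function_continuous[OF \<phi>, of UNIV "[i]"] \<phi>0 by auto
  have \<phi>d: "(\<phi> has_derivative frechet_derivative \<phi> (at x)) (at x)" for x
    using \<phi> \<phi>0 unfolding test_function_def by (metis frechet_derivative_works)
  define g where "g x = p x * partials [i] \<phi> x + p' x (axis i 1) * \<phi> x" for x
  have "(\<integral>x. g x \<partial>lborel) = 0"
  proof (rule integral_directional_derivative_zero)
    show "((\<lambda>x. p x * \<phi> x) has_derivative (\<lambda>h. p x * frechet_derivative \<phi> (at x) h + p' x h * \<phi> x)) (at x)" for x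
      by (rule has_derivative_mult[OF p \<phi>d])
    show "g x = p x * frechet_derivative \<phi> (at x) (axis i 1) + p' x (axis i 1) * \<phi> x" for x
      by (simp add: g_def partials_def partial_deriv_def)
    show "continuous_on UNIV g" unfolding g_def by (intro continuous_intros pc \<phi>c cont)
    show "compact K" by fact
    show "p x * \<phi> x = 0" if "x \<notin> K" for x using K(3)[OF that, of "[]"] \<phi>0 by simp
  qed
  moreover have "g \<in> borel_measurable borel"
    unfolding g_def by (intro borel_measurable_continuous_onI continuous_intros pc \<phi>c cont)
  ultimately have "integral\<^sup>L lebesgue g = 0" by (simp add: integral_completion)
  moreover have "integral\<^sup>L lebesgue g = integral\<^sup>L (lebesgue_on \<Omega>) g"
  proof -
    have "g x = 0" if "x \<notin> \<Omega>" for x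
    proof -
      have "x \<notin> K" using that K(2) by blast
      then show ?thesis using K(3)[of x "[]"] K(3)[of x "[i]"] by (simp add: g_def \<phi>0)
    qed
    then show ?thesis
      using integral_lebesgue_on_support(1)[of \<Omega> UNIV g] \<Omega> by (simp add: lebesgue_on_UNIV_eq)
  qed
  moreover have "integral\<^sup>L (lebesgue_on \<Omega>) g =
      (\<integral>x. p x * partials [i] \<phi> x \<partial>lebesgue_on \<Omega>) + (\<integral>x. p' x (axis i 1) * \<phi> x \<partial>lebesgue_on \<Omega>)"
    unfolding g_def
    using integrable_mult_test_function[OF \<Omega> lp \<phi>, of "[i]"] integrable_mult_test_function[OF \<Omega> lp' \<phi>, of "[]"]
    by (intro Bochner_Integration.integral_add) (auto simp: \<phi>0)
  ultimately show "(\<integral>x. p x * partials [i] \<phi> x \<partial>lebesgue_on \<Omega>) =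
      (- 1) ^ length [i] * (\<integral>x. p' x (axis i 1) * \<phi> x \<partial>lebesgue_on \<Omega>)"
    by simp
qed

section \<open>The fundamental lemma of the calculus of variations\<close>

lemma box_test_bump:
  assumes "\<And>i. p $ i < q $ i"
  shows "box_test p q (bump (p $ 1) (q $ 1) n) (bump (p $ 2) (q $ 2) m)"
  using assms bump_outside less_imp_le[OF assms] by (auto simp: box_test_def smooth_bump)

lemma box_test_mono:
  assumes "box_test p q a b" "\<And>i. P $ i \<le> p $ i" "\<And>i. q $ i \<le> Q $ i"
  shows "box_test P Q a b"
proof -
  have "P $ 1 \<le> p $ 1" "P $ 2 \<le> p $ 2" "q $ 1 \<le> Q $ 1" "q $ 2 \<le> Q $ 2" using assms by auto
  then show ?thesis using assms(1) by (auto simp: box_test_def)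
qed

lemma continuous_tensor:
  assumes "smooth a" "smooth b"
  shows "continuous_on S (tensor a b)"
  by (intro continuous_at_imp_continuous_on ballI has_derivative_continuous[OF tensor_has_derivative[OF assms]])

lemma box_nonempty_cart: "x \<in> box (p::real^2) q \<Longrightarrow> p $ i < q $ i"
  by (auto simp: mem_box_cart) (meson less_trans)

text \<open>Dominated convergence: products of bumps lie between 0 and 1 and converge pointwise to
  the indicator of the smaller box, so \<open>\<bar>f\<bar>\<close> dominates.\<close>

lemma box_tests_zero_imp_integral_box_zero:
  fixes f :: "real^2 \<Rightarrow> real"
  assumes f: "integrable (lebesgue_on (cbox P Q)) f"
    and zero: "\<And>a b. box_test P Q a b \<Longrightarrow> (\<integral>x. f x * tensor a b x \<partial>lebesgue_on (cbox P Q)) = 0"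
    and sub: "box p q \<subseteq> cbox P Q"
  shows "(\<integral>x. indicator (box p q) x * f x \<partial>lebesgue_on (cbox P Q)) = 0"
proof (cases "box p q = {}")
  case False
  then have pq: "p $ i < q $ i" for i using box_nonempty_cart by blast
  then have PQ: "P $ i \<le> p $ i" "q $ i \<le> Q $ i" for i
    using sub unfolding subset_interval_cart(3) by blast+
  define \<phi> where "\<phi> n = tensor (bump (p $ 1) (q $ 1) n) (bump (p $ 2) (q $ 2) n)" for n
  have \<phi>: "box_test P Q (bump (p $ 1) (q $ 1) n) (bump (p $ 2) (q $ 2) n)" for n
    by (rule box_test_mono[OF box_test_bump[OF pq] PQ])
  have lim: "(\<lambda>n. \<phi> n x) \<longlonglongrightarrow> indicator (box p q) x" for x
  proof -
    have "(\<lambda>n. \<phi> n x) \<longlonglongrightarrow> indicator {p $ 1<..<q $ 1} (x $ 1) * indicator {p $ 2<..<q $ 2} (x $ 2)"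
      unfolding \<phi>_def tensor_def by (intro tendsto_mult bump_tendsto less_imp_le pq)
    moreover have "indicator {p $ 1<..<q $ 1} (x $ 1) * indicator {p $ 2<..<q $ 2} (x $ 2) = (indicator (box p q) x :: real)"
      by (auto simp: indicator_def mem_box_cart forall_2)
    ultimately show ?thesis by simp
  qed
  have \<phi>1: "\<bar>\<phi> n x\<bar> \<le> 1" for n x
    unfolding \<phi>_def tensor_def abs_mult using bump_bounds by (simp add: mult_le_one)
  have [measurable]: "f \<in> borel_measurable (lebesgue_on (cbox P Q))" using f by simp
  have m: "(\<lambda>x. f x * \<phi> n x) \<in> borel_measurable (lebesgue_on (cbox P Q))" for n
    using integrable_mult_continuous[OF compact_cbox f continuous_tensor] smooth_bump
    unfolding \<phi>_def by (blast intro: borel_measurable_integrable)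
  have "(\<lambda>n. \<integral>x. f x * \<phi> n x \<partial>lebesgue_on (cbox P Q)) \<longlonglongrightarrow>
      (\<integral>x. f x * indicator (box p q) x \<partial>lebesgue_on (cbox P Q))"
  proof (rule integral_dominated_convergence)
    show "integrable (lebesgue_on (cbox P Q)) (\<lambda>x. \<bar>f x\<bar>)" using f by simp
    show "(\<lambda>x. f x * indicator (box p q) x) \<in> borel_measurable (lebesgue_on (cbox P Q))"
      by (rule borel_measurable_LIMSEQ_real[OF tendsto_mult[OF tendsto_const lim] m])
    show "AE x in lebesgue_on (cbox P Q). norm (f x * \<phi> n x) \<le> \<bar>f x\<bar>" for n
      using \<phi>1 by (auto simp: abs_mult mult_left_le)
    show "AE x in lebesgue_on (cbox P Q). (\<lambda>n. f x * \<phi> n x) \<longlonglongrightarrow> f x * indicator (box p q) x"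
      by (intro AE_I2 tendsto_mult[OF tendsto_const lim])
  qed (rule m)
  moreover have "(\<integral>x. f x * \<phi> n x \<partial>lebesgue_on (cbox P Q)) = 0" for n
    unfolding \<phi>_def by (rule zero[OF \<phi>])
  ultimately show ?thesis by (simp add: LIMSEQ_const_iff mult.commute)
qed simp

text \<open>Extending \<open>f\<close> by 0 outside \<open>box P Q\<close> moves the question to the
  whole plane. An arbitrary box then reduces to one inside \<open>cbox P Q\<close>, because boxes
  intersect in boxes.\<close>

lemma box_tests_zero_imp_AE_zero:
  fixes f :: "real^2 \<Rightarrow> real"
  assumes f: "integrable (lebesgue_on (cbox P Q)) f"
    and zero: "\<And>a b. box_test P Q a b \<Longrightarrow> (\<integral>x. f x * tensor a b x \<partial>lebesgue_on (cbox P Q)) = 0"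
  shows "AE x in lebesgue. x \<in> box P Q \<longrightarrow> f x = 0"
proof -
  define F where "F x = indicator (box P Q) x * f x" for x
  have F: "(\<integral>x. indicator (box p q) x * F x \<partial>lebesgue) = 0" for p q
  proof -
    obtain p' q' where pq: "box p q \<inter> box P Q = box p' q'" unfolding box_Int_box by blast
    have sub: "box p' q' \<subseteq> cbox P Q" using pq box_subset_cbox by blast
    have eq: "indicator (box p q) x * F x = indicator (box p' q') x * f x" for x
      unfolding F_def pq[symmetric] by (auto simp: indicator_def)
    have "(\<integral>x. indicator (box p' q') x * f x \<partial>lebesgue_on UNIV) =
        (\<integral>x. indicator (box p' q') x * f x \<partial>lebesgue_on (cbox P Q))"
      by (rule integral_lebesgue_on_support) (use sub in \<open>auto simp: indicator_def\<close>)
    then show ?thesis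
      unfolding eq using box_tests_zero_imp_integral_box_zero[OF f zero sub] by (simp add: lebesgue_on_UNIV_eq)
  qed
  have eqF: "indicator (box P Q) x * F x = F x" for x by (auto simp: F_def indicator_def)
  have "integrable lebesgue F"
  proof -
    have "integrable lebesgue (\<lambda>x. indicator (cbox P Q) x *\<^sub>R f x)"
      using f by (simp add: integrable_restrict_space)
    then have "integrable lebesgue (\<lambda>x. indicator (box P Q) x *\<^sub>R (indicator (cbox P Q) x *\<^sub>R f x))"
      by (rule integrable_mult_indicator[rotated]) simp
    moreover have "indicator (box P Q) x *\<^sub>R (indicator (cbox P Q) x *\<^sub>R f x) = F x" for x
      using box_subset_cbox[of P Q] by (auto simp: F_def indicator_def)
    ultimately show ?thesis by simp
  qed
  \<comment> \<open>The total integral of \<open>F\<close> is the special case of the box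
    \<open>box P Q\<close> itself, outside which \<open>F\<close> vanishes.\<close>
  from integral_boxes_zero_imp_AE_zero[OF this _ F] F[of P Q]
  have "AE x in lebesgue. F x = 0" unfolding eqF by simp
  then show ?thesis by eventually_elim (auto simp: F_def)
qed

lemma integrable_cbox:
  "locally_integrable \<Omega> f \<Longrightarrow> cbox p q \<subseteq> \<Omega> \<Longrightarrow> integrable (lebesgue_on (cbox p q)) f"
  by (simp add: locally_integrable_def)

lemma integral_tensor_cbox:
  assumes "open \<Omega>" "cbox P Q \<subseteq> \<Omega>" "box_test P Q a b"
  shows "(\<integral>x. f x * tensor a b x \<partial>lebesgue_on \<Omega>) = (\<integral>x. f x * tensor a b x \<partial>lebesgue_on (cbox P Q))"
proof (rule integral_lebesgue_on_support)
  show "f x * tensor a b x = 0" if "x \<notin> cbox P Q" for x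
    using tensor_zero_outside[OF assms(3) that] by simp
qed (use assms in auto)

lemma fundamental_lemma_tensor:
  assumes \<Omega>: "open \<Omega>" and f: "locally_integrable \<Omega> f"
    and zero: "\<And>a b. tensor_test \<Omega> a b \<Longrightarrow> (\<integral>x. f x * tensor a b x \<partial>lebesgue_on \<Omega>) = 0"
  shows "AE x in lebesgue_on \<Omega>. f x = 0"
proof (rule AE_lebesgue_local)
  fix x assume "x \<in> \<Omega>"
  then obtain P Q where PQ: "cbox P Q \<subseteq> \<Omega>" "x \<in> box P Q"
    using open_contains_cbox[OF \<Omega>] by metis
  have "AE y in lebesgue. y \<in> box P Q \<longrightarrow> f y = 0"
  proof (rule box_tests_zero_imp_AE_zero[OF integrable_cbox[OF f PQ(1)]])
    fix a b assume ab: "box_test P Q a b"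
    then have "tensor_test \<Omega> a b" using PQ(1) unfolding tensor_test_def by blast
    from zero[OF this] show "(\<integral>x. f x * tensor a b x \<partial>lebesgue_on (cbox P Q)) = 0"
      unfolding integral_tensor_cbox[OF \<Omega> PQ(1) ab] .
  qed
  then show "\<exists>U. open U \<and> x \<in> U \<and> (AE y in lebesgue. y \<in> U \<longrightarrow> f y = 0)"
    using PQ(2) open_box by blast
qed (use \<Omega> in simp)

lemma locally_integrable_diff:
  "locally_integrable \<Omega> f \<Longrightarrow> locally_integrable \<Omega> g \<Longrightarrow> locally_integrable \<Omega> (\<lambda>x. f x - g x)"
  by (simp add: locally_integrable_def)

text \<open>Two direction lists of equal length are allowed, provided they agree on products. This
  gives uniqueness (equal lists) and the symmetry of mixed weak derivatives (swapped lists) in one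
  argument.\<close>

lemma weak_deriv_unique_tensor:
  assumes \<Omega>: "open \<Omega>" and g: "is_weak_deriv \<Omega> is f g" and h: "is_weak_deriv \<Omega> js f h"
    and len: "length is = length js"
    and tensor: "\<And>a b. tensor_test \<Omega> a b \<Longrightarrow> partials is (tensor a b) = partials js (tensor a b)"
  shows "AE x in lebesgue_on \<Omega>. g x = h x"
proof -
  have lg: "locally_integrable \<Omega> g" and lh: "locally_integrable \<Omega> h"
    using g h by (auto simp: is_weak_deriv_def)
  have "AE x in lebesgue_on \<Omega>. g x - h x = 0"
  proof (rule fundamental_lemma_tensor[OF \<Omega> locally_integrable_diff[OF lg lh]])
    fix a b assume ab: "tensor_test \<Omega> a b"
    note t = test_function_tensor[OF ab]
    have "(\<integral>x. f x * partials is (tensor a b) x \<partial>lebesgue_on \<Omega>) =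
        (- 1) ^ length is * (\<integral>x. g x * tensor a b x \<partial>lebesgue_on \<Omega>)"
      using g t unfolding is_weak_deriv_def by blast
    moreover have "(\<integral>x. f x * partials js (tensor a b) x \<partial>lebesgue_on \<Omega>) =
        (- 1) ^ length js * (\<integral>x. h x * tensor a b x \<partial>lebesgue_on \<Omega>)"
      using h t unfolding is_weak_deriv_def by blast
    ultimately have eq: "(\<integral>x. g x * tensor a b x \<partial>lebesgue_on \<Omega>) = (\<integral>x. h x * tensor a b x \<partial>lebesgue_on \<Omega>)"
      unfolding tensor[OF ab] len by simp
    have "integrable (lebesgue_on \<Omega>) (\<lambda>x. k x * tensor a b x)" if "locally_integrable \<Omega> k" for k
      using integrable_mult_test_function[OF \<Omega> that t, of "[]"] by (simp add: partials_def)
    with lg lh eq show "(\<integral>x. (g x - h x) * tensor a b x \<partial>lebesgue_on \<Omega>) = 0"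
      by (simp add: left_diff_distrib Bochner_Integration.integral_diff)
  qed
  then show ?thesis by eventually_elim simp
qed

lemma weak_deriv_unique:
  "open \<Omega> \<Longrightarrow> is_weak_deriv \<Omega> is f g \<Longrightarrow> is_weak_deriv \<Omega> is f h \<Longrightarrow> AE x in lebesgue_on \<Omega>. g x = h x"
  by (rule weak_deriv_unique_tensor[of _ "is" f _ "is"]) auto

lemma weak_deriv_commute:
  assumes "open \<Omega>" "is_weak_deriv \<Omega> [1, 2] f g" "is_weak_deriv \<Omega> [2, 1] f h"
  shows "AE x in lebesgue_on \<Omega>. g x = h x"
  using assms by (rule weak_deriv_unique_tensor) (auto simp: partials_tensor_test)

section \<open>Functions with vanishing weak gradient\<close>

text \<open>Modulo partial derivatives of products supported in the same box, every product is a
  multiple of the fixed one. The profile is first split off from \<open>a\<close>, then from what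
  multiplies \<open>b\<close>.\<close>

lemma tensor_decompose:
  assumes ab: "box_test P Q a b" and e: "box_test P Q e\<^sub>1 e\<^sub>2" and PQ: "\<And>i. P $ i < Q $ i"
    and "integral {P $ 1..Q $ 1} e\<^sub>1 \<noteq> 0" "integral {P $ 2..Q $ 2} e\<^sub>2 \<noteq> 0"
  obtains \<alpha> A B where "box_test P Q A b" "box_test P Q e\<^sub>1 B"
    "\<And>x. tensor a b x = \<alpha> * tensor e\<^sub>1 e\<^sub>2 x + tensor (deriv A) b x + tensor e\<^sub>1 (deriv B) x"
proof -
  have *: "smooth a" "smooth b" "\<And>s. s \<notin> {P $ 1..Q $ 1} \<Longrightarrow> a s = 0" "\<And>s. s \<notin> {P $ 2..Q $ 2} \<Longrightarrow> b s = 0"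
    using ab unfolding box_test_def by blast+
  have **: "smooth e\<^sub>1" "smooth e\<^sub>2" "\<And>s. s \<notin> {P $ 1..Q $ 1} \<Longrightarrow> e\<^sub>1 s = 0" "\<And>s. s \<notin> {P $ 2..Q $ 2} \<Longrightarrow> e\<^sub>2 s = 0"
    using e unfolding box_test_def by blast+
  obtain \<alpha> A where A: "smooth A" "\<And>s. s \<notin> {P $ 1..Q $ 1} \<Longrightarrow> A s = 0" "\<And>s. a s = \<alpha> * e\<^sub>1 s + deriv A s"
    using smooth_decompose[OF *(1,3) PQ **(1,3) assms(4)] by metis
  \<comment> \<open>The first coefficient is absorbed into the function before the second splitting,
    so the final coefficient is \<open>\<beta>\<close> alone.\<close>
  obtain \<beta> B where B: "smooth B" "\<And>s. s \<notin> {P $ 2..Q $ 2} \<Longrightarrow> B s = 0" "\<And>s. \<alpha> * b s = \<beta> * e\<^sub>2 s + deriv B s"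
  proof (rule smooth_decompose)
    show "smooth (\<lambda>s. \<alpha> * b s)" by (rule smooth_mult[OF smooth_const *(2)])
    show "\<alpha> * b s = 0" if "s \<notin> {P $ 2..Q $ 2}" for s using *(4)[OF that] by simp
  qed (use PQ ** assms(5) in auto)
  show thesis
  proof
    show "box_test P Q A b" "box_test P Q e\<^sub>1 B" using A B * ** unfolding box_test_def by blast+
    fix x
    have "tensor a b x = \<alpha> * b (x $ 2) * e\<^sub>1 (x $ 1) + deriv A (x $ 1) * b (x $ 2)"
      unfolding tensor_def A(3) by (simp add: algebra_simps)
    then show "tensor a b x = \<beta> * tensor e\<^sub>1 e\<^sub>2 x + tensor (deriv A) b x + tensor e\<^sub>1 (deriv B) x"
      unfolding B(3) by (simp add: tensor_def algebra_simps)
  qed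
qed

text \<open>This is the weak formulation for the constant function 1, whose weak derivatives are
  0.\<close>

lemma integral_tensor_deriv_zero:
  assumes "box_test P Q a b"
  shows "(\<integral>x. tensor (deriv a) b x \<partial>lebesgue_on (cbox P Q)) = 0"
    "(\<integral>x. tensor a (deriv b) x \<partial>lebesgue_on (cbox P Q)) = 0"
proof -
  have t: "tensor_test UNIV a b" using assms unfolding tensor_test_def by blast
  have "is_weak_deriv UNIV [i] (\<lambda>x. 1) (\<lambda>x. 0)" for i
    using is_weak_deriv_classical[of UNIV "\<lambda>x. 1" "\<lambda>x h. 0" i] by simp
  then have 0: "(\<integral>x. 1 * partials [i] (tensor a b) x \<partial>lebesgue_on UNIV) = 0" for i
    using test_function_tensor[OF t] by (auto simp: is_weak_deriv_def)
  show "(\<integral>x. tensor (deriv a) b x \<partial>lebesgue_on (cbox P Q)) = 0"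
    "(\<integral>x. tensor a (deriv b) x \<partial>lebesgue_on (cbox P Q)) = 0"
    using 0[of 1] 0[of 2] integral_tensor_cbox[of UNIV P Q "deriv a" b "\<lambda>x. 1"]
      integral_tensor_cbox[of UNIV P Q a "deriv b" "\<lambda>x. 1"] box_test_deriv[OF assms] partials_tensor_test[OF t]
    by simp_all
qed

text \<open>By \<open>tensor_decompose\<close>, a functional that kills partial derivatives is
  determined by its value on the fixed profile; subtracting the right constant makes that value 0 as
  well.\<close>

lemma weak_gradient_zero_box:
  fixes f :: "real^2 \<Rightarrow> real"
  assumes f: "integrable (lebesgue_on (cbox P Q)) f" and PQ: "\<And>i. P $ i < Q $ i"
    and zero: "\<And>a b. box_test P Q a b \<Longrightarrow> (\<integral>x. f x * tensor (deriv a) b x \<partial>lebesgue_on (cbox P Q)) = 0"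
      "\<And>a b. box_test P Q a b \<Longrightarrow> (\<integral>x. f x * tensor a (deriv b) x \<partial>lebesgue_on (cbox P Q)) = 0"
  shows "\<exists>k. AE x in lebesgue. x \<in> box P Q \<longrightarrow> f x = k"
proof -
  let ?M = "lebesgue_on (cbox P Q)"
  define e\<^sub>1 where "e\<^sub>1 = bump (P $ 1) (Q $ 1) 0"
  define e\<^sub>2 where "e\<^sub>2 = bump (P $ 2) (Q $ 2) 0"
  have e: "box_test P Q e\<^sub>1 e\<^sub>2" unfolding e\<^sub>1_def e\<^sub>2_def by (rule box_test_bump[OF PQ])
  have bump_int: "integral {p..q} (bump p q 0) \<noteq> 0" if "p < q" for p q
  proof
    assume "integral {p..q} (bump p q 0) = 0"
    then have "bump p q 0 ((p + q) / 2) = 0"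
      using integral_eq_0_iff[of p q "bump p q 0"] smooth_continuous[OF smooth_bump] bump_bounds that by auto
    then show False using bump_pos[of "(p + q) / 2" p q 0] that by auto
  qed
  have one: "integrable ?M (\<lambda>x. 1::real)"
    by (rule integrable_cbox[OF locally_integrable_continuous subset_UNIV]) (auto intro: continuous_intros)
  have int: "integrable ?M (\<lambda>x. g x * tensor a b x)" if "integrable ?M g" "box_test P Q a b" for g a b
    using that by (intro integrable_mult_continuous continuous_tensor) (auto simp: box_test_def)
  have e_int: "integrable ?M (tensor e\<^sub>1 e\<^sub>2)" using int[OF one e] by simp
  define s where "s = (\<integral>x. tensor e\<^sub>1 e\<^sub>2 x \<partial>?M)"
  have "s \<noteq> 0"
  proof
    assume "s = 0"
    then have "AE x in ?M. tensor e\<^sub>1 e\<^sub>2 x = 0"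
      unfolding s_def
      by (subst (asm) integral_nonneg_eq_0_iff_AE[OF e_int]) (auto simp: tensor_def e\<^sub>1_def e\<^sub>2_def bump_bounds)
    then have "AE x in lebesgue. x \<in> cbox P Q \<longrightarrow> tensor e\<^sub>1 e\<^sub>2 x = 0" by (simp add: AE_restrict_space_iff)
    then have "AE x in lebesgue. x \<notin> box P Q"
    proof eventually_elim
      case (elim x)
      show ?case
      proof
        assume x: "x \<in> box P Q"
        then have "0 < tensor e\<^sub>1 e\<^sub>2 x"
          by (auto simp: tensor_def e\<^sub>1_def e\<^sub>2_def mem_box_cart intro!: mult_pos_pos bump_pos)
        with elim x box_subset_cbox show False by force
      qed
    qed
    then have "negligible (box P Q)" by (simp add: negligible_iff_null_sets AE_iff_null_sets)
    then show False using PQ by (simp add: negligible_interval interval_eq_empty_cart not_le[symmetric])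
  qed
  \<comment> \<open>The weighted mean of \<open>f\<close>, which is exactly the constant making
    \<open>f - k\<close> orthogonal to the profile.\<close>
  define k where "k = (\<integral>x. f x * tensor e\<^sub>1 e\<^sub>2 x \<partial>?M) / s"
  have fk: "integrable ?M (\<lambda>x. f x - k)" using f one integrable_mult_right[OF one, of k] by simp
  have *: "(\<integral>x. (f x - k) * tensor a b x \<partial>?M) = (\<integral>x. f x * tensor a b x \<partial>?M) - k * (\<integral>x. tensor a b x \<partial>?M)"
    if "box_test P Q a b" for a b
    using int[OF f that] int[OF one that] by (simp add: left_diff_distrib)
  have "AE x in lebesgue. x \<in> box P Q \<longrightarrow> f x - k = 0"
  proof (rule box_tests_zero_imp_AE_zero[OF fk])
    fix a b assume ab: "box_test P Q a b"
    obtain \<alpha> A B where AB: "box_test P Q A b" "box_test P Q e\<^sub>1 B"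
      "\<And>x. tensor a b x = \<alpha> * tensor e\<^sub>1 e\<^sub>2 x + tensor (deriv A) b x + tensor e\<^sub>1 (deriv B) x"
      using tensor_decompose[OF ab e PQ bump_int[OF PQ, of 1, folded e\<^sub>1_def] bump_int[OF PQ, of 2, folded e\<^sub>2_def]] by metis
    note d = box_test_deriv(1)[OF AB(1)] box_test_deriv(2)[OF AB(2)]
    have "(\<integral>x. (f x - k) * tensor a b x \<partial>?M) = \<alpha> * (\<integral>x. (f x - k) * tensor e\<^sub>1 e\<^sub>2 x \<partial>?M)
       + (\<integral>x. (f x - k) * tensor (deriv A) b x \<partial>?M) + (\<integral>x. (f x - k) * tensor e\<^sub>1 (deriv B) x \<partial>?M)"
      unfolding AB(3) using int[OF fk e] int[OF fk d(1)] int[OF fk d(2)]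
      by (simp add: distrib_left mult.left_commute[of _ \<alpha>])
    also have "\<dots> = 0"
      unfolding *[OF e] *[OF d(1)] *[OF d(2)] zero(1)[OF AB(1)] zero(2)[OF AB(2)]
        integral_tensor_deriv_zero(1)[OF AB(1)] integral_tensor_deriv_zero(2)[OF AB(2)]
      using \<open>s \<noteq> 0\<close> by (simp add: k_def s_def)
    finally show "(\<integral>x. (f x - k) * tensor a b x \<partial>?M) = 0" .
  qed
  then show ?thesis by auto
qed

text \<open>Each point gets a neighbourhood and a constant. If two neighbourhoods overlap their
  constants agree, so the assignment of constants to points is locally constant and connectedness
  makes it global.\<close>

lemma weak_gradient_zero:
  assumes \<Omega>: "open \<Omega>" "connected \<Omega>" and f: "locally_integrable \<Omega> f"
    and zero: "\<And>a b. tensor_test \<Omega> a b \<Longrightarrow> (\<integral>x. f x * tensor (deriv a) b x \<partial>lebesgue_on \<Omega>) = 0"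
      "\<And>a b. tensor_test \<Omega> a b \<Longrightarrow> (\<integral>x. f x * tensor a (deriv b) x \<partial>lebesgue_on \<Omega>) = 0"
  shows "\<exists>k. AE x in lebesgue_on \<Omega>. f x = k"
proof -
  \<comment> \<open>Neighbourhood and constant are packed into one pair so that a single choice
    selects both.\<close>
  have "\<forall>x\<in>\<Omega>. \<exists>p. open (fst p) \<and> x \<in> fst p \<and> (AE y in lebesgue. y \<in> fst p \<longrightarrow> f y = snd p)"
  proof
    fix x assume x: "x \<in> \<Omega>"
    obtain P Q where PQ: "cbox P Q \<subseteq> \<Omega>" "x \<in> box P Q"
      using open_contains_cbox[OF \<Omega>(1) x] by metis
    have tt: "tensor_test \<Omega> a b" if "box_test P Q a b" for a b
      using that PQ(1) unfolding tensor_test_def by blast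
    obtain k where "AE y in lebesgue. y \<in> box P Q \<longrightarrow> f y = k"
    proof (rule exE[OF weak_gradient_zero_box[OF integrable_cbox[OF f PQ(1)] box_nonempty_cart[OF PQ(2)]]])
      fix a b assume ab: "box_test P Q a b"
      show "(\<integral>x. f x * tensor (deriv a) b x \<partial>lebesgue_on (cbox P Q)) = 0"
        using zero(1)[OF tt[OF ab]] integral_tensor_cbox[OF \<Omega>(1) PQ(1) box_test_deriv(1)[OF ab], of f] by simp
      show "(\<integral>x. f x * tensor a (deriv b) x \<partial>lebesgue_on (cbox P Q)) = 0"
        using zero(2)[OF tt[OF ab]] integral_tensor_cbox[OF \<Omega>(1) PQ(1) box_test_deriv(2)[OF ab], of f] by simp
    qed
    then show "\<exists>p. open (fst p) \<and> x \<in> fst p \<and> (AE y in lebesgue. y \<in> fst p \<longrightarrow> f y = snd p)"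
      using PQ(2) by (intro exI[of _ "(box P Q, k)"]) (simp add: open_box)
  qed
  from bchoice[OF this] obtain p where
    p: "\<forall>x\<in>\<Omega>. open (fst (p x)) \<and> x \<in> fst (p x) \<and> (AE y in lebesgue. y \<in> fst (p x) \<longrightarrow> f y = snd (p x))"
    by (elim exE)
  define U k where "U x = fst (p x)" and "k x = snd (p x)" for x
  have U: "open (U x)" "x \<in> U x" "AE y in lebesgue. y \<in> U x \<longrightarrow> f y = k x" if "x \<in> \<Omega>" for x
    using p[rule_format, OF that] by (simp_all add: U_def k_def)
  have "k constant_on \<Omega>"
  proof (rule locally_constant_imp_constant[OF \<Omega>(2)])
    fix x assume x: "x \<in> \<Omega>"
    have "k y = k x" if y: "y \<in> \<Omega> \<inter> U x" for y
    proof (rule ccontr)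
      assume ne: "k y \<noteq> k x"
      have ae: "AE z in lebesgue. z \<notin> U x \<inter> U y"
        using U(3)[OF x] U(3)[OF IntD1[OF y]] by eventually_elim (use ne in auto)
      have op: "open (U x \<inter> U y)" using U(1)[OF x] U(1)[OF IntD1[OF y]] by (rule open_Int)
      \<comment> \<open>Two different constants would make the overlap a null set, but it is open
        and contains \<open>y\<close>.\<close>
      have "U x \<inter> U y \<in> null_sets lebesgue"
        by (rule AE_iff_null_sets[THEN iffD2, OF _ ae]) (simp add: op)
      moreover have "y \<in> U x \<inter> U y" using U(2)[OF IntD1[OF y]] y by blast
      ultimately show False
        using open_not_negligible[OF op] unfolding negligible_iff_null_sets by blast
    qed
    then show "\<exists>T. openin (top_of_set \<Omega>) T \<and> x \<in> T \<and> (\<forall>y\<in>T. k y = k x)"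
      using openin_open_Int[OF U(1)[OF x]] IntI[OF x U(2)[OF x]] by blast
  qed
  then obtain c where c: "\<And>x. x \<in> \<Omega> \<Longrightarrow> k x = c" unfolding constant_on_def by blast
  have "AE x in lebesgue_on \<Omega>. f x = c"
  proof (rule AE_lebesgue_local)
    fix x assume x: "x \<in> \<Omega>"
    show "\<exists>V. open V \<and> x \<in> V \<and> (AE y in lebesgue. y \<in> V \<longrightarrow> f y = c)"
      using U[OF x] unfolding c[OF x] by (intro exI[of _ "U x"] conjI)
  qed (use \<Omega> in simp)
  then show ?thesis by blast
qed

section \<open>Weak derivatives\<close>

lemma AE_lebesgue_on_subset:
  assumes "AE x in lebesgue_on S. P x" "K \<subseteq> S" "S \<in> sets lebesgue" "K \<in> sets lebesgue"
  shows "AE x in lebesgue_on K. P x"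
proof -
  have "AE x in lebesgue. x \<in> S \<longrightarrow> P x" using assms by (simp add: AE_restrict_space_iff)
  then have "AE x in lebesgue. x \<in> K \<longrightarrow> P x" by eventually_elim (use assms(2) in blast)
  then show ?thesis using assms by (simp add: AE_restrict_space_iff)
qed

lemma integral_mult_AE_cong:
  fixes f g h :: "'a::euclidean_space \<Rightarrow> real"
  assumes "open \<Omega>" and eq: "AE x in lebesgue_on \<Omega>. f x = g x"
  shows "(\<integral>x. f x * h x \<partial>lebesgue_on \<Omega>) = (\<integral>x. g x * h x \<partial>lebesgue_on \<Omega>)"
proof (rule integral_cong_AE_lebesgue_on)
  show "AE x in lebesgue_on \<Omega>. f x * h x = g x * h x" using eq by eventually_elim simp
qed (use assms(1) in simp)

lemma is_weak_deriv_cong_AE: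
  assumes \<Omega>: "open \<Omega>" and f: "is_weak_deriv \<Omega> is f g" and eq: "AE x in lebesgue_on \<Omega>. f x = f' x"
  shows "is_weak_deriv \<Omega> is f' g"
proof -
  have "locally_integrable \<Omega> f'"
    unfolding locally_integrable_def
  proof (intro allI impI)
    fix K assume K: "compact K \<and> K \<subseteq> \<Omega>"
    then have Kl: "K \<in> sets lebesgue" using borel_compact[of K] by simp
    have "integrable (lebesgue_on K) f" using f K by (simp add: is_weak_deriv_def locally_integrable_def)
    moreover have "AE x in lebesgue_on K. f x = f' x"
      by (rule AE_lebesgue_on_subset[OF eq _ _ Kl]) (use K \<Omega> in auto)
    ultimately show "integrable (lebesgue_on K) f'"
      by (rule integrable_cong_AE_lebesgue_on[OF Kl])
  qed
  moreover have "(\<integral>x. f x * \<psi> x \<partial>lebesgue_on \<Omega>) = (\<integral>x. f' x * \<psi> x \<partial>lebesgue_on \<Omega>)" for \<psi>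
    by (rule integral_mult_AE_cong[OF \<Omega> eq])
  ultimately show ?thesis using f by (simp add: is_weak_deriv_def)
qed

text \<open>Moving derivatives off the test function starts with the outermost one. A weak
  derivative along \<open>[i, j]\<close> is thus taken first in direction \<open>i\<close>, then in
  \<open>j\<close>, in the reverse order of \<open>partials\<close>.\<close>

lemma is_weak_deriv_compose:
  assumes f: "is_weak_deriv \<Omega> [i] f g" and g: "is_weak_deriv \<Omega> [j] g h"
  shows "is_weak_deriv \<Omega> [i, j] f h"
  unfolding is_weak_deriv_def
proof (intro conjI allI impI)
  show "locally_integrable \<Omega> f" "locally_integrable \<Omega> h" using f g by (auto simp: is_weak_deriv_def)
  fix \<phi> assume \<phi>: "test_function \<Omega> \<phi>"
  have "(\<integral>x. f x * partials [i] (partials [j] \<phi>) x \<partial>lebesgue_on \<Omega>) =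
      (- 1) ^ length [i] * (\<integral>x. g x * partials [j] \<phi> x \<partial>lebesgue_on \<Omega>)"
    using f test_function_partials[OF \<phi>] unfolding is_weak_deriv_def by blast
  moreover have "(\<integral>x. g x * partials [j] \<phi> x \<partial>lebesgue_on \<Omega>) =
      (- 1) ^ length [j] * (\<integral>x. h x * \<phi> x \<partial>lebesgue_on \<Omega>)"
    using g \<phi> unfolding is_weak_deriv_def by blast
  ultimately show "(\<integral>x. f x * partials [i, j] \<phi> x \<partial>lebesgue_on \<Omega>) =
      (- 1) ^ length [i, j] * (\<integral>x. h x * \<phi> x \<partial>lebesgue_on \<Omega>)"
    by (simp add: partials_append)
qed

text \<open>Here \<open>partials [j] \<phi>\<close> is itself used as a test function against the
  known derivative \<open>g\<close>; equating the two expressions for the same integral leaves the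
  formula for \<open>g\<close>.\<close>

lemma is_weak_deriv_decompose:
  assumes h: "is_weak_deriv \<Omega> [i, j] f h" and g: "is_weak_deriv \<Omega> [i] f g"
  shows "is_weak_deriv \<Omega> [j] g h"
  unfolding is_weak_deriv_def
proof (intro conjI allI impI)
  show "locally_integrable \<Omega> g" "locally_integrable \<Omega> h" using h g by (auto simp: is_weak_deriv_def)
  fix \<phi> assume \<phi>: "test_function \<Omega> \<phi>"
  have "(\<integral>x. f x * partials [i] (partials [j] \<phi>) x \<partial>lebesgue_on \<Omega>) =
      (- 1) ^ length [i] * (\<integral>x. g x * partials [j] \<phi> x \<partial>lebesgue_on \<Omega>)"
    using g test_function_partials[OF \<phi>] unfolding is_weak_deriv_def by blast
  moreover have "(\<integral>x. f x * partials [i, j] \<phi> x \<partial>lebesgue_on \<Omega>) =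
      (- 1) ^ length [i, j] * (\<integral>x. h x * \<phi> x \<partial>lebesgue_on \<Omega>)"
    using h \<phi> unfolding is_weak_deriv_def by blast
  ultimately show "(\<integral>x. g x * partials [j] \<phi> x \<partial>lebesgue_on \<Omega>) =
      (- 1) ^ length [j] * (\<integral>x. h x * \<phi> x \<partial>lebesgue_on \<Omega>)"
    by (simp add: partials_append)
qed

lemma is_weak_deriv_tensor:
  assumes "is_weak_deriv \<Omega> [1] f g" "tensor_test \<Omega> a b"
  shows "(\<integral>x. f x * tensor (deriv a) b x \<partial>lebesgue_on \<Omega>) = - (\<integral>x. g x * tensor a b x \<partial>lebesgue_on \<Omega>)"
  using assms test_function_tensor[OF assms(2)] unfolding is_weak_deriv_def
  by (auto simp flip: partials_tensor_test(1)[OF assms(2)])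

lemma is_weak_deriv_tensor':
  assumes "is_weak_deriv \<Omega> [2] f g" "tensor_test \<Omega> a b"
  shows "(\<integral>x. f x * tensor a (deriv b) x \<partial>lebesgue_on \<Omega>) = - (\<integral>x. g x * tensor a b x \<partial>lebesgue_on \<Omega>)"
  using assms test_function_tensor[OF assms(2)] unfolding is_weak_deriv_def
  by (auto simp flip: partials_tensor_test(2)[OF assms(2)])

lemma integrable_tensor:
  assumes "open \<Omega>" "locally_integrable \<Omega> f" "tensor_test \<Omega> a b"
  shows "integrable (lebesgue_on \<Omega>) (\<lambda>x. f x * tensor a b x)"
  using integrable_mult_test_function[OF assms(1,2) test_function_tensor[OF assms(3)], of "[]"]
  by (simp add: partials_def)

lemma weak_gradients_eq_imp_const_diff:
  assumes \<Omega>: "open \<Omega>" "connected \<Omega>"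
    and f: "\<And>i. is_weak_deriv \<Omega> [i] f (f' i)" and h: "\<And>i. is_weak_deriv \<Omega> [i] h (h' i)"
    and eq: "\<And>i. AE x in lebesgue_on \<Omega>. f' i x = h' i x"
  shows "\<exists>d. AE x in lebesgue_on \<Omega>. f x = h x + d"
proof -
  have lf: "locally_integrable \<Omega> f" and lh: "locally_integrable \<Omega> h"
    using f h by (auto simp: is_weak_deriv_def)
  have *: "(\<integral>x. (f x - h x) * tensor a b x \<partial>lebesgue_on \<Omega>) =
      (\<integral>x. f x * tensor a b x \<partial>lebesgue_on \<Omega>) - (\<integral>x. h x * tensor a b x \<partial>lebesgue_on \<Omega>)"
    if "tensor_test \<Omega> a b" for a b
    using integrable_tensor[OF \<Omega>(1) lf that] integrable_tensor[OF \<Omega>(1) lh that]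
    by (simp add: left_diff_distrib)
  have "\<exists>d. AE x in lebesgue_on \<Omega>. f x - h x = d"
  proof (rule weak_gradient_zero[OF \<Omega> locally_integrable_diff[OF lf lh]])
    fix a b assume t: "tensor_test \<Omega> a b"
    show "(\<integral>x. (f x - h x) * tensor (deriv a) b x \<partial>lebesgue_on \<Omega>) = 0"
      unfolding *[OF tensor_test_deriv(1)[OF t]] is_weak_deriv_tensor[OF f t] is_weak_deriv_tensor[OF h t]
      using integral_mult_AE_cong[OF \<Omega>(1) eq[of 1], of "tensor a b"] by simp
    show "(\<integral>x. (f x - h x) * tensor a (deriv b) x \<partial>lebesgue_on \<Omega>) = 0"
      unfolding *[OF tensor_test_deriv(2)[OF t]] is_weak_deriv_tensor'[OF f t] is_weak_deriv_tensor'[OF h t]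
      using integral_mult_AE_cong[OF \<Omega>(1) eq[of 2], of "tensor a b"] by simp
  qed
  then obtain d where "AE x in lebesgue_on \<Omega>. f x - h x = d" by blast
  then have "AE x in lebesgue_on \<Omega>. f x = h x + d" by eventually_elim simp
  then show ?thesis by blast
qed

lemma is_weak_deriv_affine:
  assumes "open \<Omega>"
  shows "is_weak_deriv \<Omega> [i] (\<lambda>x. e \<bullet> x + d) (\<lambda>x. e $ i)"
proof -
  have "is_weak_deriv \<Omega> [i] (\<lambda>x. e \<bullet> x + d) (\<lambda>x. e \<bullet> axis i 1)"
    by (rule is_weak_deriv_classical[OF assms, of _ "\<lambda>x h. e \<bullet> h"]) (auto intro!: derivative_eq_intros)
  then show ?thesis by (simp add: inner_axis)
qed

lemma is_weak_deriv_quadratic: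
  fixes H :: "real^2^2"
  assumes "open \<Omega>" and H: "transpose H = H"
  shows "is_weak_deriv \<Omega> [i] (\<lambda>x. 1/2 * (x \<bullet> (H *v x)) + p \<bullet> x + d) (\<lambda>x. (H $ i) \<bullet> x + p $ i)"
proof -
  have lin: "((\<lambda>x. H *v x) has_derivative (\<lambda>h. H *v h)) (at x)" for x
    by (rule bounded_linear_imp_has_derivative) (rule matrix_vector_mul_bounded_linear)
  have sym: "x \<bullet> (H *v h) = (H *v x) \<bullet> h" for x h
    using dot_lmul_matrix[of x H h] H by (metis transpose_matrix_vector)
  have "is_weak_deriv \<Omega> [i] (\<lambda>x. 1/2 * (x \<bullet> (H *v x)) + p \<bullet> x + d) (\<lambda>x. (H *v x + p) \<bullet> axis i 1)"
  proof (rule is_weak_deriv_classical[OF assms(1), of _ "\<lambda>x h. (H *v x + p) \<bullet> h"])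
    show "((\<lambda>x. 1/2 * (x \<bullet> (H *v x)) + p \<bullet> x + d) has_derivative (\<lambda>h. (H *v x + p) \<bullet> h)) (at x)" for x
    proof -
      have "((\<lambda>x. x \<bullet> (H *v x)) has_derivative (\<lambda>h. x \<bullet> (H *v h) + h \<bullet> (H *v x))) (at x)"
        by (rule has_derivative_inner[OF has_derivative_ident lin])
      then have "((\<lambda>x. x \<bullet> (H *v x)) has_derivative (\<lambda>h. 2 * ((H *v x) \<bullet> h))) (at x)"
      proof (rule has_derivative_eq_rhs)
        have "x \<bullet> (H *v h) + h \<bullet> (H *v x) = 2 * ((H *v x) \<bullet> h)" for h
          using sym[of x h] inner_commute[of h "H *v x"] by simp
        then show "(\<lambda>h. x \<bullet> (H *v h) + h \<bullet> (H *v x)) = (\<lambda>h. 2 * ((H *v x) \<bullet> h))" by (rule ext)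
      qed
      moreover have "((\<lambda>x. p \<bullet> x) has_derivative (\<lambda>h. p \<bullet> h)) (at x)"
        by (rule bounded_linear_imp_has_derivative) (rule bounded_linear_inner_right)
      ultimately have "((\<lambda>x. 1/2 * (x \<bullet> (H *v x)) + p \<bullet> x + d) has_derivative
          (\<lambda>h. 1/2 * (2 * ((H *v x) \<bullet> h)) + p \<bullet> h + 0)) (at x)"
        by (intro has_derivative_add has_derivative_mult_right has_derivative_const)
      then show ?thesis by (simp add: inner_add_left)
    qed
    show "continuous_on UNIV (\<lambda>x. (H *v x + p) \<bullet> axis i 1)"
      by (intro continuous_intros matrix_vector_mult_linear_continuous_on)
  qed
  moreover have "(H *v x + p) \<bullet> axis i 1 = (H $ i) \<bullet> x + p $ i" for x
    by (simp add: inner_axis matrix_vector_mul_component)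
  ultimately show ?thesis by simp
qed

lemma weak_gradient_const:
  assumes \<Omega>: "open \<Omega>" "connected \<Omega>" and f: "\<And>i. is_weak_deriv \<Omega> [i] f (f' i)"
    and e: "\<And>i. AE x in lebesgue_on \<Omega>. f' i x = e $ i"
  shows "\<exists>d. AE x in lebesgue_on \<Omega>. f x = e \<bullet> x + d"
  using weak_gradients_eq_imp_const_diff[OF \<Omega> f is_weak_deriv_affine[OF \<Omega>(1), of _ e 0] e] by simp

text \<open>Two integrations: each first derivative has a constant gradient, namely a row of
  \<open>H\<close>, and is affine; the resulting constants form the vector \<open>p\<close>, and
  \<open>f\<close> then has the same weak gradient as a quadratic polynomial.\<close>

lemma weak_hessian_const:
  fixes H :: "real^2^2"
  assumes \<Omega>: "open \<Omega>" "connected \<Omega>" and f: "\<And>i. is_weak_deriv \<Omega> [i] f (f' i)"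
    and f': "\<And>i j. is_weak_deriv \<Omega> [i, j] f (f'' i j)" and H: "transpose H = H"
    and e: "\<And>i j. AE x in lebesgue_on \<Omega>. f'' i j x = H $ i $ j"
  shows "\<exists>p d. AE x in lebesgue_on \<Omega>. f x = 1/2 * (x \<bullet> (H *v x)) + p \<bullet> x + d"
proof -
  have "\<forall>i. \<exists>d. AE x in lebesgue_on \<Omega>. f' i x = (H $ i) \<bullet> x + d"
    using weak_gradient_const[OF \<Omega> is_weak_deriv_decompose[OF f' f] e] by blast
  from choice[OF this] obtain q where q: "\<And>i. AE x in lebesgue_on \<Omega>. f' i x = (H $ i) \<bullet> x + q i" by blast
  define p :: "real^2" where "p = (\<chi> i. q i)"
  have "AE x in lebesgue_on \<Omega>. f' i x = (H $ i) \<bullet> x + p $ i" for i using q[of i] by (simp add: p_def)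
  from weak_gradients_eq_imp_const_diff[OF \<Omega> f is_weak_deriv_quadratic[OF \<Omega>(1) H] this]
  obtain d where "AE x in lebesgue_on \<Omega>. f x = 1/2 * (x \<bullet> (H *v x)) + p \<bullet> x + 0 + d" by blast
  then have "AE x in lebesgue_on \<Omega>. f x = 1/2 * (x \<bullet> (H *v x)) + p \<bullet> x + d" by simp
  then show ?thesis by blast
qed

text \<open>If the symmetrised gradient is constant, then the off-diagonal derivative
  \<open>\<partial>\<^sub>2u\<^sub>1\<close> has vanishing gradient: \<open>\<partial>\<^sub>1\<partial>\<^sub>2u\<^sub>1 = \<partial>\<^sub>2\<partial>\<^sub>1u\<^sub>1 = 0\<close> and
  \<open>\<partial>\<^sub>2\<partial>\<^sub>2u\<^sub>1 = - \<partial>\<^sub>2\<partial>\<^sub>1u\<^sub>2 = - \<partial>\<^sub>1\<partial>\<^sub>2u\<^sub>2 = 0\<close>.\<close>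

lemma weak_sym_gradient_const:
  fixes S :: "real^2^2" and u :: "real^2 \<Rightarrow> real^2"
  assumes \<Omega>: "open \<Omega>" "connected \<Omega>"
    and u: "\<And>i j. is_weak_deriv \<Omega> [j] (\<lambda>x. u x $ i) (g i j)"
    and S: "transpose S = S"
    and sym: "\<And>i j. AE x in lebesgue_on \<Omega>. (g i j x + g j i x) / 2 = S $ i $ j"
  shows "\<exists>R c. transpose R = - R \<and> (AE x in lebesgue_on \<Omega>. u x = S *v x + (R *v x + c))"
proof -
  have g11: "AE x in lebesgue_on \<Omega>. g 1 1 x = S $ 1 $ 1" and g22: "AE x in lebesgue_on \<Omega>. g 2 2 x = S $ 2 $ 2"
    using sym[of 1 1] sym[of 2 2] by auto
  have g12: "AE x in lebesgue_on \<Omega>. g 1 2 x = 2 * S $ 1 $ 2 - g 2 1 x"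
    using sym[of 1 2] by eventually_elim (simp add: field_simps)
  have l: "locally_integrable \<Omega> (g i j)" for i j using u by (auto simp: is_weak_deriv_def)
  have const: "is_weak_deriv \<Omega> [i] (\<lambda>x. k) (\<lambda>x. 0)" for i k
    using is_weak_deriv_affine[OF \<Omega>(1), of i 0 k] by simp
  have c1: "(\<integral>x. k * tensor (deriv a) b x \<partial>lebesgue_on \<Omega>) = 0" if "tensor_test \<Omega> a b" for k a b
    using is_weak_deriv_tensor[OF const that] by simp
  have c2: "(\<integral>x. k * tensor a (deriv b) x \<partial>lebesgue_on \<Omega>) = 0" if "tensor_test \<Omega> a b" for k a b
    using is_weak_deriv_tensor'[OF const that] by simp
  have "\<exists>k. AE x in lebesgue_on \<Omega>. g 1 2 x = k"
  proof (rule weak_gradient_zero[OF \<Omega> l])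
    fix a b assume t: "tensor_test \<Omega> a b"
    note ta = tensor_test_deriv(1)[OF t] and tb = tensor_test_deriv(2)[OF t]
    \<comment> \<open>Both integrals are minus the integral of \<open>u x $ 1\<close> against
      \<open>tensor (deriv a) (deriv b)\<close>: second derivatives are exchanged on the test
      function, without second weak derivatives of \<open>u\<close>.\<close>
    have "(\<integral>x. g 1 2 x * tensor (deriv a) b x \<partial>lebesgue_on \<Omega>) = (\<integral>x. g 1 1 x * tensor a (deriv b) x \<partial>lebesgue_on \<Omega>)"
      using is_weak_deriv_tensor'[OF u ta, of 1] is_weak_deriv_tensor[OF u tb, of 1] by simp
    also have "\<dots> = 0"
      unfolding integral_mult_AE_cong[OF \<Omega>(1) g11] by (rule c2[OF t])
    finally show "(\<integral>x. g 1 2 x * tensor (deriv a) b x \<partial>lebesgue_on \<Omega>) = 0" .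
    have "(\<integral>x. g 1 2 x * tensor a (deriv b) x \<partial>lebesgue_on \<Omega>) =
        (\<integral>x. 2 * S $ 1 $ 2 * tensor a (deriv b) x - g 2 1 x * tensor a (deriv b) x \<partial>lebesgue_on \<Omega>)"
      unfolding integral_mult_AE_cong[OF \<Omega>(1) g12] by (simp add: left_diff_distrib)
    also have "\<dots> = (\<integral>x. 2 * S $ 1 $ 2 * tensor a (deriv b) x \<partial>lebesgue_on \<Omega>)
        - (\<integral>x. g 2 1 x * tensor a (deriv b) x \<partial>lebesgue_on \<Omega>)"
      using integrable_tensor[OF \<Omega>(1) l tb]
        integrable_tensor[OF \<Omega>(1) locally_integrable_continuous[OF continuous_on_const] tb]
      by (intro Bochner_Integration.integral_diff)
    \<comment> \<open>The constant part integrates to 0, and the other part is exchanged as above,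
      now through \<open>u x $ 2\<close>.\<close>
    also have "\<dots> = - (\<integral>x. g 2 2 x * tensor (deriv a) b x \<partial>lebesgue_on \<Omega>)"
      using c2[OF t] is_weak_deriv_tensor[OF u tb, of 2] is_weak_deriv_tensor'[OF u ta, of 2] by simp
    also have "\<dots> = 0"
      unfolding integral_mult_AE_cong[OF \<Omega>(1) g22] using c1[OF t] by simp
    finally show "(\<integral>x. g 1 2 x * tensor a (deriv b) x \<partial>lebesgue_on \<Omega>) = 0" .
  qed
  then obtain k where k: "AE x in lebesgue_on \<Omega>. g 1 2 x = k" by blast
  \<comment> \<open>The skew matrix for which \<open>S + R\<close> has upper right entry
    \<open>k\<close>; the lower left entry then matches because the two off-diagonal derivatives add
    up to \<open>2 * S $ 1 $ 2\<close>.\<close>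
  define R :: "real^2^2" where "R = vector [vector [0, k - S $ 1 $ 2], vector [S $ 1 $ 2 - k, 0]]"
  have R: "R $ 1 $ 1 = 0" "R $ 2 $ 2 = 0" "R $ 1 $ 2 = k - S $ 1 $ 2" "R $ 2 $ 1 = S $ 1 $ 2 - k"
    by (auto simp: R_def)
  have S12: "S $ 2 $ 1 = S $ 1 $ 2" using arg_cong[OF S, of "\<lambda>A. A $ 1 $ 2"] by (simp add: transpose_def)
  have g: "AE x in lebesgue_on \<Omega>. g i j x = (S + R) $ i $ j" for i j
  proof -
    have "AE x in lebesgue_on \<Omega>. g 2 1 x = (S + R) $ 2 $ 1"
      using k g12 by eventually_elim (simp add: R S12)
    moreover have "AE x in lebesgue_on \<Omega>. g 1 2 x = (S + R) $ 1 $ 2" using k by (simp add: R)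
    moreover have "i = 1 \<or> i = 2" "j = 1 \<or> j = 2" using exhaust_2 by auto
    moreover have "AE x in lebesgue_on \<Omega>. g 1 1 x = (S + R) $ 1 $ 1"
      "AE x in lebesgue_on \<Omega>. g 2 2 x = (S + R) $ 2 $ 2" using g11 g22 by (simp_all add: R)
    ultimately show ?thesis by (elim disjE) (simp_all only:)
  qed
  have "\<forall>i. \<exists>d. AE x in lebesgue_on \<Omega>. u x $ i = (S + R) $ i \<bullet> x + d"
    using weak_gradient_const[OF \<Omega> u g] by blast
  from choice[OF this] obtain d where d: "\<And>i. AE x in lebesgue_on \<Omega>. u x $ i = (S + R) $ i \<bullet> x + d i" by blast
  have "AE x in lebesgue_on \<Omega>. u x = S *v x + (R *v x + (\<chi> i. d i))"
    using d[of 1] d[of 2]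
    by eventually_elim (simp add: vec_eq_iff forall_2 matrix_vector_mul_component inner_add_left)
  moreover have "transpose R = - R" by (simp add: vec_eq_iff forall_2 transpose_def R)
  ultimately show ?thesis by blast
qed

section \<open>Sobolev spaces\<close>

lemma L2_on_cong_AE:
  assumes "open \<Omega>" "L2_on \<Omega> f" "AE x in lebesgue_on \<Omega>. f x = g x"
  shows "L2_on \<Omega> g"
proof -
  have \<Omega>: "\<Omega> \<in> sets lebesgue" using assms(1) by simp
  have ae: "AE x in lebesgue_on \<Omega>. (f x)\<^sup>2 = (g x)\<^sup>2" using assms(3) by eventually_elim simp
  have f: "f \<in> borel_measurable (lebesgue_on \<Omega>)" "integrable (lebesgue_on \<Omega>) (\<lambda>x. (f x)\<^sup>2)"
    using assms(2) unfolding L2_on_def by blast+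
  show ?thesis
    unfolding L2_on_def
    using borel_measurable_lebesgue_on_AE[OF \<Omega> f(1) assms(3)] integrable_cong_AE_lebesgue_on[OF \<Omega> f(2) ae] ..
qed

lemma L2_on_continuous:
  assumes \<Omega>: "open \<Omega>" "bounded \<Omega>" and p: "continuous_on UNIV p"
  shows "L2_on \<Omega> p"
proof -
  have K: "compact (closure \<Omega>)" using \<Omega> by (simp add: compact_closure)
  have K': "closure \<Omega> \<in> sets lebesgue" using borel_compact[OF K] by simp
  have "continuous_on UNIV (\<lambda>x. (p x)\<^sup>2)" using p by (intro continuous_intros)
  from locally_integrable_continuous[OF this, of UNIV] K
  have "integrable (lebesgue_on (closure \<Omega>)) (\<lambda>x. (p x)\<^sup>2)"
    unfolding locally_integrable_def by blast
  then have "set_integrable lebesgue (closure \<Omega>) (\<lambda>x. (p x)\<^sup>2)"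
    using K' by (simp add: set_integrable_def integrable_restrict_space)
  then have "set_integrable lebesgue \<Omega> (\<lambda>x. (p x)\<^sup>2)"
    by (rule set_integrable_subset) (use \<Omega> closure_subset in auto)
  then have "integrable (lebesgue_on \<Omega>) (\<lambda>x. (p x)\<^sup>2)"
    using \<Omega> by (simp add: set_integrable_def integrable_restrict_space)
  moreover have "p \<in> borel_measurable (lebesgue_on \<Omega>)"
    by (rule continuous_imp_measurable_on_sets_lebesgue[OF continuous_on_subset[OF p subset_UNIV]]) (use \<Omega> in simp)
  ultimately show ?thesis by (simp add: L2_on_def)
qed

text \<open>The choice in \<open>weak_deriv\<close> ranges over all weak derivatives, so the chosen
  one inherits square integrability only through almost everywhere uniqueness.\<close>

lemma weak_deriv_sobolev2:
  assumes "open \<Omega>" "f \<in> sobolev2 k \<Omega>" "length is \<le> k"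
  shows "is_weak_deriv \<Omega> is f (weak_deriv \<Omega> is f)" "L2_on \<Omega> (weak_deriv \<Omega> is f)"
proof -
  obtain g where g: "L2_on \<Omega> g" "is_weak_deriv \<Omega> is f g" using assms(2,3) by (auto simp: sobolev2_def)
  show *: "is_weak_deriv \<Omega> is f (weak_deriv \<Omega> is f)"
    unfolding weak_deriv_def by (rule someI[of "is_weak_deriv \<Omega> is f", OF g(2)])
  show "L2_on \<Omega> (weak_deriv \<Omega> is f)"
    by (rule L2_on_cong_AE[OF assms(1) g(1) weak_deriv_unique[OF assms(1) g(2) *]])
qed

lemma weak_deriv_eq_AE:
  assumes "open \<Omega>" "is_weak_deriv \<Omega> is f g"
  shows "AE x in lebesgue_on \<Omega>. weak_deriv \<Omega> is f x = g x"
  using weak_deriv_unique[OF assms(1) someI[of "is_weak_deriv \<Omega> is f", OF assms(2)] assms(2)]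
  by (simp add: weak_deriv_def)

lemma is_weak_deriv_Nil: "locally_integrable \<Omega> f \<Longrightarrow> is_weak_deriv \<Omega> [] f f"
  by (simp add: is_weak_deriv_def partials_def)

lemma AE_all_2: "(\<And>i::2. AE x in M. P i x) \<Longrightarrow> AE x in M. \<forall>i. P i x"
  by (simp add: AE_all_countable)

text \<open>Used for the converse direction, that the claimed functions are admissible with the
  right gradient: on a bounded domain polynomials are square integrable, and everything is stable
  under changes on null sets.\<close>

lemma affine_sobolev2:
  fixes A :: "real^2^2"
  assumes \<Omega>: "open \<Omega>" "bounded \<Omega>" and u: "AE x in lebesgue_on \<Omega>. u x = A *v x + c"
  shows "(\<lambda>x. u x $ i) \<in> sobolev2 1 \<Omega>"
    and "AE x in lebesgue_on \<Omega>. sym_grad \<Omega> u x = (1/2) *\<^sub>R (A + transpose A)"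
proof -
  have eq: "AE x in lebesgue_on \<Omega>. A $ i \<bullet> x + c $ i = u x $ i" for i
    using u by eventually_elim (simp add: matrix_vector_mul_component)
  have d: "is_weak_deriv \<Omega> [j] (\<lambda>x. u x $ i) (\<lambda>x. A $ i $ j)" for i j
    by (rule is_weak_deriv_cong_AE[OF \<Omega>(1) is_weak_deriv_affine[OF \<Omega>(1)] eq])
  have L2: "L2_on \<Omega> (\<lambda>x. u x $ i)" for i
    by (rule L2_on_cong_AE[OF \<Omega>(1) L2_on_continuous[OF \<Omega>] eq]) (intro continuous_intros)
  show "(\<lambda>x. u x $ i) \<in> sobolev2 1 \<Omega>"
    unfolding sobolev2_def
  proof (intro CollectI conjI allI impI L2)
    fix "is" :: "2 list" assume "length is \<le> 1"
    then consider "is = []" | j where "is = [j]" by (cases "is") auto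
    then show "\<exists>g. L2_on \<Omega> g \<and> is_weak_deriv \<Omega> is (\<lambda>x. u x $ i) g"
    proof cases
      case 1
      then show ?thesis using L2[of i] d[of _ i] is_weak_deriv_Nil by (auto simp: is_weak_deriv_def)
    next
      case 2
      then show ?thesis using d[of j i] L2_on_continuous[OF \<Omega> continuous_on_const] by blast
    qed
  qed
  have "AE x in lebesgue_on \<Omega>. \<forall>i. \<forall>j. weak_deriv \<Omega> [j] (\<lambda>x. u x $ i) x = A $ i $ j"
    by (intro AE_all_2 weak_deriv_eq_AE \<Omega> d)
  then show "AE x in lebesgue_on \<Omega>. sym_grad \<Omega> u x = (1/2) *\<^sub>R (A + transpose A)"
    by eventually_elim (simp add: sym_grad_def weak_grad_def vec_eq_iff transpose_def)
qed

lemma quadratic_sobolev2: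
  fixes H :: "real^2^2"
  assumes \<Omega>: "open \<Omega>" "bounded \<Omega>" and H: "transpose H = H"
    and v: "AE x in lebesgue_on \<Omega>. v x = 1/2 * (x \<bullet> (H *v x)) + p \<bullet> x + d"
  shows "v \<in> sobolev2 2 \<Omega>" and "AE x in lebesgue_on \<Omega>. weak_hessian \<Omega> v x = H"
proof -
  have eq: "AE x in lebesgue_on \<Omega>. 1/2 * (x \<bullet> (H *v x)) + p \<bullet> x + d = v x"
    using v by eventually_elim simp
  have d1: "is_weak_deriv \<Omega> [i] v (\<lambda>x. (H $ i) \<bullet> x + p $ i)" for i
    by (rule is_weak_deriv_cong_AE[OF \<Omega>(1) is_weak_deriv_quadratic[OF \<Omega>(1) H] eq])
  have d2: "is_weak_deriv \<Omega> [i, j] v (\<lambda>x. H $ i $ j)" for i j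
    by (rule is_weak_deriv_compose[OF d1 is_weak_deriv_affine[OF \<Omega>(1)]])
  have L2: "L2_on \<Omega> v"
    by (rule L2_on_cong_AE[OF \<Omega>(1) L2_on_continuous[OF \<Omega>] eq])
      (intro continuous_intros linear_continuous_on matrix_vector_mul_bounded_linear)
  show "v \<in> sobolev2 2 \<Omega>"
    unfolding sobolev2_def
  proof (intro CollectI conjI allI impI L2)
    fix "is" :: "2 list" assume "length is \<le> 2"
    then consider "is = []" | i where "is = [i]" | i j where "is = [i, j]"
      by (cases "is"; cases "tl is") auto
    then show "\<exists>g. L2_on \<Omega> g \<and> is_weak_deriv \<Omega> is v g"
    proof cases
      case 1
      then show ?thesis using L2 d1 is_weak_deriv_Nil by (auto simp: is_weak_deriv_def)
    next
      case 2
      have "L2_on \<Omega> (\<lambda>x. (H $ i) \<bullet> x + p $ i)"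
        by (rule L2_on_continuous[OF \<Omega>]) (intro continuous_intros)
      then show ?thesis using 2 d1 by blast
    next
      case 3
      then show ?thesis using d2 L2_on_continuous[OF \<Omega> continuous_on_const] by blast
    qed
  qed
  have "AE x in lebesgue_on \<Omega>. \<forall>i. \<forall>j. weak_deriv \<Omega> [i, j] v x = H $ i $ j"
    by (intro AE_all_2 weak_deriv_eq_AE \<Omega> d2)
  then show "AE x in lebesgue_on \<Omega>. weak_hessian \<Omega> v x = H"
    by eventually_elim (simp add: weak_hessian_def vec_eq_iff)
qed

lemma sym_grad_const_imp_rigid:
  fixes S :: "real^2^2"
  assumes \<Omega>: "open \<Omega>" "connected \<Omega>" and u: "\<And>i. (\<lambda>x. u x $ i) \<in> sobolev2 1 \<Omega>"
    and S: "transpose S = S" "AE x in lebesgue_on \<Omega>. sym_grad \<Omega> u x = S"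
  shows "\<exists>r. infinitesimal_rigid_motion r \<and> (AE x in lebesgue_on \<Omega>. u x = S *v x + r x)"
proof -
  have "\<exists>R c. transpose R = - R \<and> (AE x in lebesgue_on \<Omega>. u x = S *v x + (R *v x + c))"
  proof (rule weak_sym_gradient_const[OF \<Omega> _ S(1)])
    show "is_weak_deriv \<Omega> [j] (\<lambda>x. u x $ i) (weak_deriv \<Omega> [j] (\<lambda>x. u x $ i))" for i j
      by (rule weak_deriv_sobolev2[OF \<Omega>(1) u]) simp
    show "AE x in lebesgue_on \<Omega>. (weak_deriv \<Omega> [j] (\<lambda>x. u x $ i) x + weak_deriv \<Omega> [i] (\<lambda>x. u x $ j) x) / 2 = S $ i $ j" for i j
      using S(2) by eventually_elim (auto simp: sym_grad_def weak_grad_def transpose_def)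
  qed
  then show ?thesis unfolding infinitesimal_rigid_motion_def by blast
qed

lemma weak_hessian_const_imp_quadratic:
  fixes H :: "real^2^2"
  assumes \<Omega>: "open \<Omega>" "connected \<Omega>" and v: "v \<in> sobolev2 2 \<Omega>"
    and H: "transpose H = H" "AE x in lebesgue_on \<Omega>. weak_hessian \<Omega> v x = H"
  shows "\<exists>l. affine_function l \<and> (AE x in lebesgue_on \<Omega>. v x = 1/2 * (x \<bullet> (H *v x)) + l x)"
proof -
  have "\<exists>p d. AE x in lebesgue_on \<Omega>. v x = 1/2 * (x \<bullet> (H *v x)) + p \<bullet> x + d"
  proof (rule weak_hessian_const[OF \<Omega> _ _ H(1)])
    show "is_weak_deriv \<Omega> [i] v (weak_deriv \<Omega> [i] v)" for i
      by (rule weak_deriv_sobolev2[OF \<Omega>(1) v]) simp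
    show "is_weak_deriv \<Omega> [i, j] v (weak_deriv \<Omega> [i, j] v)" for i j
      by (rule weak_deriv_sobolev2[OF \<Omega>(1) v]) simp
    show "AE x in lebesgue_on \<Omega>. weak_deriv \<Omega> [i, j] v x = H $ i $ j" for i j
      using H(2) by eventually_elim (auto simp: weak_hessian_def)
  qed
  then obtain p d where "AE x in lebesgue_on \<Omega>. v x = 1/2 * (x \<bullet> (H *v x)) + p \<bullet> x + d" by blast
  then have "AE x in lebesgue_on \<Omega>. v x = 1/2 * (x \<bullet> (H *v x)) + (p \<bullet> x + d)"
    by (simp add: add.assoc)
  then show ?thesis unfolding affine_function_def by (intro exI[of _ "\<lambda>x. p \<bullet> x + d"]) blast
qed

text \<open>The two mixed entries are chosen independently of each other, so they agree only up to a
  null set.\<close>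

lemma weak_hessian_symmetric:
  assumes "open \<Omega>" "v \<in> sobolev2 2 \<Omega>"
  shows "AE x in lebesgue_on \<Omega>. weak_hessian \<Omega> v x \<in> symmetric_matrices"
proof -
  have d: "is_weak_deriv \<Omega> [i, j] v (weak_deriv \<Omega> [i, j] v)" for i j
    by (rule weak_deriv_sobolev2[OF assms]) simp
  from weak_deriv_commute[OF assms(1) d d] show ?thesis
    by eventually_elim (auto simp: symmetric_matrices_def weak_hessian_def transpose_def vec_eq_iff forall_2)
qed

lemma sym_grad_symmetric: "sym_grad \<Omega> u x \<in> symmetric_matrices"
  by (simp add: symmetric_matrices_def sym_grad_def transpose_def vec_eq_iff add.commute)

section \<open>Symmetric matrices as vectors\<close>

lemma vec_of_sym_nth [simp]:
  "vec_of_sym A $ 1 = A $ 1 $ 1" "vec_of_sym A $ 2 = A $ 2 $ 2" "vec_of_sym A $ 3 = A $ 1 $ 2"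
  by (simp_all add: vec_of_sym_def)

lemma sym_of_vec_nth [simp]:
  "sym_of_vec a $ 1 $ 1 = a $ 1" "sym_of_vec a $ 2 $ 2 = a $ 2"
  "sym_of_vec a $ 1 $ 2 = a $ 3" "sym_of_vec a $ 2 $ 1 = a $ 3"
  by (simp_all add: sym_of_vec_def)

lemma vec_of_sym_of_vec [simp]: "vec_of_sym (sym_of_vec a) = a"
  by (simp add: vec_eq_iff forall_3)

lemma symmetric_matrices_2: "A \<in> symmetric_matrices \<longleftrightarrow> A $ 2 $ 1 = (A :: real^2^2) $ 1 $ 2"
  by (auto simp: symmetric_matrices_def transpose_def vec_eq_iff forall_2)

lemma sym_of_vec_of_sym [simp]: "A \<in> symmetric_matrices \<Longrightarrow> sym_of_vec (vec_of_sym A) = A"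
  by (simp add: symmetric_matrices_2 vec_eq_iff forall_2)

lemma sym_of_vec_symmetric [simp]: "sym_of_vec a \<in> symmetric_matrices"
  by (simp add: symmetric_matrices_2)

lemma vec_of_sym_linear [simp]:
  "vec_of_sym (A + B) = vec_of_sym A + vec_of_sym B" "vec_of_sym (A - B) = vec_of_sym A - vec_of_sym B"
  "vec_of_sym (- A) = - vec_of_sym A" "vec_of_sym (r *\<^sub>R A) = r *\<^sub>R vec_of_sym A"
  by (simp_all add: vec_eq_iff forall_3)

lemma sym_of_vec_linear:
  "sym_of_vec (a + b) = sym_of_vec a + sym_of_vec b" "sym_of_vec (r *\<^sub>R a) = r *\<^sub>R sym_of_vec a"
  by (simp_all add: vec_eq_iff forall_2)

lemma sym_of_vec_eq_0 [simp]: "sym_of_vec a = 0 \<longleftrightarrow> a = 0"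
  by (auto simp: vec_eq_iff forall_2 forall_3)

lemma symmetric_matrices_closed:
  fixes A B :: "real^2^2"
  shows "A \<in> symmetric_matrices \<Longrightarrow> B \<in> symmetric_matrices \<Longrightarrow> A + B \<in> symmetric_matrices"
    and "A \<in> symmetric_matrices \<Longrightarrow> r *\<^sub>R A \<in> symmetric_matrices"
    and "A \<in> symmetric_matrices \<Longrightarrow> - A \<in> symmetric_matrices"
  by (simp_all add: symmetric_matrices_2)

lemma matrix_injective_imp_surj:
  fixes N :: "real^'n^'n"
  assumes "\<And>a. N *v a = 0 \<Longrightarrow> a = 0"
  obtains a where "N *v a = x"
proof -
  have "inj ((*v) N)"
    using assms by (subst linear_injective_0) auto
  then have "surj ((*v) N)" by (rule linear_injective_imp_surjective[OF matrix_vector_mul_linear]) simp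
  then show ?thesis using that by (metis surjE)
qed

text \<open>\<open>inv_into\<close> inverts only on the image, so surjectivity onto symmetric
  matrices is needed; for a square matrix it follows from the trivial kernel.\<close>

lemma sym_map_inv_sym:
  assumes "\<And>a. N *v a = 0 \<Longrightarrow> a = 0" and X: "X \<in> symmetric_matrices"
  shows "inv_sym (sym_map N) X \<in> symmetric_matrices"
    and "N *v vec_of_sym (inv_sym (sym_map N) X) = vec_of_sym X"
proof -
  obtain a where a: "N *v a = vec_of_sym X" using matrix_injective_imp_surj[OF assms(1)] by metis
  have "sym_map N (sym_of_vec a) = X" using a X by (simp add: sym_map_def)
  then have *: "X \<in> sym_map N ` symmetric_matrices" by (metis imageI sym_of_vec_symmetric)
  show "inv_sym (sym_map N) X \<in> symmetric_matrices" using * by (rule inv_into_into)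
  have "sym_map N (inv_sym (sym_map N) X) = X" using * by (rule f_inv_into_f)
  then show "N *v vec_of_sym (inv_sym (sym_map N) X) = vec_of_sym X"
    unfolding sym_map_def by (metis vec_of_sym_of_vec)
qed

lemma symmetric_matrix_inner:
  assumes "M \<in> symmetric_matrices"
  shows "x \<bullet> (M *v y) = y \<bullet> (M *v x)"
proof -
  have "x \<bullet> (M *v y) = (x v* M) \<bullet> y" by (rule dot_lmul_matrix[symmetric])
  also have "x v* M = transpose M *v x" by (rule transpose_matrix_vector[symmetric])
  also have "transpose M = M" using assms by (simp add: symmetric_matrices_def)
  finally show ?thesis by (simp add: inner_commute)
qed

text \<open>Polarisation: a symmetric bilinear form is recovered from its values on the
  diagonal.\<close>

lemma symmetric_matrix_eqI:
  fixes M N :: "real^'n^'n"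
  assumes M: "M \<in> symmetric_matrices" and N: "N \<in> symmetric_matrices"
    and eq: "\<And>a. a \<bullet> (M *v a) = a \<bullet> (N *v a)"
  shows "M = N"
proof -
  have pol: "2 * (x \<bullet> (L *v y)) = (x + y) \<bullet> (L *v (x + y)) - x \<bullet> (L *v x) - y \<bullet> (L *v y)"
    if "L \<in> symmetric_matrices" for L :: "real^'n^'n" and x y
    using symmetric_matrix_inner[OF that, of y x]
    by (simp add: matrix_vector_right_distrib inner_add_left inner_add_right)
  have "x \<bullet> (M *v y) = x \<bullet> (N *v y)" for x y
    using pol[OF M, of x y] pol[OF N, of x y] eq by simp
  then have "M *v y = N *v y" for y using vector_eq_ldot[of "M *v y" "N *v y"] by blast
  then show ?thesis by (simp add: matrix_eq)
qed

text \<open>The polarisation identity on the basis vectors. Being an explicit expression in finitely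
  many values of \<open>q\<close>, it transfers measurability and bounds in \<open>t\<close>, which
  the definite description in \<open>M_of\<close> cannot supply directly.\<close>

definition form_matrix :: "(real^2^2 \<Rightarrow> real) \<Rightarrow> real^3^3" where
  "form_matrix q = (\<chi> i j. (q (sym_of_vec (axis i 1 + axis j 1)) - q (sym_of_vec (axis i 1)) - q (sym_of_vec (axis j 1))) / 2)"

lemma form_matrix:
  assumes "quadratic_form q"
  shows "form_matrix q \<in> symmetric_matrices"
    and "A \<in> symmetric_matrices \<Longrightarrow> q A = vec_of_sym A \<bullet> (form_matrix q *v vec_of_sym A)"
proof -
  obtain \<beta> where \<beta>: "bilinear \<beta>" "\<And>x y. \<beta> x y = \<beta> y x" "\<And>x. q x = \<beta> x x"
    using assms by (auto simp: quadratic_form_def)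
  define s where "s i = sym_of_vec (axis i 1)" for i
  have m: "form_matrix q $ i $ j = \<beta> (s i) (s j)" for i j
    unfolding form_matrix_def s_def \<beta>(3) sym_of_vec_linear
    using \<beta>(2)[of "sym_of_vec (axis j 1)" "sym_of_vec (axis i 1)"]
    by (simp add: bilinear_ladd[OF \<beta>(1)] bilinear_radd[OF \<beta>(1)])
  show "form_matrix q \<in> symmetric_matrices"
    using \<beta>(2) by (simp add: symmetric_matrices_def transpose_def vec_eq_iff m)
  assume A: "A \<in> symmetric_matrices"
  define a where "a = vec_of_sym A"
  have "A = sym_of_vec (a $ 1 *\<^sub>R axis 1 1 + a $ 2 *\<^sub>R axis 2 1 + a $ 3 *\<^sub>R axis 3 1)"
    using A by (simp add: a_def vec_eq_iff forall_2 axis_def symmetric_matrices_2)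
  then have A': "A = a $ 1 *\<^sub>R s 1 + a $ 2 *\<^sub>R s 2 + a $ 3 *\<^sub>R s 3"
    by (simp only: sym_of_vec_linear s_def)
  have "q A = \<beta> A A" by (rule \<beta>(3))
  also have "\<dots> = a \<bullet> (form_matrix q *v a)"
    by (subst (1 2) A')
      (simp add: bilinear_ladd[OF \<beta>(1)] bilinear_radd[OF \<beta>(1)] bilinear_lmul[OF \<beta>(1)] bilinear_rmul[OF \<beta>(1)]
        inner_vec_def matrix_vector_mult_def sum_3 m algebra_simps)
  finally show "q A = vec_of_sym A \<bullet> (form_matrix q *v vec_of_sym A)" by (simp add: a_def)
qed

lemma inner_matrix_vector_3:
  fixes x y :: "real^3"
  shows "x \<bullet> (M *v y) = (\<Sum>i\<in>UNIV. \<Sum>j\<in>UNIV. x $ i * M $ i $ j * y $ j)"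
  by (simp add: inner_vec_def matrix_vector_mult_def sum_distrib_left mult.assoc)

lemma norm_axis: "norm (axis i x) = norm (x :: 'b::real_normed_vector)"
proof -
  have "(norm (axis i x $ j))\<^sup>2 = (if j = i then (norm x)\<^sup>2 else 0)" for j
    by (simp add: axis_def)
  then show ?thesis by (simp add: norm_vec_def L2_set_def)
qed

section \<open>The averaged energy density\<close>

locale plate =
  fixes Q :: "real \<Rightarrow> real^2^2 \<Rightarrow> real" and B :: "real \<Rightarrow> real^2^2" and c C :: real
  assumes Q_meas: "\<And>G. (\<lambda>t. Q t G) \<in> borel_measurable (lebesgue_on thickness)"
    and Q_form: "AE t in lebesgue_on thickness. quadratic_form (Q t)"
    and c_pos: "0 < c"
    and Q_bounds: "AE t in lebesgue_on thickness.
           (\<forall>G. Q t G \<le> C * (norm G)\<^sup>2) \<and> (\<forall>G\<in>symmetric_matrices. c * (norm G)\<^sup>2 \<le> Q t G)"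
    and B_meas: "B \<in> borel_measurable (lebesgue_on thickness)"
    and B_sym: "AE t in lebesgue_on thickness. B t \<in> symmetric_matrices"
    and B_bounded: "\<exists>K. AE t in lebesgue_on thickness. norm (B t) \<le> K"
begin

abbreviation T :: "real measure" where "T \<equiv> lebesgue_on thickness"

lemma thickness_lebesgue [simp]: "thickness \<in> sets lebesgue"
  by (simp add: thickness_def)

sublocale T: finite_measure T
proof
  have "thickness \<in> lmeasurable" unfolding thickness_def by (rule lmeasurable_interval)
  then show "emeasure T (space T) \<noteq> \<infinity>"
    by (simp add: emeasure_restrict_space fmeasurable_def less_top)
qed

section \<open>The coefficient matrix as a bounded measurable function of the thickness
  variable\<close>

abbreviation M :: "real \<Rightarrow> real^3^3" where "M \<equiv> M_of Q"

text \<open>The description in \<open>M_of\<close> is well defined: positivity comes from the lower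
  bound with \<open>c\<close>, uniqueness from polarisation.\<close>

lemma M_eq: "AE t in T. M t = form_matrix (Q t)"
  using Q_form Q_bounds
proof eventually_elim
  case (elim t)
  note f = form_matrix[OF elim(1)]
  have pos: "0 < a \<bullet> (form_matrix (Q t) *v a)" if "a \<noteq> 0" for a
  proof -
    have "0 < c * (norm (sym_of_vec a))\<^sup>2" using that c_pos by simp
    also have "\<dots> \<le> Q t (sym_of_vec a)" using elim(2) by simp
    also have "\<dots> = a \<bullet> (form_matrix (Q t) *v a)" using f(2)[of "sym_of_vec a"] by simp
    finally show ?thesis .
  qed
  show ?case
    unfolding M_of_def
  proof (rule the_equality)
    fix N assume N: "N \<in> symmetric_matrices \<and> (\<forall>a. a \<noteq> 0 \<longrightarrow> 0 < a \<bullet> (N *v a)) \<and>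
      (\<forall>A\<in>symmetric_matrices. Q t A = vec_of_sym A \<bullet> (N *v vec_of_sym A))"
    have "a \<bullet> (N *v a) = a \<bullet> (form_matrix (Q t) *v a)" for a
    proof -
      have "Q t (sym_of_vec a) = a \<bullet> (N *v a)"
        using N[THEN conjunct2, THEN conjunct2, rule_format, OF sym_of_vec_symmetric, of a] by simp
      then show ?thesis using f(2)[OF sym_of_vec_symmetric, of a] by simp
    qed
    then show "N = form_matrix (Q t)" using N f(1) by (intro symmetric_matrix_eqI) auto
  qed (use f pos in blast)
qed

lemma M_sym: "AE t in T. M t \<in> symmetric_matrices"
  using M_eq Q_form by eventually_elim (use form_matrix(1) in auto)

lemma Q_eq: "AE t in T. \<forall>A\<in>symmetric_matrices. Q t A = vec_of_sym A \<bullet> (M t *v vec_of_sym A)"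
  using M_eq Q_form by eventually_elim (use form_matrix(2) in auto)

lemma M_meas [measurable]: "(\<lambda>t. M t $ i $ j) \<in> borel_measurable T"
proof (rule borel_measurable_lebesgue_on_AE)
  show "(\<lambda>t. form_matrix (Q t) $ i $ j) \<in> borel_measurable T"
    unfolding form_matrix_def using Q_meas by simp
  show "AE t in T. form_matrix (Q t) $ i $ j = M t $ i $ j" using M_eq by eventually_elim simp
qed simp

lemma M_bounded: "\<exists>K. AE t in T. \<forall>i j. \<bar>M t $ i $ j\<bar> \<le> K"
proof -
  \<comment> \<open>Since \<open>Q t\<close> is nonnegative on symmetric matrices, a polarised entry
    is at most half the sum of its three values, each controlled by the upper bound with
    \<open>C\<close>. Summing over all entries gives one constant.\<close>
  define k where "k i j = (C * (norm (sym_of_vec (axis i 1 + axis j 1)))\<^sup>2 + C * (norm (sym_of_vec (axis i 1)))\<^sup>2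
    + C * (norm (sym_of_vec (axis j 1)))\<^sup>2) / 2" for i j :: 3
  have "AE t in T. \<forall>i j. \<bar>M t $ i $ j\<bar> \<le> (\<Sum>i\<in>UNIV. \<Sum>j\<in>UNIV. k i j)"
    using M_eq Q_bounds
  proof eventually_elim
    case (elim t)
    have q: "0 \<le> Q t (sym_of_vec a)" "Q t (sym_of_vec a) \<le> C * (norm (sym_of_vec a))\<^sup>2" for a
    proof -
      have "0 \<le> c * (norm (sym_of_vec a))\<^sup>2" using c_pos by simp
      also have "\<dots> \<le> Q t (sym_of_vec a)" using elim(2) by simp
      finally show "0 \<le> Q t (sym_of_vec a)" .
    qed (use elim(2) in simp)
    show ?case
    proof (intro allI)
      fix i j
      have "\<bar>M t $ i $ j\<bar> \<le> k i j"
        using q[of "axis i 1 + axis j 1"] q[of "axis i 1"] q[of "axis j 1"]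
        by (simp add: elim(1) form_matrix_def k_def)
      have k: "0 \<le> k i j" for i j
      proof -
        have "0 \<le> C * (norm (sym_of_vec a))\<^sup>2" for a using q[of a] by linarith
        then show ?thesis unfolding k_def by (intro divide_nonneg_pos add_nonneg_nonneg) auto
      qed
      have "k i j \<le> (\<Sum>j\<in>UNIV. k i j)" by (rule member_le_sum) (use k in auto)
      also have "\<dots> \<le> (\<Sum>i\<in>UNIV. \<Sum>j\<in>UNIV. k i j)"
        by (rule member_le_sum[of i UNIV "\<lambda>i. \<Sum>j\<in>UNIV. k i j"]) (use k in \<open>auto intro: sum_nonneg\<close>)
      finally show "\<bar>M t $ i $ j\<bar> \<le> (\<Sum>i\<in>UNIV. \<Sum>j\<in>UNIV. k i j)" using \<open>\<bar>M t $ i $ j\<bar> \<le> k i j\<close> by simp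
    qed
  qed
  then show ?thesis by blast
qed

text \<open>Essentially bounded functions on the thickness interval. They are closed under all
  operations that build the integrands below and are integrable because the interval has finite
  measure.\<close>

definition bounded_meas :: "(real \<Rightarrow> 'a::euclidean_space) \<Rightarrow> bool" where
  "bounded_meas y \<longleftrightarrow> y \<in> borel_measurable T \<and> (\<exists>K. AE t in T. norm (y t) \<le> K)"

lemma bounded_meas_integrable: "bounded_meas y \<Longrightarrow> integrable T y"
  unfolding bounded_meas_def using T.integrable_const_bound by blast

lemma bounded_meas_const: "bounded_meas (\<lambda>t. x)"
  unfolding bounded_meas_def by auto

lemma bounded_meas_ident: "bounded_meas (\<lambda>t. t)"
proof -
  have "AE t in T. norm t \<le> 1/2" by (rule AE_I2) (auto simp: thickness_def)
  moreover have "(\<lambda>t. t) \<in> borel_measurable T"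
    by (rule continuous_imp_measurable_on_sets_lebesgue) (auto intro: continuous_intros)
  ultimately show ?thesis unfolding bounded_meas_def by blast
qed

lemma bounded_meas_add:
  assumes "bounded_meas y" "bounded_meas z" shows "bounded_meas (\<lambda>t. y t + z t)"
proof -
  obtain K L where "AE t in T. norm (y t) \<le> K" "AE t in T. norm (z t) \<le> L" using assms by (auto simp: bounded_meas_def)
  then have "AE t in T. norm (y t + z t) \<le> K + L" by eventually_elim (rule norm_triangle_mono)
  then show ?thesis using assms unfolding bounded_meas_def by (blast intro: borel_measurable_add)
qed

lemma bounded_meas_scaleR:
  fixes y :: "real \<Rightarrow> real" and z :: "real \<Rightarrow> 'a::euclidean_space"
  assumes "bounded_meas y" "bounded_meas z" shows "bounded_meas (\<lambda>t. y t *\<^sub>R z t)"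
proof -
  obtain K L where "AE t in T. norm (y t) \<le> K" "AE t in T. norm (z t) \<le> L" using assms by (auto simp: bounded_meas_def)
  then have "AE t in T. norm (y t *\<^sub>R z t) \<le> K * L"
  proof eventually_elim
    case (elim t)
    have "0 \<le> K" using elim(1) norm_ge_zero[of "y t"] by linarith
    then show ?case unfolding norm_scaleR using elim by (intro mult_mono) auto
  qed
  then show ?thesis using assms unfolding bounded_meas_def by (blast intro: borel_measurable_scaleR)
qed

lemma bounded_meas_mult: "bounded_meas y \<Longrightarrow> bounded_meas z \<Longrightarrow> bounded_meas (\<lambda>t. y t * z t :: real)"
  using bounded_meas_scaleR[of y z] by simp

lemma bounded_meas_sum: "finite I \<Longrightarrow> (\<And>i. i \<in> I \<Longrightarrow> bounded_meas (y i)) \<Longrightarrow> bounded_meas (\<lambda>t. \<Sum>i\<in>I. y i t)"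
  by (induction I rule: finite_induct) (auto intro: bounded_meas_const bounded_meas_add)

lemma bounded_meas_power: "bounded_meas y \<Longrightarrow> bounded_meas (\<lambda>t. y t ^ k :: real)"
  by (induction k) (auto intro: bounded_meas_const bounded_meas_mult)

lemma bounded_meas_nth:
  fixes y :: "real \<Rightarrow> 'a::euclidean_space^'n"
  assumes "bounded_meas y" shows "bounded_meas (\<lambda>t. y t $ i)"
proof -
  obtain K where "AE t in T. norm (y t) \<le> K" using assms by (auto simp: bounded_meas_def)
  then have "AE t in T. norm (y t $ i) \<le> K"
  proof eventually_elim
    case (elim t)
    then show ?case using Finite_Cartesian_Product.norm_nth_le[of "y t" i] by linarith
  qed
  moreover have "(\<lambda>t. y t $ i) \<in> borel_measurable T"
  proof (rule measurable_compose[of y T borel])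
    show "y \<in> borel_measurable T" using assms by (simp add: bounded_meas_def)
    show "(\<lambda>x. x $ i) \<in> borel_measurable borel"
      by (intro borel_measurable_continuous_onI continuous_intros)
  qed
  ultimately show ?thesis unfolding bounded_meas_def by blast
qed

lemma bounded_meas_M: "bounded_meas (\<lambda>t. M t $ i $ j)"
proof -
  obtain K where "AE t in T. \<forall>i j. \<bar>M t $ i $ j\<bar> \<le> K" using M_bounded by blast
  then have "AE t in T. norm (M t $ i $ j) \<le> K" by eventually_elim simp
  then show ?thesis unfolding bounded_meas_def using M_meas by blast
qed

lemma bounded_meas_inner_M: "bounded_meas y \<Longrightarrow> bounded_meas z \<Longrightarrow> bounded_meas (\<lambda>t. y t \<bullet> (M t *v z t))"
  unfolding inner_matrix_vector_3 by (intro bounded_meas_sum bounded_meas_mult bounded_meas_nth bounded_meas_M) auto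

lemma bounded_meas_vec:
  fixes y :: "real \<Rightarrow> 'a::euclidean_space^'n"
  assumes "\<And>i. bounded_meas (\<lambda>t. y t $ i)" shows "bounded_meas y"
proof -
  have "bounded_meas (\<lambda>t. \<Sum>i\<in>UNIV. axis i (y t $ i))"
  proof (rule bounded_meas_sum)
    fix i
    obtain K where K: "AE t in T. norm (y t $ i) \<le> K" using assms by (auto simp: bounded_meas_def)
    have "bounded_linear (\<lambda>x::'a. axis i x :: 'a^'n)"
    proof (rule bounded_linear_intro[of _ 1])
      show "norm (axis i x :: 'a^'n) \<le> norm x * 1" for x :: 'a by (simp add: norm_axis)
    qed (simp_all add: vec_eq_iff axis_def)
    then have "(\<lambda>x::'a. axis i x :: 'a^'n) \<in> borel_measurable borel"
      by (intro borel_measurable_continuous_onI linear_continuous_on)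
    then have "(\<lambda>t. axis i (y t $ i)) \<in> borel_measurable T"
      by (rule measurable_compose[rotated]) (use assms in \<open>simp add: bounded_meas_def\<close>)
    then show "bounded_meas (\<lambda>t. axis i (y t $ i))"
      unfolding bounded_meas_def using K by (intro conjI exI[of _ K]) (simp_all add: norm_axis)
  qed simp
  moreover have "(\<Sum>i\<in>UNIV. axis i (x $ i)) = x" for x :: "'a^'n"
    by (simp add: vec_eq_iff axis_def)
  ultimately show ?thesis by simp
qed

lemma bounded_meas_B: "bounded_meas (\<lambda>t. vec_of_sym (B t))"
proof -
  have "bounded_meas B" using B_meas B_bounded by (simp add: bounded_meas_def)
  then have "bounded_meas (\<lambda>t. B t $ i $ j)" for i j by (intro bounded_meas_nth)
  then have "bounded_meas (\<lambda>t. vec_of_sym (B t) $ i)" for i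
    using exhaust_3[of i] by auto
  then show ?thesis by (rule bounded_meas_vec)
qed

section \<open>Moments and the block quadratic form\<close>

definition b_mom :: "nat \<Rightarrow> real^3" where
  "b_mom k = vec_of_sym (B_mom Q B k)"

text \<open>The scalar \<open>e \<bullet> (N *v f)\<close> is a bounded linear functional of the
  matrix \<open>N\<close> and therefore passes through the integral.\<close>

lemma inner_M_mom:
  "has_bochner_integral T (\<lambda>t. t ^ k * (e \<bullet> (M t *v f))) (e \<bullet> (M_mom Q k *v f))"
proof -
  have "bounded_meas (\<lambda>t. t ^ k *\<^sub>R M t)"
    by (intro bounded_meas_scaleR bounded_meas_power bounded_meas_ident bounded_meas_vec bounded_meas_M)
  then have "has_bochner_integral T (\<lambda>t. t ^ k *\<^sub>R M t) (M_mom Q k)"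
    unfolding M_mom_def by (intro has_bochner_integral_integrable bounded_meas_integrable)
  moreover have "bounded_linear (\<lambda>N::real^3^3. e \<bullet> (N *v f))"
  proof -
    have "linear (\<lambda>N::real^3^3. e \<bullet> (N *v f))"
      by (rule linearI) (simp_all add: matrix_vector_mult_add_rdistrib inner_add_right scaleR_matrix_vector_assoc[symmetric])
    then show ?thesis by (simp add: linear_conv_bounded_linear)
  qed
  ultimately have "has_bochner_integral T (\<lambda>t. e \<bullet> ((t ^ k *\<^sub>R M t) *v f)) (e \<bullet> (M_mom Q k *v f))"
    by (rule has_bochner_integral_bounded_linear[rotated])
  then show ?thesis by (simp add: scaleR_matrix_vector_assoc[symmetric])
qed

lemma inner_b_mom:
  "has_bochner_integral T (\<lambda>t. t ^ k * (e \<bullet> (M t *v vec_of_sym (B t)))) (e \<bullet> b_mom k)"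
proof -
  have "bounded_meas (\<lambda>t. (M t *v vec_of_sym (B t)) $ i)" for i
    unfolding matrix_vector_mult_def by (simp, intro bounded_meas_sum bounded_meas_mult bounded_meas_nth[OF bounded_meas_B] bounded_meas_M) auto
  then have "bounded_meas (\<lambda>t. t ^ k *\<^sub>R (M t *v vec_of_sym (B t)))"
    by (intro bounded_meas_scaleR bounded_meas_power bounded_meas_ident bounded_meas_vec)
  then have "has_bochner_integral T (\<lambda>t. t ^ k *\<^sub>R (M t *v vec_of_sym (B t))) (b_mom k)"
    unfolding b_mom_def B_mom_def vec_of_sym_of_vec by (intro has_bochner_integral_integrable bounded_meas_integrable)
  then have "has_bochner_integral T (\<lambda>t. e \<bullet> (t ^ k *\<^sub>R (M t *v vec_of_sym (B t)))) (e \<bullet> b_mom k)"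
    by (intro has_bochner_integral_inner_right)
  then show ?thesis by simp
qed

text \<open>The quadratic form of the symmetric block matrix with rows (M_0, M_1) and (M_1,
  M_2).\<close>

definition W :: "real^3 \<Rightarrow> real^3 \<Rightarrow> real" where
  "W d f = d \<bullet> (M_mom Q 0 *v d) + 2 * (d \<bullet> (M_mom Q 1 *v f)) + f \<bullet> (M_mom Q 2 *v f)"

lemma W_integral:
  "has_bochner_integral T (\<lambda>t. (d + t *\<^sub>R f) \<bullet> (M t *v (d + t *\<^sub>R f))) (W d f)"
proof -
  have "has_bochner_integral T (\<lambda>t. t ^ 0 * (d \<bullet> (M t *v d)) + 2 * (t ^ 1 * (d \<bullet> (M t *v f))) + t ^ 2 * (f \<bullet> (M t *v f))) (W d f)"
    unfolding W_def
    by (intro has_bochner_integral_add has_bochner_integral_mult_right inner_M_mom)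
  then show ?thesis
  proof (rule has_bochner_integral_cong_AE[THEN iffD1, rotated 3])
    show "AE t in T. t ^ 0 * (d \<bullet> (M t *v d)) + 2 * (t ^ 1 * (d \<bullet> (M t *v f))) + t ^ 2 * (f \<bullet> (M t *v f))
        = (d + t *\<^sub>R f) \<bullet> (M t *v (d + t *\<^sub>R f))"
      using M_sym
    proof eventually_elim
      case (elim t)
      show ?case using symmetric_matrix_inner[OF elim, of f d]
        by (simp add: matrix_vector_right_distrib matrix_vector_mult_scaleR inner_add_left inner_add_right
            power2_eq_square algebra_simps)
    qed
    have "bounded_meas (\<lambda>t. t ^ 0 * (d \<bullet> (M t *v d)) + 2 * (t ^ 1 * (d \<bullet> (M t *v f))) + t ^ 2 * (f \<bullet> (M t *v f)))"
      by (intro bounded_meas_add bounded_meas_mult bounded_meas_const bounded_meas_power bounded_meas_ident bounded_meas_inner_M)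
    then show "(\<lambda>t. t ^ 0 * (d \<bullet> (M t *v d)) + 2 * (t ^ 1 * (d \<bullet> (M t *v f))) + t ^ 2 * (f \<bullet> (M t *v f))) \<in> borel_measurable T"
      by (simp only: bounded_meas_def)
    have "bounded_meas (\<lambda>t. (d + t *\<^sub>R f) \<bullet> (M t *v (d + t *\<^sub>R f)))"
      by (intro bounded_meas_inner_M bounded_meas_add bounded_meas_scaleR bounded_meas_const bounded_meas_ident)
    then show "(\<lambda>t. (d + t *\<^sub>R f) \<bullet> (M t *v (d + t *\<^sub>R f))) \<in> borel_measurable T"
      by (simp only: bounded_meas_def)
  qed
qed

text \<open>The norm is that of the matrix: the identification with vectors is not an isometry,
  since the Frobenius norm counts the off-diagonal entry twice.\<close>

lemma M_form_nonneg: "AE t in T. \<forall>a. c * (norm (sym_of_vec a))\<^sup>2 \<le> a \<bullet> (M t *v a)"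
  using Q_bounds Q_eq
proof eventually_elim
  case (elim t)
  show ?case
  proof
    fix a
    have "c * (norm (sym_of_vec a))\<^sup>2 \<le> Q t (sym_of_vec a)" using elim(1) by simp
    also have "Q t (sym_of_vec a) = a \<bullet> (M t *v a)"
      using elim(2)[rule_format, OF sym_of_vec_symmetric, of a] by simp
    finally show "c * (norm (sym_of_vec a))\<^sup>2 \<le> a \<bullet> (M t *v a)" .
  qed
qed

lemma M_form_nonneg': "AE t in T. 0 \<le> (d + t *\<^sub>R f) \<bullet> (M t *v (d + t *\<^sub>R f))"
  using M_form_nonneg
proof eventually_elim
  case (elim t)
  have "0 \<le> c * (norm (sym_of_vec (d + t *\<^sub>R f)))\<^sup>2" using c_pos by simp
  with elim show ?case using order_trans by blast
qed

lemma W_nonneg: "0 \<le> W d f"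
  using integral_nonneg_AE[OF M_form_nonneg', of d f] has_bochner_integral_integral_eq[OF W_integral, of d f] by simp

text \<open>Coercivity forces \<open>d + t *\<^sub>R f = 0\<close> for almost every
  \<open>t\<close>, and an affine function of \<open>t\<close> with two distinct zeros vanishes
  identically.\<close>

lemma W_eq_0:
  assumes "W d f = 0"
  shows "d = 0" "f = 0"
proof -
  have i: "integrable T (\<lambda>t. (d + t *\<^sub>R f) \<bullet> (M t *v (d + t *\<^sub>R f)))"
    using W_integral by (rule integrable.intros)
  have "(\<integral>t. (d + t *\<^sub>R f) \<bullet> (M t *v (d + t *\<^sub>R f)) \<partial>T) = 0"
    using has_bochner_integral_integral_eq[OF W_integral] assms by simp
  then have "AE t in T. (d + t *\<^sub>R f) \<bullet> (M t *v (d + t *\<^sub>R f)) = 0"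
    using integral_nonneg_eq_0_iff_AE[OF i M_form_nonneg'] by blast
  then have "AE t in T. d + t *\<^sub>R f = 0"
    using M_form_nonneg
  proof eventually_elim
    case (elim t)
    then have "c * (norm (sym_of_vec (d + t *\<^sub>R f)))\<^sup>2 \<le> 0" by metis
    then have "norm (sym_of_vec (d + t *\<^sub>R f)) = 0"
      using c_pos by (simp add: mult_le_0_iff)
    then show ?case by simp
  qed
  then have "AE t in lebesgue. t \<in> thickness \<longrightarrow> d + t *\<^sub>R f = 0"
    by (simp add: AE_restrict_space_iff)
  then have N: "{t. \<not> (t \<in> thickness \<longrightarrow> d + t *\<^sub>R f = 0)} \<in> null_sets lebesgue" (is "?N \<in> _")
    by (simp add: completion.AE_iff_null_sets)
  \<comment> \<open>No nonempty open interval lies in a null set, so there is a zero in the negative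
    half and another in the positive half of the thickness interval.\<close>
  have "\<exists>t\<in>{r<..<s}. d + t *\<^sub>R f = 0" if "r < s" "{r<..<s} \<subseteq> thickness" for r s
  proof (rule ccontr)
    assume "\<not> ?thesis"
    then have "{r<..<s} \<subseteq> ?N" using that by blast
    then have "negligible {r<..<s}" using N negligible_subset negligible_iff_null_sets by blast
    moreover have "open {r<..<s}" "{r<..<s} \<noteq> {}" using that by auto
    ultimately show False using open_not_negligible by blast
  qed
  from this[of "-1/2" 0] this[of 0 "1/2"] obtain r s where
    rs: "r < 0" "0 < s" "d + r *\<^sub>R f = 0" "d + s *\<^sub>R f = 0"
    unfolding thickness_def by fastforce
  have "(s - r) *\<^sub>R f = (d + s *\<^sub>R f) - (d + r *\<^sub>R f)" by (simp add: scaleR_diff_left)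
  then have "(s - r) *\<^sub>R f = 0" using rs by simp
  with rs(1,2) show "f = 0" by simp
  with rs show "d = 0" by simp
qed

lemma M_mom_sym: "e \<bullet> (M_mom Q k *v f) = f \<bullet> (M_mom Q k *v e)"
proof -
  have "(\<integral>t. t ^ k * (e \<bullet> (M t *v f)) \<partial>T) = (\<integral>t. t ^ k * (f \<bullet> (M t *v e)) \<partial>T)"
  proof (rule integral_cong_AE_lebesgue_on[OF thickness_lebesgue])
    show "AE t in T. t ^ k * (e \<bullet> (M t *v f)) = t ^ k * (f \<bullet> (M t *v e))"
      using M_sym by eventually_elim (use symmetric_matrix_inner in metis)
  qed
  then show ?thesis using inner_M_mom[THEN has_bochner_integral_integral_eq] by simp
qed

lemma M0_inj: "M_mom Q 0 *v a = 0 \<Longrightarrow> a = 0"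
  using W_eq_0(1)[of a 0] by (simp add: W_def)

lemma matrix_inv_M0:
  shows "M_mom Q 0 *v (matrix_inv (M_mom Q 0) *v x) = x" "matrix_inv (M_mom Q 0) *v (M_mom Q 0 *v x) = x"
proof -
  have "invertible (M_mom Q 0)"
    unfolding invertible_left_inverse matrix_left_invertible_ker using M0_inj by blast
  then show "M_mom Q 0 *v (matrix_inv (M_mom Q 0) *v x) = x" "matrix_inv (M_mom Q 0) *v (M_mom Q 0 *v x) = x"
    using someI_ex[of "\<lambda>N. M_mom Q 0 ** N = mat 1 \<and> N ** M_mom Q 0 = mat 1"]
    by (simp_all add: matrix_vector_mul_assoc matrix_inv_def invertible_def)
qed

lemma M_star_mult: "M_star Q *v x = M_mom Q 2 *v x - M_mom Q 1 *v (matrix_inv (M_mom Q 0) *v (M_mom Q 1 *v x))"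
  by (simp add: M_star_def matrix_vector_mult_diff_rdistrib matrix_vector_mul_assoc matrix_mul_assoc)

text \<open>\<open>M_star Q\<close> is the Schur complement of \<open>M_mom Q 0\<close> in the block
  matrix of \<open>W\<close>. A kernel vector \<open>f\<close> extends by d = - M_0^{-1} M_1 f to a
  kernel vector of the block matrix, where \<open>W\<close> vanishes.\<close>

lemma M_star_inj:
  assumes "M_star Q *v f = 0" shows "f = 0"
proof -
  define d where "d = - (matrix_inv (M_mom Q 0) *v (M_mom Q 1 *v f))"
  have M0d: "M_mom Q 0 *v d = - (M_mom Q 1 *v f)"
    unfolding d_def by (simp add: matrix_inv_M0 vec.neg)
  have M1d: "M_mom Q 1 *v d + M_mom Q 2 *v f = 0"
    using assms unfolding M_star_mult d_def by (simp add: vec.neg)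
  have "W d f = d \<bullet> (M_mom Q 0 *v d + M_mom Q 1 *v f) + f \<bullet> (M_mom Q 1 *v d + M_mom Q 2 *v f)"
    unfolding W_def using M_mom_sym[of d 1 f] by (simp add: inner_add_right)
  also have "\<dots> = 0" unfolding M0d M1d by simp
  finally show ?thesis by (rule W_eq_0)
qed

section \<open>The critical point and the completion of the square\<close>

definition E_opt :: "real^2^2" where
  "E_opt = - (inv_sym (L_map Q 0) (L_map Q 1 (F_zero Q B)) + E_zero Q B)"

lemma B_mom_sym: "B_mom Q B k \<in> symmetric_matrices"
  by (simp add: B_mom_def)

lemma sym_map_sym: "sym_map N A \<in> symmetric_matrices"
  by (simp add: sym_map_def)

lemma vec_sym_map: "vec_of_sym (sym_map N A) = N *v vec_of_sym A"
  by (simp add: sym_map_def)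

lemma E_zero: "E_zero Q B \<in> symmetric_matrices" "M_mom Q 0 *v vec_of_sym (E_zero Q B) = b_mom 0"
  unfolding E_zero_def b_mom_def using sym_map_inv_sym[OF M0_inj B_mom_sym] by blast+

lemma F_zero: "F_zero Q B \<in> symmetric_matrices"
  "M_star Q *v vec_of_sym (F_zero Q B) = M_mom Q 1 *v vec_of_sym (E_zero Q B) - b_mom 1"
proof -
  have s: "L_map Q 1 (inv_sym (L_map Q 0) (B_mom Q B 0)) - B_mom Q B 1 \<in> symmetric_matrices"
    using sym_map_sym[of "M_mom Q 1"] B_mom_sym by (simp add: symmetric_matrices_2)
  show "F_zero Q B \<in> symmetric_matrices"
    unfolding F_zero_def by (rule sym_map_inv_sym(1)[OF M_star_inj s])
  have "M_star Q *v vec_of_sym (F_zero Q B) = vec_of_sym (L_map Q 1 (E_zero Q B) - B_mom Q B 1)"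
    unfolding F_zero_def E_zero_def by (rule sym_map_inv_sym(2)[OF M_star_inj s])
  then show "M_star Q *v vec_of_sym (F_zero Q B) = M_mom Q 1 *v vec_of_sym (E_zero Q B) - b_mom 1"
    by (simp add: vec_sym_map b_mom_def)
qed

lemma E_opt_sym: "E_opt \<in> symmetric_matrices"
  unfolding E_opt_def
  by (intro symmetric_matrices_closed E_zero(1) sym_map_inv_sym(1)[OF M0_inj sym_map_sym])

text \<open>The Euler equations of the averaged density, solved by block elimination: the first row
  defines the strain in terms of \<open>F_zero Q B\<close>, and inserting it into the second leaves
  the equation defining \<open>F_zero Q B\<close>. The minus sign in \<open>E_opt\<close> is forced
  by the first row.\<close>

lemma critical:
  "M_mom Q 0 *v vec_of_sym E_opt + M_mom Q 1 *v vec_of_sym (F_zero Q B) + b_mom 0 = 0"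
  "M_mom Q 1 *v vec_of_sym E_opt + M_mom Q 2 *v vec_of_sym (F_zero Q B) + b_mom 1 = 0"
proof -
  define f where "f = vec_of_sym (F_zero Q B)"
  define g where "g = vec_of_sym (inv_sym (L_map Q 0) (L_map Q 1 (F_zero Q B)))"
  define e where "e = vec_of_sym (E_zero Q B)"
  have eo: "vec_of_sym E_opt = - (g + e)" by (simp add: E_opt_def g_def e_def)
  have g: "M_mom Q 0 *v g = M_mom Q 1 *v f"
    unfolding g_def f_def using sym_map_inv_sym(2)[OF M0_inj sym_map_sym] by (simp add: vec_sym_map)
  have e: "M_mom Q 0 *v e = b_mom 0" unfolding e_def by (rule E_zero)
  have mi: "matrix_inv (M_mom Q 0) *v (M_mom Q 1 *v f) = g" unfolding g[symmetric] by (rule matrix_inv_M0)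
  have f: "M_mom Q 2 *v f - M_mom Q 1 *v g = M_mom Q 1 *v e - b_mom 1"
    using F_zero(2) unfolding M_star_mult f_def[symmetric] e_def[symmetric] mi .
  show "M_mom Q 0 *v vec_of_sym E_opt + M_mom Q 1 *v vec_of_sym (F_zero Q B) + b_mom 0 = 0"
    unfolding eo f_def[symmetric] by (simp add: vec.neg vec.diff g e)
  show "M_mom Q 1 *v vec_of_sym E_opt + M_mom Q 2 *v vec_of_sym (F_zero Q B) + b_mom 1 = 0"
    unfolding eo f_def[symmetric] using f by (simp add: vec.neg vec.diff algebra_simps)
qed

text \<open>Completing the square around the critical point: the term linear in the deviation is the
  first variation, which vanishes by \<open>critical\<close>, and the purely quadratic term
  integrates to \<open>W\<close>.\<close>

lemma Q2bar_eq:
  assumes E: "E \<in> symmetric_matrices" and F: "F \<in> symmetric_matrices"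
  shows "Q2bar Q B E F = Q2bar Q B E_opt (F_zero Q B)
    + W (vec_of_sym E - vec_of_sym E_opt) (vec_of_sym F - vec_of_sym (F_zero Q B))"
proof -
  define e f where "e = vec_of_sym E_opt" and "f = vec_of_sym (F_zero Q B)"
  define d h where "d = vec_of_sym E - e" and "h = vec_of_sym F - f"
  define b where "b t = vec_of_sym (B t)" for t
  define X where "X t = e + t *\<^sub>R f + b t" for t
  have bounded_meas_X: "bounded_meas X" unfolding X_def[abs_def] b_def
    by (intro bounded_meas_add bounded_meas_scaleR bounded_meas_const bounded_meas_ident bounded_meas_B)
  have Q2: "Q2bar Q B A G = (\<integral>t. (vec_of_sym A + t *\<^sub>R vec_of_sym G + b t) \<bullet> (M t *v (vec_of_sym A + t *\<^sub>R vec_of_sym G + b t)) \<partial>T)"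
    if "A \<in> symmetric_matrices" "G \<in> symmetric_matrices" for A G
    unfolding Q2bar_def
  proof (rule integral_cong_AE_lebesgue_on[OF thickness_lebesgue])
    show "AE t in T. Q t (A + t *\<^sub>R G + B t) =
      (vec_of_sym A + t *\<^sub>R vec_of_sym G + b t) \<bullet> (M t *v (vec_of_sym A + t *\<^sub>R vec_of_sym G + b t))"
      using Q_eq B_sym
    proof eventually_elim
      case (elim t)
      have "A + t *\<^sub>R G + B t \<in> symmetric_matrices"
        using that elim(2) by (intro symmetric_matrices_closed)
      with elim(1) show ?case by (simp add: b_def)
    qed
  qed
  have m: "has_bochner_integral T (\<lambda>t. X t \<bullet> (M t *v X t)) (Q2bar Q B E_opt (F_zero Q B))"
    unfolding Q2[OF E_opt_sym F_zero(1)] X_def[symmetric] e_def[symmetric] f_def[symmetric]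
    by (intro has_bochner_integral_integrable bounded_meas_integrable bounded_meas_inner_M bounded_meas_X)
  \<comment> \<open>The linear term, expanded into powers of \<open>t\<close>, including the powers
    0 and 1, so that each summand matches a moment; the value collects into \<open>critical\<close>
    tested with \<open>d\<close> and \<open>h\<close>.\<close>
  have "has_bochner_integral T (\<lambda>t.
      (t ^ 0 * (d \<bullet> (M t *v e)) + t ^ 1 * (d \<bullet> (M t *v f)) + t ^ 0 * (d \<bullet> (M t *v b t)))
      + (t ^ 1 * (h \<bullet> (M t *v e)) + t ^ 2 * (h \<bullet> (M t *v f)) + t ^ 1 * (h \<bullet> (M t *v b t))))
    ((d \<bullet> (M_mom Q 0 *v e) + d \<bullet> (M_mom Q 1 *v f) + d \<bullet> b_mom 0)
      + (h \<bullet> (M_mom Q 1 *v e) + h \<bullet> (M_mom Q 2 *v f) + h \<bullet> b_mom 1))"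
    unfolding b_def by (intro has_bochner_integral_add inner_M_mom inner_b_mom)
  moreover have "(d \<bullet> (M_mom Q 0 *v e) + d \<bullet> (M_mom Q 1 *v f) + d \<bullet> b_mom 0)
      + (h \<bullet> (M_mom Q 1 *v e) + h \<bullet> (M_mom Q 2 *v f) + h \<bullet> b_mom 1) = 0"
    using critical unfolding e_def[symmetric] f_def[symmetric] by (simp flip: inner_add_right)
  moreover have "(t ^ 0 * (d \<bullet> (M t *v e)) + t ^ 1 * (d \<bullet> (M t *v f)) + t ^ 0 * (d \<bullet> (M t *v b t)))
      + (t ^ 1 * (h \<bullet> (M t *v e)) + t ^ 2 * (h \<bullet> (M t *v f)) + t ^ 1 * (h \<bullet> (M t *v b t)))
      = (d + t *\<^sub>R h) \<bullet> (M t *v X t)" for t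
    by (simp add: X_def matrix_vector_right_distrib matrix_vector_mult_scaleR inner_add_left inner_add_right
        power2_eq_square algebra_simps)
  ultimately have l: "has_bochner_integral T (\<lambda>t. (d + t *\<^sub>R h) \<bullet> (M t *v X t)) 0" by simp
  have "Q2bar Q B E F = (\<integral>t. (X t + (d + t *\<^sub>R h)) \<bullet> (M t *v (X t + (d + t *\<^sub>R h))) \<partial>T)"
    unfolding Q2[OF E F] by (simp add: X_def d_def h_def algebra_simps)
  also have "\<dots> = (\<integral>t. X t \<bullet> (M t *v X t) + 2 * ((d + t *\<^sub>R h) \<bullet> (M t *v X t)) + (d + t *\<^sub>R h) \<bullet> (M t *v (d + t *\<^sub>R h)) \<partial>T)"
  proof (rule integral_cong_AE_lebesgue_on[OF thickness_lebesgue])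
    show "AE t in T. (X t + (d + t *\<^sub>R h)) \<bullet> (M t *v (X t + (d + t *\<^sub>R h))) =
      X t \<bullet> (M t *v X t) + 2 * ((d + t *\<^sub>R h) \<bullet> (M t *v X t)) + (d + t *\<^sub>R h) \<bullet> (M t *v (d + t *\<^sub>R h))"
      using M_sym
    proof eventually_elim
      case (elim t)
      show ?case
        using symmetric_matrix_inner[OF elim, of "X t" "d + t *\<^sub>R h"]
        by (simp add: matrix_vector_right_distrib[of "M t" "X t" "d + t *\<^sub>R h"]
            inner_add_left[of "X t" "d + t *\<^sub>R h"] inner_add_right[of _ "M t *v X t"])
    qed
  qed
  also have "\<dots> = Q2bar Q B E_opt (F_zero Q B) + 2 * 0 + W d h"
    by (intro has_bochner_integral_integral_eq has_bochner_integral_add has_bochner_integral_mult_right m l W_integral)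
  finally show ?thesis by (simp add: d_def h_def e_def f_def)
qed

end

section \<open>Minimisers\<close>

lemma L2_on_mult:
  assumes "L2_on \<Omega> f" "L2_on \<Omega> g"
  shows "integrable (lebesgue_on \<Omega>) (\<lambda>x. f x * g x)"
proof (rule Bochner_Integration.integrable_bound)
  show "integrable (lebesgue_on \<Omega>) (\<lambda>x. (f x)\<^sup>2 + (g x)\<^sup>2)" using assms by (simp add: L2_on_def)
  show "(\<lambda>x. f x * g x) \<in> borel_measurable (lebesgue_on \<Omega>)"
    by (rule borel_measurable_times) (use assms in \<open>simp_all add: L2_on_def\<close>)
  have "\<bar>a * b\<bar> \<le> a\<^sup>2 + b\<^sup>2" for a b :: real
  proof -
    have "2 * (\<bar>a\<bar> * \<bar>b\<bar>) \<le> a\<^sup>2 + b\<^sup>2" using sum_squares_bound[of "\<bar>a\<bar>" "\<bar>b\<bar>"] by simp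
    moreover have "0 \<le> \<bar>a\<bar> * \<bar>b\<bar>" by simp
    ultimately show ?thesis unfolding abs_mult by linarith
  qed
  then show "AE x in lebesgue_on \<Omega>. norm (f x * g x) \<le> norm ((f x)\<^sup>2 + (g x)\<^sup>2)" by simp
qed

lemma L2_on_add:
  assumes "L2_on \<Omega> f" "L2_on \<Omega> g"
  shows "L2_on \<Omega> (\<lambda>x. f x + g x)"
proof -
  have "integrable (lebesgue_on \<Omega>) (\<lambda>x. (f x)\<^sup>2 + (g x)\<^sup>2 + 2 * (f x * g x))"
    using assms L2_on_mult[OF assms] by (simp add: L2_on_def)
  then have "integrable (lebesgue_on \<Omega>) (\<lambda>x. (f x + g x)\<^sup>2)"
    by (simp add: power2_sum mult.assoc)
  moreover have "(\<lambda>x. f x + g x) \<in> borel_measurable (lebesgue_on \<Omega>)"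
    by (rule borel_measurable_add) (use assms in \<open>simp_all add: L2_on_def\<close>)
  ultimately show ?thesis by (simp add: L2_on_def)
qed

lemma L2_on_cmult:
  assumes "L2_on \<Omega> f"
  shows "L2_on \<Omega> (\<lambda>x. r * f x)"
proof -
  have "(\<lambda>x. r * f x) \<in> borel_measurable (lebesgue_on \<Omega>)"
    by (rule borel_measurable_times[OF borel_measurable_const]) (use assms in \<open>simp add: L2_on_def\<close>)
  then show ?thesis using assms by (simp add: L2_on_def power_mult_distrib)
qed

lemma integrable_inner_matrix:
  fixes N :: "real^3^3"
  assumes "\<And>i. L2_on \<Omega> (\<lambda>x. d x $ i)" "\<And>i. L2_on \<Omega> (\<lambda>x. f x $ i)"
  shows "integrable (lebesgue_on \<Omega>) (\<lambda>x. d x \<bullet> (N *v f x))"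
proof -
  have "integrable (lebesgue_on \<Omega>) (\<lambda>x. N $ i $ j * (d x $ i * f x $ j))" for i j
    by (intro integrable_mult_right L2_on_mult assms)
  then have "integrable (lebesgue_on \<Omega>) (\<lambda>x. d x $ i * N $ i $ j * f x $ j)" for i j
    by (simp add: mult_ac)
  then show ?thesis unfolding inner_matrix_vector_3 by (intro Bochner_Integration.integrable_sum)
qed

section \<open>The energy of admissible pairs on a fixed domain\<close>

context plate
begin

context
  fixes \<omega> :: "(real^2) set"
  assumes \<omega>: "open \<omega>" "connected \<omega>" "bounded \<omega>"
begin

abbreviation admissible :: "(real^2 \<Rightarrow> real^2) \<Rightarrow> (real^2 \<Rightarrow> real) \<Rightarrow> bool" where
  "admissible u v \<equiv> (\<forall>i. (\<lambda>x. u x $ i) \<in> sobolev2 1 \<omega>) \<and> v \<in> sobolev2 2 \<omega>"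

definition excess :: "(real^2 \<Rightarrow> real^2) \<Rightarrow> (real^2 \<Rightarrow> real) \<Rightarrow> real^2 \<Rightarrow> real" where
  "excess u v x = W (vec_of_sym (sym_grad \<omega> u x) - vec_of_sym E_opt)
     (vec_of_sym (- weak_hessian \<omega> v x) - vec_of_sym (F_zero Q B))"

definition minimum :: real where
  "minimum = 1/2 * (\<integral>x. Q2bar Q B E_opt (F_zero Q B) \<partial>lebesgue_on \<omega>)"

text \<open>Rules out the default value 0 of the integral. It is needed to separate the minimum from
  the excess and to conclude from a zero integral that the excess vanishes almost
  everywhere.\<close>

lemma integrable_excess:
  assumes "admissible u v"
  shows "integrable (lebesgue_on \<omega>) (excess u v)"
proof -
  have const: "L2_on \<omega> (\<lambda>x. k)" for k
    by (rule L2_on_continuous[OF \<omega>(1,3) continuous_on_const])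
  have u: "L2_on \<omega> (\<lambda>x. weak_deriv \<omega> [j] (\<lambda>y. u y $ i) x)" for i j
    by (rule weak_deriv_sobolev2(2)[OF \<omega>(1)]) (use assms in auto)
  have v: "L2_on \<omega> (\<lambda>x. weak_deriv \<omega> [i, j] v x)" for i j
    by (rule weak_deriv_sobolev2(2)[OF \<omega>(1)]) (use assms in auto)
  have "L2_on \<omega> (\<lambda>x. 1/2 * (weak_deriv \<omega> [j] (\<lambda>y. u y $ i) x + weak_deriv \<omega> [i] (\<lambda>y. u y $ j) x) + k)" for i j k
    by (intro L2_on_add L2_on_cmult u const)
  from this[of _ _ "- k" for k] have sg: "L2_on \<omega> (\<lambda>x. sym_grad \<omega> u x $ i $ j - k)" for i j k
    unfolding sym_grad_def weak_grad_def by (simp add: transpose_def)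
  have "L2_on \<omega> (\<lambda>x. (- 1) * weak_deriv \<omega> [i, j] v x + k)" for i j k
    by (intro L2_on_add L2_on_cmult v const)
  from this[of _ _ "- k" for k] have wh: "L2_on \<omega> (\<lambda>x. - weak_hessian \<omega> v x $ i $ j - k)" for i j k
    unfolding weak_hessian_def by simp
  have "L2_on \<omega> (\<lambda>x. (vec_of_sym (sym_grad \<omega> u x) - vec_of_sym E_opt) $ i)" for i
    using exhaust_3[of i] sg by auto
  moreover have "L2_on \<omega> (\<lambda>x. (vec_of_sym (- weak_hessian \<omega> v x) - vec_of_sym (F_zero Q B)) $ i)" for i
    using exhaust_3[of i] wh by auto
  ultimately show ?thesis
    unfolding excess_def[abs_def] W_def
    by (intro Bochner_Integration.integrable_add integrable_mult_right integrable_inner_matrix)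
qed

lemma energy_eq:
  assumes uv: "admissible u v"
  shows "I_lvK \<omega> Q B u v = ereal (minimum + 1/2 * (\<integral>x. excess u v x \<partial>lebesgue_on \<omega>))"
proof -
  interpret finite_measure "lebesgue_on \<omega>"
    using bounded_set_imp_lmeasurable[OF \<omega>(3)] \<omega>(1) by (intro finite_measure_lebesgue_on) simp
  have l: "\<omega> \<in> sets lebesgue" using \<omega>(1) by simp
  have "(\<integral>x. Q2bar Q B (sym_grad \<omega> u x) (- weak_hessian \<omega> v x) \<partial>lebesgue_on \<omega>) =
      (\<integral>x. Q2bar Q B E_opt (F_zero Q B) + excess u v x \<partial>lebesgue_on \<omega>)"
  proof (rule integral_cong_AE_lebesgue_on[OF l])
    show "AE x in lebesgue_on \<omega>. Q2bar Q B (sym_grad \<omega> u x) (- weak_hessian \<omega> v x) =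
        Q2bar Q B E_opt (F_zero Q B) + excess u v x"
      \<comment> \<open>The symmetrised gradient is symmetric at every point, but the Hessian only
        off a null set, where \<open>Q2bar_eq\<close> applies.\<close>
      using weak_hessian_symmetric[OF \<omega>(1) conjunct2[OF uv]]
    proof eventually_elim
      case (elim x)
      show ?case unfolding excess_def
        by (rule Q2bar_eq[OF sym_grad_symmetric symmetric_matrices_closed(3)[OF elim]])
    qed
  qed
  also have "\<dots> = (\<integral>x. Q2bar Q B E_opt (F_zero Q B) \<partial>lebesgue_on \<omega>) + (\<integral>x. excess u v x \<partial>lebesgue_on \<omega>)"
    by (rule Bochner_Integration.integral_add[OF integrable_const integrable_excess[OF uv]])
  finally show ?thesis
    unfolding I_lvK_def if_P[OF uv] minimum_def by (simp only: distrib_left)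
qed

definition optimal :: "(real^2 \<Rightarrow> real^2) \<Rightarrow> (real^2 \<Rightarrow> real) \<Rightarrow> bool" where
  "optimal u v \<longleftrightarrow> admissible u v \<and> (AE x in lebesgue_on \<omega>. sym_grad \<omega> u x = E_opt)
     \<and> (AE x in lebesgue_on \<omega>. weak_hessian \<omega> v x = - F_zero Q B)"

lemma energy_optimal:
  assumes "optimal u v"
  shows "I_lvK \<omega> Q B u v = ereal minimum"
proof -
  have "AE x in lebesgue_on \<omega>. sym_grad \<omega> u x = E_opt" "AE x in lebesgue_on \<omega>. weak_hessian \<omega> v x = - F_zero Q B"
    using assms unfolding optimal_def by blast+
  then have "AE x in lebesgue_on \<omega>. excess u v x = 0"
    by eventually_elim (simp add: excess_def W_def)
  then have "(\<integral>x. excess u v x \<partial>lebesgue_on \<omega>) = 0" by (rule integral_eq_zero_AE)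
  then show ?thesis using energy_eq assms by (simp add: optimal_def)
qed

lemma energy_ge: "ereal minimum \<le> I_lvK \<omega> Q B u v"
proof (cases "admissible u v")
  case True
  have "0 \<le> (\<integral>x. excess u v x \<partial>lebesgue_on \<omega>)"
    by (rule Bochner_Integration.integral_nonneg) (simp add: excess_def W_nonneg)
  then show ?thesis unfolding energy_eq[OF True] by simp
next
  case False
  then have "I_lvK \<omega> Q B u v = \<infinity>" unfolding I_lvK_def by (rule if_not_P)
  then show ?thesis by simp
qed

text \<open>A finite bound forces admissibility. Then the nonnegative excess has integral 0, hence
  is 0 almost everywhere, and definiteness of \<open>W\<close> pins down both fields.\<close>

lemma energy_le_imp_optimal:
  assumes "I_lvK \<omega> Q B u v \<le> ereal minimum"
  shows "optimal u v"
proof -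
  have adm: "admissible u v"
  proof (rule ccontr)
    assume "\<not> admissible u v"
    then have "I_lvK \<omega> Q B u v = \<infinity>" unfolding I_lvK_def by (rule if_not_P)
    then show False using assms by simp
  qed
  have nonneg: "AE x in lebesgue_on \<omega>. 0 \<le> excess u v x" by (simp add: excess_def W_nonneg)
  have "(\<integral>x. excess u v x \<partial>lebesgue_on \<omega>) \<le> 0" using assms unfolding energy_eq[OF adm] by simp
  moreover have "0 \<le> (\<integral>x. excess u v x \<partial>lebesgue_on \<omega>)" by (rule integral_nonneg_AE[OF nonneg])
  ultimately have "(\<integral>x. excess u v x \<partial>lebesgue_on \<omega>) = 0" by linarith
  then have "AE x in lebesgue_on \<omega>. excess u v x = 0"
    using integral_nonneg_eq_0_iff_AE[OF integrable_excess[OF adm] nonneg] by blast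
  then have *: "AE x in lebesgue_on \<omega>. sym_grad \<omega> u x = E_opt \<and> weak_hessian \<omega> v x = - F_zero Q B"
    using weak_hessian_symmetric[OF \<omega>(1) conjunct2[OF adm]]
  proof eventually_elim
    case (elim x)
    have "vec_of_sym (sym_grad \<omega> u x) = vec_of_sym E_opt"
      using W_eq_0(1)[OF elim(1)[unfolded excess_def]] by simp
    \<comment> \<open>\<open>vec_of_sym\<close> forgets the lower left entry, so cancelling it
      requires both matrices to be symmetric.\<close>
    then have "sym_grad \<omega> u x = E_opt"
      using sym_of_vec_of_sym[OF sym_grad_symmetric] sym_of_vec_of_sym[OF E_opt_sym] by metis
    moreover have "vec_of_sym (- weak_hessian \<omega> v x) = vec_of_sym (F_zero Q B)"
      using W_eq_0(2)[OF elim(1)[unfolded excess_def]] by simp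
    then have "- weak_hessian \<omega> v x = F_zero Q B"
      using sym_of_vec_of_sym[OF symmetric_matrices_closed(3)[OF elim(2)]] sym_of_vec_of_sym[OF F_zero(1)] by metis
    then have "weak_hessian \<omega> v x = - F_zero Q B" by (metis minus_minus)
    ultimately show ?case by blast
  qed
  then show ?thesis using adm by (simp add: optimal_def)
qed

lemma minus_matrix_vector: "- (A :: real^2^2) *v x = - (A *v x)"
  by (simp add: matrix_vector_mult_def vec_eq_iff sum_negf)

lemma optimal_iff:
  "optimal u v \<longleftrightarrow>
     (\<exists>r. infinitesimal_rigid_motion r \<and> (AE x in lebesgue_on \<omega>. u x = E_opt *v x + r x)) \<and>
     (\<exists>l. affine_function l \<and> (AE x in lebesgue_on \<omega>. v x = - (1/2) * (x \<bullet> (F_zero Q B *v x)) + l x))"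
  (is "_ \<longleftrightarrow> ?U \<and> ?V")
proof
  have F: "transpose (- F_zero Q B) = - F_zero Q B"
    using symmetric_matrices_closed(3)[OF F_zero(1)] by (simp add: symmetric_matrices_def)
  have E: "transpose E_opt = E_opt" using E_opt_sym by (simp add: symmetric_matrices_def)
  {
    assume o: "optimal u v"
    have ?U
      by (rule sym_grad_const_imp_rigid[OF \<omega>(1,2) _ E]) (use o in \<open>auto simp: optimal_def\<close>)
    moreover have ?V
      using weak_hessian_const_imp_quadratic[OF \<omega>(1,2) _ F, of v] o
      by (simp add: optimal_def minus_matrix_vector)
    ultimately show "?U \<and> ?V" ..
  next
    assume "?U \<and> ?V"
    then obtain R k p d where R: "transpose R = - R" and
      u: "AE x in lebesgue_on \<omega>. u x = E_opt *v x + (R *v x + k)" and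
      v: "AE x in lebesgue_on \<omega>. v x = - (1/2) * (x \<bullet> (F_zero Q B *v x)) + (p \<bullet> x + d)"
      unfolding infinitesimal_rigid_motion_def affine_function_def by blast
    have u': "AE x in lebesgue_on \<omega>. u x = (E_opt + R) *v x + k"
      using u by eventually_elim (simp add: matrix_vector_mult_add_rdistrib)
    have v': "AE x in lebesgue_on \<omega>. v x = 1/2 * (x \<bullet> (- F_zero Q B *v x)) + p \<bullet> x + d"
      using v by eventually_elim (simp add: minus_matrix_vector)
    \<comment> \<open>The skew part of the rigid motion cancels under symmetrisation.\<close>
    have "(1/2) *\<^sub>R (E_opt + R + transpose (E_opt + R)) = E_opt"
    proof -
      have "transpose (E_opt + R) = transpose E_opt + transpose R"
        by (simp add: transpose_def vec_eq_iff)
      then have "transpose (E_opt + R) = E_opt - R" unfolding E R by simp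
      then have "E_opt + R + transpose (E_opt + R) = 2 *\<^sub>R E_opt" by (simp add: scaleR_2)
      then show ?thesis by simp
    qed
    then show "optimal u v"
      using affine_sobolev2[OF \<omega>(1,3) u'] quadratic_sobolev2[OF \<omega>(1,3) F v'] unfolding optimal_def by simp
  }
qed

text \<open>Since \<open>is_arg_min\<close> only compares with other pairs, an optimal pair has to
  be exhibited: comparing a minimiser with it bounds the minimiser's energy by
  \<open>minimum\<close>.\<close>

lemma is_arg_min_iff_optimal:
  "is_arg_min (\<lambda>(u, v). I_lvK \<omega> Q B u v) (\<lambda>_. True) (u, v) \<longleftrightarrow> optimal u v"
proof
  \<comment> \<open>The witness has the zero rigid motion and the zero affine function.\<close>
  have "optimal (\<lambda>x. E_opt *v x + 0) (\<lambda>x. - (1/2) * (x \<bullet> (F_zero Q B *v x)) + 0)"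
    unfolding optimal_iff infinitesimal_rigid_motion_def affine_function_def
    by (intro conjI exI[of _ "\<lambda>x. 0"] exI[of _ 0] AE_I2) (simp_all add: transpose_def vec_eq_iff)
  then obtain u\<^sub>0 v\<^sub>0 where "I_lvK \<omega> Q B u\<^sub>0 v\<^sub>0 = ereal minimum" using energy_optimal by blast
  moreover assume "is_arg_min (\<lambda>(u, v). I_lvK \<omega> Q B u v) (\<lambda>_. True) (u, v)"
  ultimately have "I_lvK \<omega> Q B u v \<le> ereal minimum"
    unfolding is_arg_min_def by (auto simp: not_less) metis
  then show "optimal u v" by (rule energy_le_imp_optimal)
next
  assume "optimal u v"
  then show "is_arg_min (\<lambda>(u, v). I_lvK \<omega> Q B u v) (\<lambda>_. True) (u, v)"
    using energy_ge by (simp add: is_arg_min_def energy_optimal not_less)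
qed

end

end

text \<open>The equivalence contains existence, since the right-hand side is satisfied with
  \<open>r\<close> and \<open>l\<close> zero, and uniqueness, since two pairs satisfying it differ
  almost everywhere by a rigid motion and an affine function. Both minus signs, opposite to the
  formulas of the English statement, are forced: the first by \<open>critical\<close>, the second by
  the argument \<open>- weak_hessian \<omega> v x\<close> of the density.\<close>

theorem theorem1:
  fixes \<omega> :: "(real^2) set"
    and Q :: "real \<Rightarrow> real^2^2 \<Rightarrow> real"
    and B :: "real \<Rightarrow> real^2^2"
    and c C :: real
    and u :: "real^2 \<Rightarrow> real^2"
    and v :: "real^2 \<Rightarrow> real"
  assumes "bounded \<omega>" and "lipschitz_domain \<omega>"
    and "\<And>G. (\<lambda>t. Q t G) \<in> borel_measurable (lebesgue_on thickness)"
    and "AE t in lebesgue_on thickness.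
           quadratic_form (Q t) \<and> (\<forall>G. transpose G = - G \<longrightarrow> Q t G = 0)"
    and "0 < c" and "0 < C"
    and "AE t in lebesgue_on thickness.
           (\<forall>G. Q t G \<le> C * (norm G)\<^sup>2) \<and> (\<forall>G\<in>symmetric_matrices. c * (norm G)\<^sup>2 \<le> Q t G)"
    and "B \<in> borel_measurable (lebesgue_on thickness)"
    and "AE t in lebesgue_on thickness. B t \<in> symmetric_matrices"
    and "\<exists>K. AE t in lebesgue_on thickness. norm (B t) \<le> K"
  shows "is_arg_min (\<lambda>(u, v). I_lvK \<omega> Q B u v) (\<lambda>_. True) (u, v) \<longleftrightarrow>
     (\<exists>r. infinitesimal_rigid_motion r \<and>
        (AE x in lebesgue_on \<omega>.
           u x = - (inv_sym (L_map Q 0) (L_map Q 1 (F_zero Q B)) + E_zero Q B) *v x + r x)) \<and>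
     (\<exists>l. affine_function l \<and>
        (AE x in lebesgue_on \<omega>. v x = - (1/2) * (x \<bullet> (F_zero Q B *v x)) + l x))"
proof -
  interpret plate Q B c C
  proof
    show "AE t in lebesgue_on thickness. quadratic_form (Q t)"
      using assms(4) by eventually_elim blast
  qed (fact assms)+
  have \<omega>: "open \<omega>" "connected \<omega>" using assms(2) by (simp_all add: lipschitz_domain_def)
  show ?thesis
    unfolding is_arg_min_iff_optimal[OF \<omega> assms(1)] optimal_iff[OF \<omega> assms(1)] E_opt_def ..
qed

end
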